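(* Assume the consistency of ZFC + "there is an inaccessible cardinal". Then there is a model of KMCU which has no definable (without parameters) map that fulfills Hume's Principle for classes.
   Context: KMU (Kelley–Morse class theory with urelements) is a two-sorted theory of objects and classes of objects, with membership $\in$ and a predicate $\mathscr{A}$ for urelements; a set is an object that is not a urelement. Its axioms are: urelements have no members; Extensionality for sets and for classes; Foundation; Pairing; Union; Powerset; Infinity; Replacement (if a class $F$ is a function and $x$ is a set then $\{F(y):y\in x\cap\mathrm{dom}(F)\}$ is a set); Separation (the intersection of a set with a class is a set); and the full (impredicative) class comprehension schema: for every second-order formula $\varphi$, possibly with class quantifiers and with object and class parameters, $\{x:\varphi(x)\}$ is a class. The urelements may form a proper class. KMCU is KMU plus Global Well-Ordering: there is a class that is a well-ordering of the class $U$ of all objects (a linear order in which every non-empty class has a least element). A map $X\mapsto\#X$ from classes to objects fulfills Hume's Principle for classes if for all classes $X,Y$: $\#X=\#Y$ if and only if $X\sim Y$, where $X\sim Y$ means there is a class that is a bijection between $X$ and $Y$. The map is definable if its graph is defined over the two-sorted model by a second-order formula $\varphi(X,y)$ without parameters. *)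

theory Defs
  imports Main
begin

section \<open>First-order set theory: formulas and provability\<close>

text \<open>
  Formulas of the language with membership and equality, with de Bruijn indices. The language is
  relational, so variables are the only terms and substitution is renaming of variables.
\<close>

datatype fm = Fls | Mem nat nat | Eq nat nat | Imp fm fm | All fm

definition Neg :: "fm \<Rightarrow> fm" where "Neg p = Imp p Fls"
definition Conj :: "fm \<Rightarrow> fm \<Rightarrow> fm" where "Conj p q = Neg (Imp p (Neg q))"
definition Disj :: "fm \<Rightarrow> fm \<Rightarrow> fm" where "Disj p q = Imp (Neg p) q"
definition Iff :: "fm \<Rightarrow> fm \<Rightarrow> fm" where "Iff p q = Conj (Imp p q) (Imp q p)"
definition Ex :: "fm \<Rightarrow> fm" where "Ex p = Neg (All (Neg p))"

primrec ren :: "(nat \<Rightarrow> nat) \<Rightarrow> fm \<Rightarrow> fm" where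
  "ren r Fls = Fls"
| "ren r (Mem i j) = Mem (r i) (r j)"
| "ren r (Eq i j) = Eq (r i) (r j)"
| "ren r (Imp p q) = Imp (ren r p) (ren r q)"
| "ren r (All p) = All (ren (case_nat 0 (\<lambda>i. Suc (r i))) p)"

abbreviation lift :: "fm \<Rightarrow> fm" where "lift \<equiv> ren Suc"

text \<open>\<open>inst p t\<close> is the body \<open>p\<close> of a quantifier with its bound variable replaced by the variable \<open>t\<close>.\<close>

abbreviation inst :: "fm \<Rightarrow> nat \<Rightarrow> fm" where "inst p t \<equiv> ren (case_nat t (\<lambda>i. i)) p"

text \<open>Classical natural deduction with equality; the hypotheses may form an infinite set.\<close>

inductive proves :: "fm set \<Rightarrow> fm \<Rightarrow> bool" (infix "\<turnstile>" 50) where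
  assm: "p \<in> G \<Longrightarrow> G \<turnstile> p"
| impI: "insert p G \<turnstile> q \<Longrightarrow> G \<turnstile> Imp p q"
| impE: "G \<turnstile> Imp p q \<Longrightarrow> G \<turnstile> p \<Longrightarrow> G \<turnstile> q"
| contr: "insert (Neg p) G \<turnstile> Fls \<Longrightarrow> G \<turnstile> p"
| allI: "lift ` G \<turnstile> p \<Longrightarrow> G \<turnstile> All p"
| allE: "G \<turnstile> All p \<Longrightarrow> G \<turnstile> inst p t"
| eqI: "G \<turnstile> Eq t t"
| eqE: "G \<turnstile> Eq s t \<Longrightarrow> G \<turnstile> inst p s \<Longrightarrow> G \<turnstile> inst p t"

definition consistent :: "fm set \<Rightarrow> bool" where
  "consistent T \<longleftrightarrow> \<not> T \<turnstile> Fls"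

text \<open>All free variables of \<open>p\<close> are below \<open>fv_bound p\<close>.\<close>

primrec fv_bound :: "fm \<Rightarrow> nat" where
  "fv_bound Fls = 0"
| "fv_bound (Mem i j) = max (Suc i) (Suc j)"
| "fv_bound (Eq i j) = max (Suc i) (Suc j)"
| "fv_bound (Imp p q) = max (fv_bound p) (fv_bound q)"
| "fv_bound (All p) = fv_bound p - 1"

definition univ_closure :: "fm \<Rightarrow> fm" where
  "univ_closure p = (All ^^ fv_bound p) p"

text \<open>
  Tarskian satisfaction in a structure \<open>(UNIV, E)\<close>. It is used only to state, as simplification
  rules, what the de Bruijn formulas below say.
\<close>

primrec sat :: "('a \<Rightarrow> 'a \<Rightarrow> bool) \<Rightarrow> (nat \<Rightarrow> 'a) \<Rightarrow> fm \<Rightarrow> bool" where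
  "sat E v Fls = False"
| "sat E v (Mem i j) = E (v i) (v j)"
| "sat E v (Eq i j) = (v i = v j)"
| "sat E v (Imp p q) = (sat E v p \<longrightarrow> sat E v q)"
| "sat E v (All p) = (\<forall>x. sat E (case_nat x v) p)"

lemma sat_connectives [simp]:
  "sat E v (Neg p) \<longleftrightarrow> \<not> sat E v p"
  "sat E v (Conj p q) \<longleftrightarrow> sat E v p \<and> sat E v q"
  "sat E v (Disj p q) \<longleftrightarrow> sat E v p \<or> sat E v q"
  "sat E v (Iff p q) \<longleftrightarrow> (sat E v p \<longleftrightarrow> sat E v q)"
  "sat E v (Ex p) \<longleftrightarrow> (\<exists>x. sat E (case_nat x v) p)"
  by (auto simp: Neg_def Conj_def Disj_def Iff_def Ex_def)

lemma sat_ren: "sat E v (ren r p) \<longleftrightarrow> sat E (\<lambda>i. v (r i)) p"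
proof (induction p arbitrary: v r)
  case (All p)
  have "(\<lambda>i. case_nat x v (case_nat 0 (\<lambda>i. Suc (r i)) i)) = case_nat x (\<lambda>i. v (r i))" for x
    by (auto split: nat.split)
  then show ?case by (simp add: All)
qed auto


section \<open>ZFC with an inaccessible cardinal\<close>

definition BAll :: "nat \<Rightarrow> fm \<Rightarrow> fm" where "BAll a p = All (Imp (Mem 0 (Suc a)) p)"
definition BEx :: "nat \<Rightarrow> fm \<Rightarrow> fm" where "BEx a p = Ex (Conj (Mem 0 (Suc a)) p)"

lemma sat_bounded [simp]:
  "sat E v (BAll a p) \<longleftrightarrow> (\<forall>x. E x (v a) \<longrightarrow> sat E (case_nat x v) p)"
  "sat E v (BEx a p) \<longleftrightarrow> (\<exists>x. E x (v a) \<and> sat E (case_nat x v) p)"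
  by (simp_all add: BAll_def BEx_def)

definition empty_fm :: "nat \<Rightarrow> fm" where
  "empty_fm a = All (Neg (Mem 0 (a+1)))"
definition subset_fm :: "nat \<Rightarrow> nat \<Rightarrow> fm" where
  "subset_fm a b = BAll a (Mem 0 (b+1))"
definition succ_fm :: "nat \<Rightarrow> nat \<Rightarrow> fm" where
  "succ_fm s y = All (Iff (Mem 0 (s+1)) (Disj (Mem 0 (y+1)) (Eq 0 (y+1))))"
definition power_fm :: "nat \<Rightarrow> nat \<Rightarrow> fm" where
  "power_fm p a = All (Iff (Mem 0 (p+1)) (subset_fm 0 (a+1)))"
definition upair_fm :: "nat \<Rightarrow> nat \<Rightarrow> nat \<Rightarrow> fm" where
  "upair_fm p x y = All (Iff (Mem 0 (p+1)) (Disj (Eq 0 (x+1)) (Eq 0 (y+1))))"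
definition opair_fm :: "nat \<Rightarrow> nat \<Rightarrow> nat \<Rightarrow> fm" where
  "opair_fm p x y = Ex (Ex (Conj (upair_fm 1 (x+2) (x+2))
     (Conj (upair_fm 0 (x+2) (y+2)) (upair_fm (p+2) 1 0))))"
definition app_fm :: "nat \<Rightarrow> nat \<Rightarrow> nat \<Rightarrow> fm" where
  "app_fm f x y = BEx f (opair_fm 0 (x+1) (y+1))"
definition func_fm :: "nat \<Rightarrow> nat \<Rightarrow> nat \<Rightarrow> fm" where
  "func_fm f a b = Conj
     (BAll f (BEx (a+1) (BEx (b+2) (opair_fm 2 1 0))))
     (BAll a (BEx (b+1) (Conj (app_fm (f+2) 1 0)
        (BAll (b+2) (Imp (app_fm (f+3) 2 0) (Eq 0 1))))))"
definition bij_fm :: "nat \<Rightarrow> nat \<Rightarrow> nat \<Rightarrow> fm" where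
  "bij_fm f a b = Conj (func_fm f a b)
     (BAll b (BEx (a+1) (Conj (app_fm (f+2) 0 1)
        (BAll (a+2) (Imp (app_fm (f+3) 0 2) (Eq 0 1))))))"

text \<open>
  In the presence of Foundation, ordinals are the transitive sets of transitive sets.
\<close>

definition trans_fm :: "nat \<Rightarrow> fm" where
  "trans_fm a = BAll a (subset_fm 0 (a+1))"
definition ord_fm :: "nat \<Rightarrow> fm" where
  "ord_fm a = Conj (trans_fm a) (BAll a (trans_fm 0))"
definition limit_fm :: "nat \<Rightarrow> fm" where
  "limit_fm a = Conj (ord_fm a) (Conj (Neg (empty_fm a)) (BAll a (BEx (a+1) (succ_fm 0 1))))"
definition omega_fm :: "nat \<Rightarrow> fm" where
  "omega_fm a = Conj (limit_fm a) (BAll a (Neg (limit_fm 0)))"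
definition card_fm :: "nat \<Rightarrow> fm" where
  "card_fm k = Conj (ord_fm k) (BAll k (Neg (Ex (bij_fm 0 1 (k+2)))))"

text \<open>
  \<open>regular_fm k\<close>: every function from an element of \<open>k\<close> to \<open>k\<close> is bounded below \<open>k\<close>.
  \<open>strong_limit_fm k\<close>: for every \<open>a\<close> in \<open>k\<close>, the power set of \<open>a\<close> is in bijection with an
  element of \<open>k\<close>. In \<open>inaccessible_fm k\<close> these are applied only to uncountable cardinals \<open>k\<close>.
\<close>

definition regular_fm :: "nat \<Rightarrow> fm" where
  "regular_fm k = BAll k (All (Imp (func_fm 0 1 (k+2))
     (BEx (k+2) (BAll 2 (BAll (k+4) (Imp (app_fm 3 1 0) (Mem 0 2)))))))"
definition strong_limit_fm :: "nat \<Rightarrow> fm" where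
  "strong_limit_fm k = BAll k (BEx (k+1) (Ex (Ex (Conj (power_fm 1 3) (bij_fm 0 1 2)))))"
definition inaccessible_fm :: "nat \<Rightarrow> fm" where
  "inaccessible_fm k = Conj (card_fm k) (Conj (BEx k (omega_fm 0))
     (Conj (regular_fm k) (strong_limit_fm k)))"

definition inaccessible_axiom :: fm where
  "inaccessible_axiom = Ex (inaccessible_fm 0)"

definition ext_axiom :: fm where
  "ext_axiom = All (All (Imp (All (Iff (Mem 0 2) (Mem 0 1))) (Eq 1 0)))"
definition found_axiom :: fm where
  "found_axiom = All (Imp (Neg (empty_fm 0)) (BEx 0 (BAll 1 (Neg (Mem 0 1)))))"
definition pairing_axiom :: fm where
  "pairing_axiom = All (All (Ex (upair_fm 0 2 1)))"
definition union_axiom :: fm where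
  "union_axiom = All (Ex (All (Iff (Mem 0 1) (BEx 2 (Mem 1 0)))))"
definition power_axiom :: fm where
  "power_axiom = All (Ex (power_fm 0 1))"
definition infinity_axiom :: fm where
  "infinity_axiom = Ex (Conj (BEx 0 (empty_fm 0)) (BAll 0 (BEx 1 (succ_fm 0 1))))"
definition choice_axiom :: fm where
  "choice_axiom = All (Imp
     (Conj (BAll 0 (Neg (empty_fm 0)))
           (BAll 0 (BAll 1 (Imp (Ex (Conj (Mem 0 2) (Mem 0 1))) (Eq 1 0)))))
     (Ex (BAll 1 (Ex (Conj (Conj (Mem 0 1) (Mem 0 2))
        (All (Imp (Conj (Mem 0 2) (Mem 0 3)) (Eq 0 1))))))))"

text \<open>
  In Separation, variable 0 of \<open>p\<close> is the element; in Replacement, variables 0 and 1 of \<open>p\<close> are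
  the argument and the value. The next variable is the given set, the remaining ones are parameters.
\<close>

definition separation_axiom :: "fm \<Rightarrow> fm" where
  "separation_axiom p = univ_closure (All (Ex (All (Iff (Mem 0 1)
     (Conj (Mem 0 2) (ren (case_nat 0 (\<lambda>i. i+2)) p))))))"
definition replacement_axiom :: "fm \<Rightarrow> fm" where
  "replacement_axiom p = univ_closure (All (Imp
     (BAll 0 (All (All
        (Imp (ren (case_nat 2 (case_nat 1 (\<lambda>i. i+3))) p)
        (Imp (ren (case_nat 2 (case_nat 0 (\<lambda>i. i+3))) p) (Eq 1 0))))))
     (Ex (All (Iff (Mem 0 1)
        (BEx 2 (ren (case_nat 0 (case_nat 1 (\<lambda>i. i+3))) p)))))))"

definition ZFC :: "fm set" where
  "ZFC = {ext_axiom, found_axiom, pairing_axiom, union_axiom, power_axiom, infinity_axiom,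
          choice_axiom} \<union> range separation_axiom \<union> range replacement_axiom"

context
  fixes E :: "'a \<Rightarrow> 'a \<Rightarrow> bool"
begin

definition s_subset where "s_subset a b \<longleftrightarrow> (\<forall>x. E x a \<longrightarrow> E x b)"
definition s_succ where "s_succ s y \<longleftrightarrow> (\<forall>z. E z s \<longleftrightarrow> E z y \<or> z = y)"
definition s_power where "s_power p a \<longleftrightarrow> (\<forall>x. E x p \<longleftrightarrow> s_subset x a)"
definition s_upair where "s_upair p x y \<longleftrightarrow> (\<forall>z. E z p \<longleftrightarrow> z = x \<or> z = y)"
definition s_opair where
  "s_opair p x y \<longleftrightarrow> (\<exists>a b. s_upair a x x \<and> s_upair b x y \<and> s_upair p a b)"
definition s_app where "s_app f x y \<longleftrightarrow> (\<exists>p. E p f \<and> s_opair p x y)"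
definition s_func where
  "s_func f a b \<longleftrightarrow>
     (\<forall>p. E p f \<longrightarrow> (\<exists>x. E x a \<and> (\<exists>y. E y b \<and> s_opair p x y))) \<and>
     (\<forall>x. E x a \<longrightarrow> (\<exists>y. E y b \<and> s_app f x y \<and> (\<forall>z. E z b \<longrightarrow> s_app f x z \<longrightarrow> z = y)))"
definition s_bij where
  "s_bij f a b \<longleftrightarrow> s_func f a b \<and>
     (\<forall>y. E y b \<longrightarrow> (\<exists>x. E x a \<and> s_app f x y \<and> (\<forall>z. E z a \<longrightarrow> s_app f z y \<longrightarrow> z = x)))"
definition s_trans where "s_trans a \<longleftrightarrow> (\<forall>x. E x a \<longrightarrow> s_subset x a)"
definition s_ord where "s_ord a \<longleftrightarrow> s_trans a \<and> (\<forall>x. E x a \<longrightarrow> s_trans x)"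
definition s_limit where
  "s_limit a \<longleftrightarrow> s_ord a \<and> (\<exists>x. E x a) \<and> (\<forall>y. E y a \<longrightarrow> (\<exists>s. E s a \<and> s_succ s y))"
definition s_omega where "s_omega a \<longleftrightarrow> s_limit a \<and> (\<forall>x. E x a \<longrightarrow> \<not> s_limit x)"
definition s_card where "s_card k \<longleftrightarrow> s_ord k \<and> (\<forall>a. E a k \<longrightarrow> \<not> (\<exists>f. s_bij f a k))"
definition s_regular where
  "s_regular k \<longleftrightarrow> (\<forall>a. E a k \<longrightarrow> (\<forall>f. s_func f a k \<longrightarrow>
     (\<exists>b. E b k \<and> (\<forall>x. E x a \<longrightarrow> (\<forall>y. E y k \<longrightarrow> s_app f x y \<longrightarrow> E y b)))))"
definition s_strong_limit where
  "s_strong_limit k \<longleftrightarrow> (\<forall>a. E a k \<longrightarrow> (\<exists>b. E b k \<and> (\<exists>P f. s_power P a \<and> s_bij f P b)))"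

lemmas sat_fm_simps = sat.simps sat_connectives sat_bounded nat.case
  numeral_eq_Suc pred_numeral_simps BitM.simps One_nat_def add_Suc_right add_0_right

lemma sat_empty_fm [simp]: "sat E v (empty_fm i) \<longleftrightarrow> \<not> (\<exists>x. E x (v i))"
  by (simp add: empty_fm_def)
lemma sat_subset_fm [simp]: "sat E v (subset_fm i j) \<longleftrightarrow> s_subset (v i) (v j)"
  by (simp add: subset_fm_def s_subset_def numeral_eq_Suc)
lemma sat_succ_fm [simp]: "sat E v (succ_fm i j) \<longleftrightarrow> s_succ (v i) (v j)"
  by (simp add: succ_fm_def s_succ_def numeral_eq_Suc)
lemma sat_power_fm [simp]: "sat E v (power_fm i j) \<longleftrightarrow> s_power (v i) (v j)"
  by (simp add: power_fm_def s_power_def numeral_eq_Suc)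
lemma sat_upair_fm [simp]: "sat E v (upair_fm i j k) \<longleftrightarrow> s_upair (v i) (v j) (v k)"
  by (simp add: upair_fm_def s_upair_def numeral_eq_Suc)
lemma sat_opair_fm [simp]: "sat E v (opair_fm i j k) \<longleftrightarrow> s_opair (v i) (v j) (v k)"
  by (simp add: opair_fm_def s_opair_def numeral_eq_Suc)
lemma sat_app_fm [simp]: "sat E v (app_fm i j k) \<longleftrightarrow> s_app (v i) (v j) (v k)"
  by (simp add: app_fm_def s_app_def numeral_eq_Suc)
lemma sat_func_fm [simp]: "sat E v (func_fm i j k) \<longleftrightarrow> s_func (v i) (v j) (v k)"
  by (simp only: func_fm_def s_func_def sat_fm_simps sat_app_fm sat_opair_fm)
lemma sat_bij_fm [simp]: "sat E v (bij_fm i j k) \<longleftrightarrow> s_bij (v i) (v j) (v k)"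
  by (simp only: bij_fm_def s_bij_def sat_fm_simps sat_func_fm sat_app_fm)
lemma sat_trans_fm [simp]: "sat E v (trans_fm i) \<longleftrightarrow> s_trans (v i)"
  by (simp only: trans_fm_def s_trans_def sat_fm_simps sat_subset_fm)
lemma sat_ord_fm [simp]: "sat E v (ord_fm i) \<longleftrightarrow> s_ord (v i)"
  by (simp only: ord_fm_def s_ord_def sat_fm_simps sat_trans_fm)
lemma sat_limit_fm [simp]: "sat E v (limit_fm i) \<longleftrightarrow> s_limit (v i)"
  by (simp only: limit_fm_def s_limit_def sat_fm_simps sat_ord_fm sat_empty_fm sat_succ_fm not_not)
lemma sat_omega_fm [simp]: "sat E v (omega_fm i) \<longleftrightarrow> s_omega (v i)"
  by (simp only: omega_fm_def s_omega_def sat_fm_simps sat_limit_fm)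
lemma sat_card_fm [simp]: "sat E v (card_fm i) \<longleftrightarrow> s_card (v i)"
  by (simp only: card_fm_def s_card_def sat_fm_simps sat_ord_fm sat_bij_fm)
lemma sat_regular_fm [simp]: "sat E v (regular_fm i) \<longleftrightarrow> s_regular (v i)"
  by (simp only: regular_fm_def s_regular_def sat_fm_simps sat_func_fm sat_app_fm)
lemma sat_strong_limit_fm [simp]: "sat E v (strong_limit_fm i) \<longleftrightarrow> s_strong_limit (v i)"
  by (simp only: strong_limit_fm_def s_strong_limit_def sat_fm_simps sat_power_fm sat_bij_fm)

lemma sat_inaccessible_axiom:
  "sat E v inaccessible_axiom \<longleftrightarrow>
     (\<exists>k. s_card k \<and> (\<exists>w. E w k \<and> s_omega w) \<and> s_regular k \<and> s_strong_limit k)"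
  by (simp add: inaccessible_axiom_def inaccessible_fm_def)

lemma sat_ext_axiom:
  "sat E v ext_axiom \<longleftrightarrow> (\<forall>x y. (\<forall>z. E z x \<longleftrightarrow> E z y) \<longrightarrow> x = y)"
  by (simp add: ext_axiom_def numeral_eq_Suc)
lemma sat_found_axiom:
  "sat E v found_axiom \<longleftrightarrow> (\<forall>x. (\<exists>y. E y x) \<longrightarrow> (\<exists>y. E y x \<and> (\<forall>z. E z x \<longrightarrow> \<not> E z y)))"
  by (simp add: found_axiom_def numeral_eq_Suc)
lemma sat_pairing_axiom:
  "sat E v pairing_axiom \<longleftrightarrow> (\<forall>x y. \<exists>p. s_upair p x y)"
  by (simp add: pairing_axiom_def numeral_eq_Suc)
lemma sat_union_axiom:
  "sat E v union_axiom \<longleftrightarrow> (\<forall>x. \<exists>u. \<forall>z. E z u \<longleftrightarrow> (\<exists>y. E y x \<and> E z y))"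
  by (simp add: union_axiom_def numeral_eq_Suc)
lemma sat_power_axiom:
  "sat E v power_axiom \<longleftrightarrow> (\<forall>x. \<exists>p. s_power p x)"
  by (simp add: power_axiom_def numeral_eq_Suc)
lemma sat_infinity_axiom:
  "sat E v infinity_axiom \<longleftrightarrow> (\<exists>w. (\<exists>e. E e w \<and> \<not> (\<exists>x. E x e)) \<and>
     (\<forall>y. E y w \<longrightarrow> (\<exists>s. E s w \<and> s_succ s y)))"
  by (simp add: infinity_axiom_def numeral_eq_Suc)
lemma sat_choice_axiom:
  "sat E v choice_axiom \<longleftrightarrow> (\<forall>x.
     (\<forall>y. E y x \<longrightarrow> (\<exists>z. E z y)) \<and>
     (\<forall>y. E y x \<longrightarrow> (\<forall>z. E z x \<longrightarrow> (\<exists>u. E u y \<and> E u z) \<longrightarrow> y = z)) \<longrightarrow>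
     (\<exists>c. \<forall>y. E y x \<longrightarrow> (\<exists>!z. E z y \<and> E z c)))"
  by (simp add: choice_axiom_def numeral_eq_Suc Ex1_def)

lemma sat_cong_fv: "(\<And>i. i < fv_bound p \<Longrightarrow> v i = w i) \<Longrightarrow> sat E v p \<longleftrightarrow> sat E w p"
proof (induction p arbitrary: v w)
  case Fls
  show ?case by simp
next
  case (Mem i j)
  have "v i = w i" "v j = w j" by (rule Mem; simp add: less_max_iff_disj)+
  then show ?case by simp
next
  case (Eq i j)
  have "v i = w i" "v j = w j" by (rule Eq; simp add: less_max_iff_disj)+
  then show ?case by simp
next
  case (Imp p q)
  have "sat E v p \<longleftrightarrow> sat E w p"
    by (rule Imp.IH) (rule Imp.prems, simp add: less_max_iff_disj)
  moreover have "sat E v q \<longleftrightarrow> sat E w q"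
    by (rule Imp.IH) (rule Imp.prems, simp add: less_max_iff_disj)
  ultimately show ?case by simp
next
  case (All p)
  have "sat E (case_nat x v) p \<longleftrightarrow> sat E (case_nat x w) p" for x
  proof (rule All.IH)
    fix i assume "i < fv_bound p"
    then show "case_nat x v i = case_nat x w i"
      by (cases i) (simp_all add: All.prems[simplified])
  qed
  then show ?case by simp
qed

lemma sat_univ_closure: "sat E v (univ_closure p) \<longleftrightarrow> (\<forall>w. sat E w p)"
proof -
  define u where "u n v w = (\<lambda>i. if i < n then w i else v (i - n))"
    for n and v w :: "nat \<Rightarrow> 'a"
  have u_Suc: "u n (case_nat x v) w = u (Suc n) v (w(n := x))" for n x v w
    by (rule ext) (auto simp: u_def less_Suc_eq Suc_diff_Suc not_less diff_Suc split: nat.split)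
  have upd: "(\<forall>x w. P (w(n := x))) \<longleftrightarrow> (\<forall>w. P w)" for P :: "(nat \<Rightarrow> 'a) \<Rightarrow> bool" and n
  proof -
    have "P w" if "\<And>x w. P (w(n := x))" for w
      using that[where w = w and x = "w n"] by (simp only: fun_upd_triv)
    then show ?thesis by blast
  qed
  have *: "sat E v ((All ^^ n) p) \<longleftrightarrow> (\<forall>w. sat E (u n v w) p)" for n v
  proof (induction n arbitrary: v)
    case 0
    then show ?case by (simp add: u_def)
  next
    case (Suc n)
    have "sat E v ((All ^^ Suc n) p) \<longleftrightarrow> (\<forall>x w. sat E (u (Suc n) v (w(n := x))) p)"
      by (simp only: funpow.simps o_apply sat.simps Suc.IH u_Suc)
    then show ?case
      using upd[of "\<lambda>w. sat E (u (Suc n) v w) p" n] by (simp only:)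
  qed
  have "sat E (u (fv_bound p) v w) p \<longleftrightarrow> sat E w p" for w
    by (rule sat_cong_fv) (simp add: u_def)
  then show ?thesis
    by (simp only: univ_closure_def *)
qed

lemma sat_separation_axiom:
  "sat E v (separation_axiom p) \<longleftrightarrow> (\<forall>w a. \<exists>b. \<forall>x. E x b \<longleftrightarrow>
     E x a \<and> sat E (case_nat x (case_nat a w)) p)"
proof -
  have *: "(\<lambda>i. case_nat x (case_nat b (case_nat a w)) (case_nat 0 (\<lambda>i. i+2) i))
      = case_nat x (case_nat a w)" for x a b :: 'a and w
    by (rule ext) (auto split: nat.split)
  show ?thesis
    unfolding separation_axiom_def sat_univ_closure sat.simps sat_connectives sat_ren *
    by (simp add: numeral_eq_Suc)
qed

lemma sat_replacement_axiom:
  "sat E v (replacement_axiom p) \<longleftrightarrow> (\<forall>w a.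
     (\<forall>x. E x a \<longrightarrow> (\<forall>y z. sat E (case_nat x (case_nat y (case_nat a w))) p \<longrightarrow>
        sat E (case_nat x (case_nat z (case_nat a w))) p \<longrightarrow> y = z)) \<longrightarrow>
     (\<exists>b. \<forall>y. E y b \<longleftrightarrow> (\<exists>x. E x a \<and> sat E (case_nat x (case_nat y (case_nat a w))) p)))"
proof -
  have *: "(\<lambda>i. case_nat z (case_nat y (case_nat x (case_nat a w)))
          (case_nat 2 (case_nat 1 (\<lambda>i. i+3)) i)) = case_nat x (case_nat y (case_nat a w))"
    "(\<lambda>i. case_nat z (case_nat y (case_nat x (case_nat a w)))
          (case_nat 2 (case_nat 0 (\<lambda>i. i+3)) i)) = case_nat x (case_nat z (case_nat a w))"
    "(\<lambda>i. case_nat x (case_nat y (case_nat b (case_nat a w)))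
          (case_nat 0 (case_nat 1 (\<lambda>i. i+3)) i)) = case_nat x (case_nat y (case_nat a w))"
    for x y z a b :: 'a and w
    by (rule ext; auto simp: numeral_eq_Suc split: nat.split)+
  show ?thesis
    unfolding replacement_axiom_def sat_univ_closure sat.simps sat_connectives sat_bounded sat_ren *
    by (simp add: numeral_eq_Suc)
qed

end


section \<open>Two-sorted structures of objects and classes\<close>

text \<open>
  \<open>Ur M\<close> is the urelement predicate, \<open>mem M\<close> is membership of objects in objects and
  \<open>cmem M\<close> is membership of objects in classes. Only their values on \<open>Obj M\<close> and \<open>Cls M\<close> matter.
\<close>

record ('o, 'c) class_structure =
  Obj :: "'o set"
  Cls :: "'c set"
  Ur :: "'o \<Rightarrow> bool"
  mem :: "'o \<Rightarrow> 'o \<Rightarrow> bool"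
  cmem :: "'o \<Rightarrow> 'c \<Rightarrow> bool"

text \<open>
  Formulas of the two-sorted (second-order) language. Object variables and class variables have
  separate de Bruijn indices: \<open>COAll\<close> binds object variable 0 and \<open>CCAll\<close> class variable 0.
\<close>

datatype cfm =
    CFls
  | CUr nat
  | COMem nat nat
  | COEq nat nat
  | CMem nat nat
  | CEq nat nat
  | CImp cfm cfm
  | COAll cfm
  | CCAll cfm

primrec csat :: "('o, 'c) class_structure \<Rightarrow> (nat \<Rightarrow> 'o) \<Rightarrow> (nat \<Rightarrow> 'c) \<Rightarrow> cfm \<Rightarrow> bool" where
  "csat M v V CFls \<longleftrightarrow> False"
| "csat M v V (CUr i) \<longleftrightarrow> Ur M (v i)"
| "csat M v V (COMem i j) \<longleftrightarrow> mem M (v i) (v j)"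
| "csat M v V (COEq i j) \<longleftrightarrow> v i = v j"
| "csat M v V (CMem i j) \<longleftrightarrow> cmem M (v i) (V j)"
| "csat M v V (CEq i j) \<longleftrightarrow> V i = V j"
| "csat M v V (CImp p q) \<longleftrightarrow> (csat M v V p \<longrightarrow> csat M v V q)"
| "csat M v V (COAll p) \<longleftrightarrow> (\<forall>x\<in>Obj M. csat M (case_nat x v) V p)"
| "csat M v V (CCAll p) \<longleftrightarrow> (\<forall>X\<in>Cls M. csat M v (case_nat X V) p)"

primrec ofv :: "cfm \<Rightarrow> nat set" where
  "ofv CFls = {}"
| "ofv (CUr i) = {i}"
| "ofv (COMem i j) = {i, j}"
| "ofv (COEq i j) = {i, j}"
| "ofv (CMem i j) = {i}"
| "ofv (CEq i j) = {}"
| "ofv (CImp p q) = ofv p \<union> ofv q"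
| "ofv (COAll p) = {i. Suc i \<in> ofv p}"
| "ofv (CCAll p) = ofv p"

primrec cfv :: "cfm \<Rightarrow> nat set" where
  "cfv CFls = {}"
| "cfv (CUr i) = {}"
| "cfv (COMem i j) = {}"
| "cfv (COEq i j) = {}"
| "cfv (CMem i j) = {j}"
| "cfv (CEq i j) = {i, j}"
| "cfv (CImp p q) = cfv p \<union> cfv q"
| "cfv (COAll p) = cfv p"
| "cfv (CCAll p) = {i. Suc i \<in> cfv p}"


section \<open>The theories KMU and KMCU\<close>

definition is_set :: "('o, 'c) class_structure \<Rightarrow> 'o \<Rightarrow> bool" where
  "is_set M x \<longleftrightarrow> x \<in> Obj M \<and> \<not> Ur M x"

definition is_upair :: "('o, 'c) class_structure \<Rightarrow> 'o \<Rightarrow> 'o \<Rightarrow> 'o \<Rightarrow> bool" where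
  "is_upair M p x y \<longleftrightarrow> is_set M p \<and> (\<forall>z\<in>Obj M. mem M z p \<longleftrightarrow> z = x \<or> z = y)"

text \<open>Kuratowski pairs.\<close>

definition is_opair :: "('o, 'c) class_structure \<Rightarrow> 'o \<Rightarrow> 'o \<Rightarrow> 'o \<Rightarrow> bool" where
  "is_opair M p x y \<longleftrightarrow>
     (\<exists>a\<in>Obj M. \<exists>b\<in>Obj M. is_upair M a x x \<and> is_upair M b x y \<and> is_upair M p a b)"

definition is_relation :: "('o, 'c) class_structure \<Rightarrow> 'c \<Rightarrow> bool" where
  "is_relation M R \<longleftrightarrow> (\<forall>p\<in>Obj M. cmem M p R \<longrightarrow> (\<exists>x\<in>Obj M. \<exists>y\<in>Obj M. is_opair M p x y))"

definition related :: "('o, 'c) class_structure \<Rightarrow> 'c \<Rightarrow> 'o \<Rightarrow> 'o \<Rightarrow> bool" where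
  "related M R x y \<longleftrightarrow> (\<exists>p\<in>Obj M. is_opair M p x y \<and> cmem M p R)"

definition is_function :: "('o, 'c) class_structure \<Rightarrow> 'c \<Rightarrow> bool" where
  "is_function M F \<longleftrightarrow> is_relation M F \<and>
     (\<forall>x\<in>Obj M. \<forall>y\<in>Obj M. \<forall>z\<in>Obj M. related M F x y \<longrightarrow> related M F x z \<longrightarrow> y = z)"

definition is_bijection :: "('o, 'c) class_structure \<Rightarrow> 'c \<Rightarrow> 'c \<Rightarrow> 'c \<Rightarrow> bool" where
  "is_bijection M F X Y \<longleftrightarrow> is_function M F \<and>
     (\<forall>x\<in>Obj M. \<forall>y\<in>Obj M. related M F x y \<longrightarrow> cmem M x X \<and> cmem M y Y) \<and>
     (\<forall>x\<in>Obj M. cmem M x X \<longrightarrow> (\<exists>y\<in>Obj M. related M F x y)) \<and>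
     (\<forall>y\<in>Obj M. cmem M y Y \<longrightarrow> (\<exists>x\<in>Obj M. related M F x y)) \<and>
     (\<forall>x\<in>Obj M. \<forall>x'\<in>Obj M. \<forall>y\<in>Obj M. related M F x y \<longrightarrow> related M F x' y \<longrightarrow> x = x')"

definition equinumerous :: "('o, 'c) class_structure \<Rightarrow> 'c \<Rightarrow> 'c \<Rightarrow> bool" where
  "equinumerous M X Y \<longleftrightarrow> (\<exists>F\<in>Cls M. is_bijection M F X Y)"

definition ax_urelements :: "('o, 'c) class_structure \<Rightarrow> bool" where
  "ax_urelements M \<longleftrightarrow> (\<forall>x\<in>Obj M. Ur M x \<longrightarrow> \<not> (\<exists>z\<in>Obj M. mem M z x))"

definition ax_set_ext :: "('o, 'c) class_structure \<Rightarrow> bool" where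
  "ax_set_ext M \<longleftrightarrow> (\<forall>x y. is_set M x \<longrightarrow> is_set M y \<longrightarrow>
     (\<forall>z\<in>Obj M. mem M z x \<longleftrightarrow> mem M z y) \<longrightarrow> x = y)"

definition ax_class_ext :: "('o, 'c) class_structure \<Rightarrow> bool" where
  "ax_class_ext M \<longleftrightarrow> (\<forall>X\<in>Cls M. \<forall>Y\<in>Cls M.
     (\<forall>z\<in>Obj M. cmem M z X \<longleftrightarrow> cmem M z Y) \<longrightarrow> X = Y)"

definition ax_foundation :: "('o, 'c) class_structure \<Rightarrow> bool" where
  "ax_foundation M \<longleftrightarrow> (\<forall>x. is_set M x \<longrightarrow> (\<exists>y\<in>Obj M. mem M y x) \<longrightarrow>
     (\<exists>y\<in>Obj M. mem M y x \<and> \<not> (\<exists>z\<in>Obj M. mem M z x \<and> mem M z y)))"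

definition ax_pairing :: "('o, 'c) class_structure \<Rightarrow> bool" where
  "ax_pairing M \<longleftrightarrow> (\<forall>x\<in>Obj M. \<forall>y\<in>Obj M. \<exists>p. is_upair M p x y)"

definition ax_union :: "('o, 'c) class_structure \<Rightarrow> bool" where
  "ax_union M \<longleftrightarrow> (\<forall>x. is_set M x \<longrightarrow>
     (\<exists>u. is_set M u \<and> (\<forall>z\<in>Obj M. mem M z u \<longleftrightarrow> (\<exists>y\<in>Obj M. mem M y x \<and> mem M z y))))"

definition ax_powerset :: "('o, 'c) class_structure \<Rightarrow> bool" where
  "ax_powerset M \<longleftrightarrow> (\<forall>x. is_set M x \<longrightarrow>
     (\<exists>p. is_set M p \<and> (\<forall>y\<in>Obj M. mem M y p \<longleftrightarrow>
        is_set M y \<and> (\<forall>z\<in>Obj M. mem M z y \<longrightarrow> mem M z x))))"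

definition ax_infinity :: "('o, 'c) class_structure \<Rightarrow> bool" where
  "ax_infinity M \<longleftrightarrow> (\<exists>w. is_set M w \<and>
     (\<exists>e. is_set M e \<and> mem M e w \<and> \<not> (\<exists>z\<in>Obj M. mem M z e)) \<and>
     (\<forall>y\<in>Obj M. mem M y w \<longrightarrow> (\<exists>s. is_set M s \<and> mem M s w \<and>
        (\<forall>z\<in>Obj M. mem M z s \<longleftrightarrow> mem M z y \<or> z = y))))"

definition ax_replacement :: "('o, 'c) class_structure \<Rightarrow> bool" where
  "ax_replacement M \<longleftrightarrow> (\<forall>F\<in>Cls M. \<forall>x. is_function M F \<longrightarrow> is_set M x \<longrightarrow>
     (\<exists>r. is_set M r \<and> (\<forall>z\<in>Obj M. mem M z r \<longleftrightarrow>
        (\<exists>y\<in>Obj M. mem M y x \<and> related M F y z))))"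

definition ax_separation :: "('o, 'c) class_structure \<Rightarrow> bool" where
  "ax_separation M \<longleftrightarrow> (\<forall>x. \<forall>X\<in>Cls M. is_set M x \<longrightarrow>
     (\<exists>s. is_set M s \<and> (\<forall>z\<in>Obj M. mem M z s \<longleftrightarrow> mem M z x \<and> cmem M z X)))"

text \<open>Object variable 0 is the element; all other variables of \<open>p\<close> are parameters.\<close>

definition ax_comprehension :: "('o, 'c) class_structure \<Rightarrow> bool" where
  "ax_comprehension M \<longleftrightarrow> (\<forall>p v V. range v \<subseteq> Obj M \<longrightarrow> range V \<subseteq> Cls M \<longrightarrow>
     (\<exists>X\<in>Cls M. \<forall>x\<in>Obj M. cmem M x X \<longleftrightarrow> csat M (case_nat x v) V p))"

text \<open>As usual for structures of a first-order language, both sorts are nonempty.\<close>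

definition KMU_model :: "('o, 'c) class_structure \<Rightarrow> bool" where
  "KMU_model M \<longleftrightarrow> Obj M \<noteq> {} \<and> Cls M \<noteq> {} \<and>
     ax_urelements M \<and> ax_set_ext M \<and> ax_class_ext M \<and> ax_foundation M \<and> ax_pairing M \<and>
     ax_union M \<and> ax_powerset M \<and> ax_infinity M \<and> ax_replacement M \<and> ax_separation M \<and>
     ax_comprehension M"

definition is_wellorder_of_universe :: "('o, 'c) class_structure \<Rightarrow> 'c \<Rightarrow> bool" where
  "is_wellorder_of_universe M W \<longleftrightarrow> is_relation M W \<and>
     (\<forall>x\<in>Obj M. related M W x x) \<and>
     (\<forall>x\<in>Obj M. \<forall>y\<in>Obj M. related M W x y \<longrightarrow> related M W y x \<longrightarrow> x = y) \<and>
     (\<forall>x\<in>Obj M. \<forall>y\<in>Obj M. \<forall>z\<in>Obj M. related M W x y \<longrightarrow> related M W y z \<longrightarrow> related M W x z) \<and>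
     (\<forall>x\<in>Obj M. \<forall>y\<in>Obj M. related M W x y \<or> related M W y x) \<and>
     (\<forall>X\<in>Cls M. (\<exists>x\<in>Obj M. cmem M x X) \<longrightarrow>
        (\<exists>m\<in>Obj M. cmem M m X \<and> (\<forall>x\<in>Obj M. cmem M x X \<longrightarrow> related M W m x)))"

definition KMCU_model :: "('o, 'c) class_structure \<Rightarrow> bool" where
  "KMCU_model M \<longleftrightarrow> KMU_model M \<and> (\<exists>W\<in>Cls M. is_wellorder_of_universe M W)"


section \<open>Hume's Principle for classes and definable maps\<close>

definition Hume_classes :: "('o, 'c) class_structure \<Rightarrow> ('c \<Rightarrow> 'o) \<Rightarrow> bool" where
  "Hume_classes M h \<longleftrightarrow> (\<forall>X\<in>Cls M. h X \<in> Obj M) \<and>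
     (\<forall>X\<in>Cls M. \<forall>Y\<in>Cls M. h X = h Y \<longleftrightarrow> equinumerous M X Y)"

text \<open>In the defining formula \<open>p\<close>, class variable 0 is the argument and object variable 0 the value.\<close>

definition definable_map :: "('o, 'c) class_structure \<Rightarrow> ('c \<Rightarrow> 'o) \<Rightarrow> bool" where
  "definable_map M h \<longleftrightarrow> (\<exists>p. ofv p \<subseteq> {0} \<and> cfv p \<subseteq> {0} \<and>
     (\<forall>X\<in>Cls M. \<forall>y\<in>Obj M. csat M (\<lambda>_. y) (\<lambda>_. X) p \<longleftrightarrow> h X = y))"

end

theory Submission
  imports Defs "HOL-Library.Countable_Set"
begin

text \<open>
  By completeness there is a model of ZFC with an inaccessible cardinal \<open>k\<close>, and everything else
  happens inside it. Choose a level \<open>U\<close> of the cumulative hierarchy that has cofinality at least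
  \<open>k\<close> and has more levels below it than the level \<open>K\<close>, the analogue of \<open>V\<^sub>k\<close>, has elements.
  Declare the elements of \<open>U\<close> of size less than \<open>k\<close> to be sets, those of larger size to be
  urelements, and all subsets of \<open>U\<close> to be classes; this is a model of KMCU.

  Swapping two urelements extends to an automorphism that is itself given by a class, so a definable
  map with Hume's Principle has values fixed by all such automorphisms. Such objects have no
  urelement in their transitive closure and hence lie in \<open>K\<close>. But the levels below \<open>U\<close> are pairwise
  non-equinumerous by Cantor's theorem, so there are too many cardinalities of classes.
\<close>

section \<open>Completeness\<close>

text \<open>Mere consistency yields only some model \<open>E\<close>, possibly ill-founded from
  outside. Every set, function and induction used must therefore be definable in \<open>E\<close>.
  This is why the closure rules \<open>fo\<close> and \<open>tm\<close> run through all proofs, why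
  sizes are compared by partial surjections that are sets of \<open>E\<close> (\<open>cov\<close>),
  and why the automorphism comes from coinduction and not from recursion.

  Calling large elements urelements avoids building a hierarchy over given atoms: \<open>U\<close>
  is transitive and closed under small subsets, and the set axioms need little more. A strong limit
  \<open>k\<close> makes power sets of small sets small, a regular \<open>k\<close> does the same
  for small unions.

  Class variables range over subsets of \<open>U\<close>, which are again elements of
  \<open>E\<close>, so second-order satisfaction in \<open>M\<close> is first-order in
  \<open>E\<close>. Hence full comprehension follows from Separation, and a map given only from
  outside becomes an internal relation once it has a defining formula. Without this the final count
  could not be carried out in \<open>E\<close>, where \<open>U\<close> was chosen so that
  \<open>K\<close> does not cover its levels.\<close>

instance fm :: countable by countable_datatype

text \<open>The exact set is needed: over an infinite theory there may be no common bound on the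
  variables, and fresh ones are found among the gaps.\<close>

primrec fvs :: "fm \<Rightarrow> nat set" where
  "fvs Fls = {}"
| "fvs (Mem i j) = {i, j}"
| "fvs (Eq i j) = {i, j}"
| "fvs (Imp p q) = fvs p \<union> fvs q"
| "fvs (All p) = {i. Suc i \<in> fvs p}"

lemma finite_fvs: "finite (fvs p)"
proof (induction p)
  case (All p)
  have "{i. Suc i \<in> fvs p} = Suc -` fvs p" by auto
  then show ?case using All by (simp add: finite_vimageI)
qed auto

section \<open>Renaming and structural rules of natural deduction\<close>

lemma ren_cong: "(\<And>i. i \<in> fvs p \<Longrightarrow> r i = s i) \<Longrightarrow> ren r p = ren s p"
proof (induction p arbitrary: r s)
  case (All p)
  have "ren (case_nat 0 (\<lambda>i. Suc (r i))) p = ren (case_nat 0 (\<lambda>i. Suc (s i))) p"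
    by (rule All.IH) (auto simp: All.prems split: nat.split)
  then show ?case by simp
next
  case (Imp p q)
  have "ren r p = ren s p" by (rule Imp.IH(1)) (simp add: Imp.prems)
  moreover have "ren r q = ren s q" by (rule Imp.IH(2)) (simp add: Imp.prems)
  ultimately show ?case by simp
qed simp_all

lemma ren_ren: "ren r (ren s p) = ren (\<lambda>i. r (s i)) p"
proof (induction p arbitrary: r s)
  case (All p)
  have "(\<lambda>i. case_nat 0 (\<lambda>i. Suc (r i)) (case_nat 0 (\<lambda>i. Suc (s i)) i))
      = case_nat 0 (\<lambda>i. Suc (r (s i)))"
    by (auto split: nat.split)
  then show ?case by (simp add: All)
qed auto

lemma ren_id: "ren (\<lambda>i. i) p = p"
proof (induction p)
  case (All p)
  have "case_nat 0 (\<lambda>i. Suc i) = (\<lambda>i. i)" by (auto split: nat.split)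
  then show ?case by (simp add: All)
qed auto

lemma ren_Neg [simp]: "ren r (Neg p) = Neg (ren r p)"
  by (simp add: Neg_def)

lemma fvs_ren: "fvs (ren r p) \<subseteq> r ` fvs p"
proof (induction p arbitrary: r)
  case (All p)
  show ?case using All[of "case_nat 0 (\<lambda>i. Suc (r i))"]
    by (fastforce split: nat.splits)
next
  case (Imp p q)
  show ?case using Imp(1)[of r] Imp(2)[of r] by auto
qed auto

lemma proves_mono: "G \<turnstile> p \<Longrightarrow> G \<subseteq> H \<Longrightarrow> H \<turnstile> p"
proof (induction arbitrary: H rule: proves.induct)
  case (assm p G) then show ?case by (auto intro: proves.assm)
next
  case (impI p G q) then show ?case by (meson insert_mono proves.impI)
next
  case (impE G p q) then show ?case by (meson proves.impE)
next
  case (contr p G) then show ?case by (meson insert_mono proves.contr)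
next
  case (allI G p) then show ?case by (meson image_mono proves.allI)
next
  case (allE G p t) show ?case by (rule proves.allE[OF allE.IH[OF allE.prems]])
next
  case (eqI G t) show ?case by (rule proves.eqI)
next
  case (eqE G s t p)
  show ?case by (rule proves.eqE[OF eqE.IH(1)[OF eqE.prems] eqE.IH(2)[OF eqE.prems]])
qed

lemma ren_inst: "ren r (inst p t) = inst (ren (case_nat 0 (\<lambda>i. Suc (r i))) p) (r t)"
  unfolding ren_ren by (rule ren_cong) (auto split: nat.split)

lemma proves_ren: "G \<turnstile> p \<Longrightarrow> ren r ` G \<turnstile> ren r p"
proof (induction arbitrary: r rule: proves.induct)
  case (assm p G) then show ?case by (auto intro: proves.assm)
next
  case (impI p G q) then show ?case using proves.impI by force
next
  case (impE G p q) then show ?case using proves.impE by fastforce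
next
  case (contr p G) then show ?case using proves.contr by force
next
  case (allI G p)
  have "ren (case_nat 0 (\<lambda>i. Suc (r i))) ` lift ` G = lift ` ren r ` G"
    by (simp add: image_image ren_ren)
  then show ?case using allI.IH[of "case_nat 0 (\<lambda>i. Suc (r i))"]
    by (simp add: proves.allI)
next
  case (allE G p t)
  show ?case unfolding ren_inst by (rule proves.allE) (use allE.IH[of r] in simp)
next
  case (eqI G t) then show ?case by (simp add: proves.eqI)
next
  case (eqE G s t p)
  show ?case using eqE.IH(1)[of r] eqE.IH(2)[of r] unfolding ren_inst ren.simps
    by (rule proves.eqE)
qed

lemma proves_finite: "G \<turnstile> p \<Longrightarrow> \<exists>F \<subseteq> G. finite F \<and> F \<turnstile> p"
proof (induction rule: proves.induct)
  case (assm p G)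
  show ?case by (rule exI[of _ "{p}"]) (use assm in \<open>auto intro: proves.assm\<close>)
next
  case (impI p G q)
  then obtain F where "F \<subseteq> insert p G" "finite F" "F \<turnstile> q" by blast
  moreover from this have "F - {p} \<turnstile> Imp p q"
    by (intro proves.impI, elim proves_mono) auto
  ultimately have "F - {p} \<subseteq> G" "finite (F - {p})" "F - {p} \<turnstile> Imp p q" by auto
  then show ?case by blast
next
  case (impE G p q)
  then obtain F F' where "F \<subseteq> G" "finite F" "F \<turnstile> Imp p q" "F' \<subseteq> G" "finite F'" "F' \<turnstile> p" by blast
  moreover from this have "F \<union> F' \<turnstile> q"
    by (rule_tac proves.impE[OF proves_mono[of F "Imp p q"] proves_mono[of F' p]]) auto
  ultimately have "F \<union> F' \<subseteq> G" "finite (F \<union> F')" "F \<union> F' \<turnstile> q" by auto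
  then show ?case by blast
next
  case (contr p G)
  then obtain F where "F \<subseteq> insert (Neg p) G" "finite F" "F \<turnstile> Fls" by blast
  moreover from this have "F - {Neg p} \<turnstile> p"
    by (intro proves.contr[of p], elim proves_mono) auto
  ultimately have "F - {Neg p} \<subseteq> G" "finite (F - {Neg p})" "F - {Neg p} \<turnstile> p" by auto
  then show ?case by blast
next
  case (allI G p)
  then obtain F where "F \<subseteq> lift ` G" "finite F" "F \<turnstile> p" by blast
  then obtain F' where "F' \<subseteq> G" "finite F'" "F = lift ` F'"
    by (meson finite_subset_image)
  then show ?case using \<open>F \<turnstile> p\<close> by (auto intro: proves.allI)
next
  case (allE G p t)
  then obtain F where "F \<subseteq> G" "finite F" "F \<turnstile> All p" by blast
  then show ?case by (intro exI[of _ F] conjI proves.allE) auto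
next
  case (eqI G t)
  show ?case by (rule exI[of _ "{}"]) (auto intro: proves.eqI)
next
  case (eqE G s t p)
  then obtain F F' where "F \<subseteq> G" "finite F" "F \<turnstile> Eq s t" "F' \<subseteq> G" "finite F'" "F' \<turnstile> inst p s"
    by blast
  moreover from this have "F \<union> F' \<turnstile> inst p t"
    by (rule_tac proves.eqE[OF proves_mono[of F "Eq s t"] proves_mono[of F' "inst p s"]]) auto
  ultimately have "F \<union> F' \<subseteq> G" "finite (F \<union> F')" "F \<union> F' \<turnstile> inst p t" by auto
  then show ?case by blast
qed

text \<open>This recovers the eigenvariable rule from the de Bruijn rule: the renaming that sends
  \<open>y\<close> to 0 and shifts everything else acts as \<open>lift\<close> on \<open>G\<close>,
  where \<open>y\<close> does not occur, and turns \<open>inst p y\<close> back into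
  \<open>p\<close>.\<close>

lemma proves_gen:
  assumes "G \<turnstile> inst p y" "\<And>q. q \<in> G \<Longrightarrow> y \<notin> fvs q" "y \<notin> fvs (All p)"
  shows "G \<turnstile> All p"
proof (rule proves.allI)
  define r where "r = (\<lambda>i. if i = y then 0 else Suc i)"
  have "ren r q = lift q" if "q \<in> G" for q
    using assms(2)[OF that] by (intro ren_cong) (auto simp: r_def)
  then have "ren r ` G = lift ` G" by simp
  moreover have "ren r (inst p y) = p"
  proof -
    have "ren r (inst p y) = ren (\<lambda>i. i) p" unfolding ren_ren
      by (rule ren_cong) (use assms(3) in \<open>auto simp: r_def split: nat.split\<close>)
    then show ?thesis by (simp add: ren_id)
  qed
  ultimately show "lift ` G \<turnstile> p" using proves_ren[OF assms(1), of r] by simp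
qed

lemma neg_elim: "G \<turnstile> Neg p \<Longrightarrow> G \<turnstile> p \<Longrightarrow> G \<turnstile> q"
proof -
  assume "G \<turnstile> Neg p" "G \<turnstile> p"
  then have "G \<turnstile> Fls" unfolding Neg_def by (rule proves.impE)
  then show ?thesis by (meson proves.contr proves_mono subset_insertI)
qed

section \<open>Henkin extension of a consistent theory\<close>

lemma consistent_cases:
  assumes "consistent G" shows "consistent (insert p G) \<or> consistent (insert (Neg p) G)"
proof (rule ccontr)
  assume "\<not> ?thesis"
  then have "insert p G \<turnstile> Fls" "insert (Neg p) G \<turnstile> Fls" by (auto simp: consistent_def)
  then have "G \<turnstile> Imp p Fls" "G \<turnstile> p" by (auto intro: proves.impI proves.contr)
  then show False using assms proves.impE by (auto simp: consistent_def)
qed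

text \<open>Only finitely many formulas are added before stage \<open>n\<close>, so odd variables remain fresh.\<close>

fun henkin :: "fm set \<Rightarrow> nat \<Rightarrow> fm set" where
  "henkin T 0 = T"
| "henkin T (Suc n) = (let G = henkin T n; p = from_nat n in
     if consistent (insert p G) then
       insert p G \<union> {Neg (inst q (SOME y. \<forall>g\<in>insert p G. y \<notin> fvs g)) | q. p = Neg (All q)}
     else insert (Neg p) G)"

definition fresh_set :: "fm set \<Rightarrow> bool" where
  "fresh_set G \<longleftrightarrow> infinite (UNIV - (\<Union>p\<in>G. fvs p))"

lemma fresh_set_insert: "fresh_set G \<Longrightarrow> fresh_set (insert p G)"
proof -
  have "UNIV - (\<Union>q\<in>insert p G. fvs q) = (UNIV - (\<Union>q\<in>G. fvs q)) - fvs p" by auto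
  then show "fresh_set G \<Longrightarrow> fresh_set (insert p G)"
    unfolding fresh_set_def by (simp add: finite_fvs Diff_infinite_finite)
qed

lemma fresh_set_ex: "fresh_set G \<Longrightarrow> \<exists>y. \<forall>g\<in>G. y \<notin> fvs g"
proof -
  assume "fresh_set G"
  then have "UNIV - (\<Union>p\<in>G. fvs p) \<noteq> {}" unfolding fresh_set_def by (metis finite.emptyI)
  then show ?thesis by blast
qed

text \<open>A refutation of the new formula would prove \<open>inst q y\<close> from
  \<open>G\<close>, and as \<open>y\<close> is fresh it could be generalised to
  \<open>All q\<close>.\<close>

lemma consistent_witness:
  assumes "consistent G" "Neg (All q) \<in> G" "\<forall>g\<in>G. y \<notin> fvs g"
  shows "consistent (insert (Neg (inst q y)) G)"
  unfolding consistent_def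
proof
  assume "insert (Neg (inst q y)) G \<turnstile> Fls"
  then have "G \<turnstile> inst q y" by (rule proves.contr)
  moreover have "y \<notin> fvs (All q)" using assms(2,3) by (auto simp: Neg_def)
  ultimately have "G \<turnstile> All q" using assms(3) proves_gen by blast
  moreover have "G \<turnstile> Neg (All q)" by (rule proves.assm) (rule assms(2))
  ultimately show False using assms(1) neg_elim consistent_def by blast
qed

lemma henkin_inv:
  assumes "consistent T" "fresh_set T"
  shows "consistent (henkin T n) \<and> fresh_set (henkin T n)"
proof (induction n)
  case 0 then show ?case using assms by simp
next
  case (Suc n)
  define G where "G = henkin T n"
  define p where "p = (from_nat n :: fm)"
  have G: "consistent G" "fresh_set G" using Suc by (auto simp: G_def)
  show ?case
  proof (cases "consistent (insert p G)")
    case False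
    then have "henkin T (Suc n) = insert (Neg p) G" by (simp add: Let_def G_def p_def)
    then show ?thesis using G False consistent_cases fresh_set_insert by metis
  next
    case True
    have fr: "fresh_set (insert p G)" using G fresh_set_insert by blast
    show ?thesis
    proof (cases "\<exists>q. p = Neg (All q)")
      case False
      then have "henkin T (Suc n) = insert p G" using True by (auto simp: Let_def G_def p_def)
      then show ?thesis using fr True by simp
    next
      case ex: True
      then obtain q where q: "p = Neg (All q)" by blast
      define y where "y = (SOME y. \<forall>g\<in>insert p G. y \<notin> fvs g)"
      have y: "\<forall>g\<in>insert p G. y \<notin> fvs g"
        unfolding y_def by (rule someI_ex) (rule fresh_set_ex[OF fr])
      have "henkin T (Suc n) = insert (Neg (inst q y)) (insert p G)"
        using True q unfolding y_def by (auto simp: Let_def G_def p_def Neg_def)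
      then show ?thesis using consistent_witness[OF True _ y, of q] q fr fresh_set_insert by auto
    qed
  qed
qed

lemma henkin_mono: "m \<le> n \<Longrightarrow> henkin T m \<subseteq> henkin T n"
  by (rule lift_Suc_mono_le) (auto simp: Let_def)

lemma henkin_set:
  assumes "consistent T" "fresh_set T"
  obtains G where "T \<subseteq> G" "consistent G" "\<And>p. p \<in> G \<or> Neg p \<in> G"
    "\<And>q. Neg (All q) \<in> G \<Longrightarrow> \<exists>y. Neg (inst q y) \<in> G"
proof
  define G where "G = (\<Union>n. henkin T n)"
  show "T \<subseteq> G" unfolding G_def using henkin.simps(1) by blast
  have fin: "\<exists>n. F \<subseteq> henkin T n" if "finite F" "F \<subseteq> G" for F
    using that
  proof (induction F rule: finite_induct)
    case (insert x F)
    then obtain m n where "F \<subseteq> henkin T n" "x \<in> henkin T m" by (auto simp: G_def)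
    then have "insert x F \<subseteq> henkin T (max m n)"
      using henkin_mono[of m "max m n" T] henkin_mono[of n "max m n" T] by auto
    then show ?case by blast
  qed auto
  show con: "consistent G" unfolding consistent_def
  proof
    assume "G \<turnstile> Fls"
    then obtain F where "F \<subseteq> G" "finite F" "F \<turnstile> Fls" using proves_finite by blast
    moreover then obtain n where "F \<subseteq> henkin T n" using fin by blast
    ultimately have "henkin T n \<turnstile> Fls" using proves_mono by blast
    then show False using henkin_inv[OF assms, of n] by (simp add: consistent_def)
  qed
  show "p \<in> G \<or> Neg p \<in> G" for p
  proof -
    have "p \<in> henkin T (Suc (to_nat p)) \<or> Neg p \<in> henkin T (Suc (to_nat p))"
      by (auto simp: Let_def)
    then show ?thesis unfolding G_def by blast
  qed
  show "\<exists>y. Neg (inst q y) \<in> G" if q: "Neg (All q) \<in> G" for q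
  proof -
    define n where "n = to_nat (Neg (All q))"
    have sub: "insert (Neg (All q)) (henkin T n) \<subseteq> G" using q by (auto simp: G_def)
    \<comment> \<open>Consistency of the limit forces the first branch at the stage where this
      formula is enumerated, and that branch adds the witness.\<close>
    have "consistent (insert (Neg (All q)) (henkin T n))"
      using con proves_mono[OF _ sub] by (auto simp: consistent_def)
    then have "\<exists>y. Neg (inst q y) \<in> henkin T (Suc n)" by (auto simp: Let_def n_def)
    then show ?thesis unfolding G_def by blast
  qed
qed

section \<open>The term model, with quantifiers relativised to a set of representatives\<close>

primrec satC :: "'a set \<Rightarrow> ('a \<Rightarrow> 'a \<Rightarrow> bool) \<Rightarrow> (nat \<Rightarrow> 'a) \<Rightarrow> fm \<Rightarrow> bool" where
  "satC C E v Fls = False"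
| "satC C E v (Mem i j) = E (v i) (v j)"
| "satC C E v (Eq i j) = (v i = v j)"
| "satC C E v (Imp p q) = (satC C E v p \<longrightarrow> satC C E v q)"
| "satC C E v (All p) = (\<forall>x\<in>C. satC C E (case_nat x v) p)"

lemma satC_bij:
  assumes "bij_betw g UNIV C"
  shows "sat (\<lambda>x y. E (g x) (g y)) v p \<longleftrightarrow> satC C E (\<lambda>i. g (v i)) p"
proof (induction p arbitrary: v)
  case (Eq i j)
  then show ?case using assms by (auto simp: bij_betw_def inj_def)
next
  case (All p)
  have "case_nat (g x) (\<lambda>i. g (v i)) = (\<lambda>i. g (case_nat x v i))" for x
    by (auto split: nat.split)
  moreover have "C = range g" using assms by (simp add: bij_betw_def)
  ultimately show ?case by (simp add: All)
qed auto

lemma satC_connectives [simp]: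
  "satC C E v (Neg p) \<longleftrightarrow> \<not> satC C E v p"
  "satC C E v (Conj p q) \<longleftrightarrow> satC C E v p \<and> satC C E v q"
  "satC C E v (Disj p q) \<longleftrightarrow> satC C E v p \<or> satC C E v q"
  "satC C E v (Iff p q) \<longleftrightarrow> (satC C E v p \<longleftrightarrow> satC C E v q)"
  "satC C E v (Ex p) \<longleftrightarrow> (\<exists>x\<in>C. satC C E (case_nat x v) p)"
  by (auto simp: Neg_def Conj_def Disj_def Iff_def Ex_def)

lemma completeness:
  assumes "consistent T"
  obtains C :: "nat set" and E v where "range v \<subseteq> C" "\<And>p. p \<in> T \<Longrightarrow> satC C E v p"
proof -
  \<comment> \<open>\<open>T\<close> may use every variable, so doubling the indices frees all odd
    ones; halving is the inverse renaming and carries a contradiction back to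
    \<open>T\<close>.\<close>
  let ?d = "ren (\<lambda>i. 2 * i)"
  have inv: "ren (\<lambda>i. i div 2) (?d p) = p" for p by (simp add: ren_ren ren_id)
  have "consistent (?d ` T)" unfolding consistent_def
  proof
    assume "?d ` T \<turnstile> Fls"
    from proves_ren[OF this, of "\<lambda>i. i div 2"] show False
      using assms by (simp add: image_image inv consistent_def)
  qed
  moreover have "fresh_set (?d ` T)" unfolding fresh_set_def
  proof (rule infinite_super)
    show "range (\<lambda>i. 2 * i + 1) \<subseteq> UNIV - (\<Union>p\<in>?d ` T. fvs p)"
    proof -
      have "2 * i + 1 \<notin> fvs (?d p)" for i p
      proof
        assume "2 * i + 1 \<in> fvs (?d p)"
        then obtain j where "2 * i + 1 = 2 * j" using fvs_ren[of "\<lambda>i. 2 * i" p] by blast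
        then show False by presburger
      qed
      then show ?thesis by auto
    qed
    show "infinite (range (\<lambda>i::nat. 2 * i + 1))"
      by (rule range_inj_infinite) (simp add: inj_def)
  qed
  ultimately obtain G where sub: "?d ` T \<subseteq> G" and con: "consistent G"
    and max: "\<And>p. p \<in> G \<or> Neg p \<in> G"
    and wit: "\<And>q. Neg (All q) \<in> G \<Longrightarrow> \<exists>y. Neg (inst q y) \<in> G"
    using henkin_set by metis
  have ded: "p \<in> G" if "G \<turnstile> p" for p
    using that max[of p] con neg_elim[of G p] proves.assm[of "Neg p" G]
    by (auto simp: consistent_def)
  have neg: "Neg p \<in> G \<longleftrightarrow> p \<notin> G" for p
    using max[of p] con neg_elim[of G p] proves.assm[of _ G] by (auto simp: consistent_def)
  have imp: "Imp p q \<in> G \<longleftrightarrow> (p \<in> G \<longrightarrow> q \<in> G)" for p q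
  proof
    assume "Imp p q \<in> G" then show "p \<in> G \<longrightarrow> q \<in> G"
      by (meson ded proves.assm proves.impE)
  next
    assume pq: "p \<in> G \<longrightarrow> q \<in> G"
    show "Imp p q \<in> G"
    proof (cases "p \<in> G")
      case True
      then have "insert p G \<turnstile> q" using pq by (simp add: proves.assm)
      then show ?thesis using ded proves.impI by blast
    next
      case False
      then have "Neg p \<in> G" using neg by blast
      then have "insert p G \<turnstile> q" by (meson insertI1 insertI2 neg_elim proves.assm)
      then show ?thesis using ded proves.impI by blast
    qed
  qed
  have all: "All q \<in> G \<longleftrightarrow> (\<forall>y. inst q y \<in> G)" for q
  proof
    assume "All q \<in> G"
    then have "G \<turnstile> All q" by (rule proves.assm)
    then have "G \<turnstile> inst q y" for y by (rule proves.allE)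
    then show "\<forall>y. inst q y \<in> G" using ded by simp
  next
    assume "\<forall>y. inst q y \<in> G"
    then show "All q \<in> G" using wit[of q] neg by blast
  qed
  define R where "R i j \<longleftrightarrow> Eq i j \<in> G" for i j
  have Rrefl: "R i i" for i unfolding R_def by (rule ded) (rule proves.eqI)
  have subst: "inst p t \<in> G" if "R s t" "inst p s \<in> G" for s t p
  proof (rule ded, rule proves.eqE)
    show "G \<turnstile> Eq s t" using that(1) unfolding R_def by (rule proves.assm)
    show "G \<turnstile> inst p s" using that(2) by (rule proves.assm)
  qed
  \<comment> \<open>Instantiation lowers the other indices by one, so \<open>Eq 0 (Suc i)\<close>
    becomes \<open>Eq t i\<close>. The patterns below use \<open>Suc\<close> in the same way to
    protect a fixed variable.\<close>
  have Rsym: "R j i" if "R i j" for i j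
    using subst[OF that, of "Eq 0 (Suc i)"] Rrefl[of i] by (simp add: R_def)
  have Rtrans: "R i k" if "R i j" "R j k" for i j k
    using subst[OF that(2), of "Eq (Suc i) 0"] that(1) by (simp add: R_def)
  define E where "E i j \<longleftrightarrow> Mem i j \<in> G" for i j
  have E1: "E i' j" if "R i i'" "E i j" for i i' j
    using subst[OF that(1), of "Mem 0 (Suc j)"] that(2) by (simp add: E_def)
  have E2: "E i j'" if "R j j'" "E i j" for i j j'
    using subst[OF that(1), of "Mem (Suc i) 0"] that(2) by (simp add: E_def)
  \<comment> \<open>Variables are the only terms. Their quotient by provable equality is realised by
    least representatives, so the carrier remains a set of naturals.\<close>
  define rep where "rep i = (LEAST j. R i j)" for i
  have rep: "R i (rep i)" for i unfolding rep_def by (rule LeastI) (rule Rrefl)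
  have rep_eq: "rep i = rep j \<longleftrightarrow> R i j" for i j
  proof
    assume "rep i = rep j" then show "R i j" by (metis rep Rsym Rtrans)
  next
    assume "R i j"
    then have "R i = R j" by (auto intro: Rsym Rtrans)
    then show "rep i = rep j" by (simp add: rep_def)
  qed
  have E_rep: "E (rep i) (rep j) \<longleftrightarrow> E i j" for i j
    by (meson E1 E2 Rsym rep)
  have truth: "satC (range rep) E (\<lambda>i. rep (v i)) p \<longleftrightarrow> ren v p \<in> G" for v p
  proof (induction p arbitrary: v)
    case Fls
    show ?case using con proves.assm[of Fls G] by (auto simp: consistent_def)
  next
    case (Mem i j) show ?case by (simp add: E_rep) (simp add: E_def)
  next
    case (Eq i j) show ?case by (simp add: rep_eq) (simp add: R_def)
  next
    case (Imp p q) then show ?case by (simp add: imp)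
  next
    case (All p)
    have 1: "case_nat (rep y) (\<lambda>i. rep (v i)) = (\<lambda>i. rep (case_nat y v i))" for y
      by (auto split: nat.split)
    have 2: "inst (ren (case_nat 0 (\<lambda>i. Suc (v i))) p) y = ren (case_nat y v) p" for y
      unfolding ren_ren by (rule ren_cong) (auto split: nat.split)
    show ?case by (simp add: all 1 2 All)
  qed
  show ?thesis
  proof (rule that)
    \<comment> \<open>Reading variable \<open>i\<close> at \<open>2 * i\<close> compensates for the
      doubling, by \<open>truth\<close>.\<close>
    show "range (\<lambda>i. rep (2 * i)) \<subseteq> range rep" by blast
    show "satC (range rep) E (\<lambda>i. rep (2 * i)) p" if "p \<in> T" for p
      unfolding truth using sub that by blast
  qed
qed

text \<open>With a finite carrier, Pairing and Union would build a universal set \<open>u\<close>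
  one element at a time, and then \<open>{u}\<close> violates Foundation because \<open>u\<close> is
  in \<open>u\<close>.\<close>

lemma satC_finite_False:
  assumes "finite C" "v 0 \<in> C" "satC C E v pairing_axiom" "satC C E v union_axiom"
    "satC C E v found_axiom"
  shows False
proof -
  have pair: "\<exists>p\<in>C. \<forall>z\<in>C. E z p \<longleftrightarrow> z = x \<or> z = y" if "x \<in> C" "y \<in> C" for x y
    using assms(3) that by (simp add: pairing_axiom_def upair_fm_def numeral_eq_Suc)
  have un: "\<exists>u\<in>C. \<forall>z\<in>C. E z u \<longleftrightarrow> (\<exists>y\<in>C. E y x \<and> E z y)" if "x \<in> C" for x
    using assms(4) that by (simp add: union_axiom_def BEx_def numeral_eq_Suc)
  have found: "\<exists>y\<in>C. E y x \<and> (\<forall>z\<in>C. E z x \<longrightarrow> \<not> E z y)" if "x \<in> C" "\<exists>y\<in>C. E y x" for x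
    using assms(5) that
    by (auto simp: found_axiom_def empty_fm_def BAll_def BEx_def numeral_eq_Suc)
  have "\<exists>u\<in>C. \<forall>x\<in>S. E x u" if "finite S" "S \<subseteq> C" for S
    using that
  proof (induction S rule: finite_induct)
    case empty then show ?case using assms(2) by blast
  next
    case (insert c S)
    then obtain u where u: "u \<in> C" "\<forall>x\<in>S. E x u" by auto
    obtain d where d: "d \<in> C" "\<forall>z\<in>C. E z d \<longleftrightarrow> z = c" using pair[of c c] insert by auto
    obtain p where p: "p \<in> C" "\<forall>z\<in>C. E z p \<longleftrightarrow> z = u \<or> z = d" using pair[of u d] u d by auto
    obtain w where w: "w \<in> C" "\<forall>z\<in>C. E z w \<longleftrightarrow> (\<exists>y\<in>C. E y p \<and> E z y)" using un p by blast
    have "E x w" if "x \<in> insert c S" for x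
    proof -
      have x: "x \<in> C" using that insert.prems by blast
      show ?thesis
      proof (cases "x = c")
        case True then show ?thesis using w(2) x p(2) d by blast
      next
        case False then show ?thesis using w(2) x p(2) u that by blast
      qed
    qed
    then show ?case using w(1) by blast
  qed
  then obtain u where u: "u \<in> C" "\<forall>x\<in>C. E x u" using assms(1) by blast
  obtain p where p: "p \<in> C" "\<forall>z\<in>C. E z p \<longleftrightarrow> z = u" using pair[of u u] u by auto
  then show False using found[of p] u by auto
qed

text \<open>\<open>sat\<close> quantifies over the whole type; the carrier is infinite, so
  enumerating it transports the term model to all of \<open>nat\<close>.\<close>

lemma ZFC_nat_model:
  assumes "consistent T" "ZFC \<subseteq> T"
  obtains E :: "nat \<Rightarrow> nat \<Rightarrow> bool" and v where "\<And>p. p \<in> T \<Longrightarrow> sat E v p"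
proof -
  obtain C :: "nat set" and E v where C: "range v \<subseteq> C" "\<And>p. p \<in> T \<Longrightarrow> satC C E v p"
    using completeness[OF assms(1)] by metis
  have "pairing_axiom \<in> T" "union_axiom \<in> T" "found_axiom \<in> T"
    using assms(2) by (auto simp: ZFC_def)
  then have "infinite C" using satC_finite_False[of C v E] C by blast
  then have b: "bij_betw (from_nat_into C) UNIV C" by (simp add: bij_betw_from_nat_into)
  define g where "g = from_nat_into C"
  define v' where "v' i = inv_into UNIV g (v i)" for i
  have "g (v' i) = v i" for i
    using C(1) b by (auto simp: v'_def g_def bij_betw_def intro!: f_inv_into_f)
  then have "sat (\<lambda>x y. E (g x) (g y)) v' p \<longleftrightarrow> satC C E v p" for p
    using satC_bij[of g C E v' p] b by (simp add: g_def)
  then show ?thesis using C(2) that by blast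
qed

section \<open>Set theory inside a model\<close>

locale zf_model =
  fixes E :: "'a \<Rightarrow> 'a \<Rightarrow> bool" (infix "\<epsilon>" 50)
  assumes ext: "(\<And>z. z \<epsilon> x \<longleftrightarrow> z \<epsilon> y) \<Longrightarrow> x = y"
    and found: "y \<epsilon> x \<Longrightarrow> \<exists>y. y \<epsilon> x \<and> (\<forall>z. z \<epsilon> x \<longrightarrow> \<not> z \<epsilon> y)"
    and pairing: "\<exists>p. \<forall>z. z \<epsilon> p \<longleftrightarrow> z = x \<or> z = y"
    and union: "\<exists>u. \<forall>z. z \<epsilon> u \<longleftrightarrow> (\<exists>y. y \<epsilon> x \<and> z \<epsilon> y)"
    and power: "\<exists>p. \<forall>z. z \<epsilon> p \<longleftrightarrow> (\<forall>t. t \<epsilon> z \<longrightarrow> t \<epsilon> x)"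
    and choice: "(\<And>y. y \<epsilon> x \<Longrightarrow> \<exists>z. z \<epsilon> y) \<Longrightarrow>
      (\<And>y z u. y \<epsilon> x \<Longrightarrow> z \<epsilon> x \<Longrightarrow> u \<epsilon> y \<Longrightarrow> u \<epsilon> z \<Longrightarrow> y = z) \<Longrightarrow>
      \<exists>c. \<forall>y. y \<epsilon> x \<longrightarrow> (\<exists>!z. z \<epsilon> y \<and> z \<epsilon> c)"
    and separation: "\<exists>b. \<forall>x. x \<epsilon> b \<longleftrightarrow> x \<epsilon> a \<and> sat E (case_nat x (case_nat a w)) p"
    and replacement:
      "(\<And>x y z. x \<epsilon> a \<Longrightarrow> sat E (case_nat x (case_nat y (case_nat a w))) p \<Longrightarrow>
          sat E (case_nat x (case_nat z (case_nat a w))) p \<Longrightarrow> y = z) \<Longrightarrow>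
       \<exists>b. \<forall>y. y \<epsilon> b \<longleftrightarrow> (\<exists>x. x \<epsilon> a \<and> sat E (case_nat x (case_nat y (case_nat a w))) p)"
begin

subsection \<open>Definability with parameters\<close>

text \<open>
  The values \<open>Inr c\<close> of \<open>e\<close> are the parameters. Formulas enter only through the closure rules
  collected in \<open>fo\<close>, which make Separation and Replacement applicable to HOL predicates.
\<close>

definition fo :: "((nat \<Rightarrow> 'a) \<Rightarrow> bool) \<Rightarrow> bool" where
  "fo P \<longleftrightarrow> (\<exists>p e. \<forall>v. P v \<longleftrightarrow> sat E (\<lambda>i. case_sum v (\<lambda>c. c) (e i)) p)"

text \<open>The language is relational, so a definable function is represented by its graph, with
  the value in variable 0 and the arguments shifted.\<close>

definition tm :: "((nat \<Rightarrow> 'a) \<Rightarrow> 'a) \<Rightarrow> bool" where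
  "tm f \<longleftrightarrow> fo (\<lambda>v. v 0 = f (\<lambda>i. v (Suc i)))"

lemma fo_subst: "fo P \<Longrightarrow> fo (\<lambda>v. P (\<lambda>i. case_sum v (\<lambda>c. c) (s i)))"
proof -
  assume "fo P"
  then obtain p e where p: "\<And>v. P v \<longleftrightarrow> sat E (\<lambda>i. case_sum v (\<lambda>c. c) (e i)) p"
    unfolding fo_def by blast
  have 1: "(\<lambda>i. case_sum (\<lambda>i. case_sum v (\<lambda>c. c) (s i)) (\<lambda>c. c) (e i))
      = (\<lambda>i. case_sum v (\<lambda>c. c) (case_sum s Inr (e i)))" for v :: "nat \<Rightarrow> 'a"
    by (auto split: sum.split)
  show ?thesis unfolding fo_def p 1
    by (rule exI[of _ p], rule exI[of _ "\<lambda>i. case_sum s Inr (e i)"]) simp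
qed

lemma fo_ren: "fo P \<Longrightarrow> fo (\<lambda>v. P (\<lambda>i. v (r i)))"
  using fo_subst[of P "\<lambda>i. Inl (r i)"] by simp

text \<open>Freezing all variables but 0 as parameters brings a predicate into the unary form in
  which Separation is stated.\<close>

lemma fo_param: "fo P \<Longrightarrow> fo (\<lambda>u. P (case_nat (u 0) v))"
proof -
  have 1: "(\<lambda>i. case_sum u (\<lambda>c. c) (case i of 0 \<Rightarrow> Inl 0 | Suc j \<Rightarrow> Inr (v j))) = case_nat (u 0) v"
    for u by (auto split: nat.split)
  show "fo P \<Longrightarrow> fo (\<lambda>u. P (case_nat (u 0) v))"
    using fo_subst[of P "\<lambda>i. case i of 0 \<Rightarrow> Inl 0 | Suc j \<Rightarrow> Inr (v j)"] unfolding 1 .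
qed

named_theorems fo

lemma fo_const [fo]: "fo (\<lambda>v. c)"
proof -
  have "sat E v (if c then Imp Fls Fls else Fls) \<longleftrightarrow> c" for v by simp
  then show ?thesis unfolding fo_def by (metis (no_types))
qed

lemma fo_imp [fo]: assumes "fo P" "fo Q" shows "fo (\<lambda>v. P v \<longrightarrow> Q v)"
proof -
  obtain p e where p: "\<And>v. P v \<longleftrightarrow> sat E (\<lambda>i. case_sum v (\<lambda>c. c) (e i)) p"
    using assms(1) unfolding fo_def by blast
  obtain q d where q: "\<And>v. Q v \<longleftrightarrow> sat E (\<lambda>i. case_sum v (\<lambda>c. c) (d i)) q"
    using assms(2) unfolding fo_def by blast
  \<comment> \<open>The two formulas come with unrelated parameter lists, which are interleaved on
    even and odd indices.\<close>
  define k where "k i = (if even i then e (i div 2) else d (i div 2))" for i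
  have "(P v \<longrightarrow> Q v) \<longleftrightarrow> sat E (\<lambda>i. case_sum v (\<lambda>c. c) (k i))
      (Imp (ren (\<lambda>i. 2 * i) p) (ren (\<lambda>i. 2 * i + 1) q))" for v
    unfolding p q sat.simps sat_ren by (simp add: k_def)
  then show ?thesis unfolding fo_def by blast
qed

lemma fo_all [fo]: assumes "fo (\<lambda>v. Q (v 0) (\<lambda>i. v (Suc i)))" shows "fo (\<lambda>v. \<forall>x. Q x v)"
proof -
  obtain p e where p: "\<And>v. Q (v 0) (\<lambda>i. v (Suc i)) \<longleftrightarrow> sat E (\<lambda>i. case_sum v (\<lambda>c. c) (e i)) p"
    using assms unfolding fo_def by blast
  \<comment> \<open>Several indices may stand for the bound variable; \<open>r\<close> collapses
    them to 0 and moves the others up. The dummy \<open>Inr undefined\<close> in \<open>d\<close>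
    occurs only at the collapsed indices and is never read.\<close>
  define r where "r i = (if e i = Inl 0 then 0 else Suc i)" for i
  define d where "d i = (case e i of Inl j \<Rightarrow> (case j of 0 \<Rightarrow> Inr undefined | Suc k \<Rightarrow> Inl k) | Inr c \<Rightarrow> Inr c)" for i
  have "Q x v \<longleftrightarrow> sat E (case_nat x (\<lambda>i. case_sum v (\<lambda>c. c) (d i))) (ren r p)" for x v
  proof -
    have "(\<lambda>i. case_sum (case_nat x v) (\<lambda>c. c) (e i))
        = (\<lambda>i. case_nat x (\<lambda>i. case_sum v (\<lambda>c. c) (d i)) (r i))"
      by (rule HOL.ext) (auto simp: r_def d_def split: sum.split nat.split)
    then show ?thesis using p[of "case_nat x v"] by (simp add: sat_ren)
  qed
  then have "(\<forall>x. Q x v) \<longleftrightarrow> sat E (\<lambda>i. case_sum v (\<lambda>c. c) (d i)) (All (ren r p))" for v by simp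
  then show ?thesis unfolding fo_def by blast
qed

lemma fo_not [fo]: "fo P \<Longrightarrow> fo (\<lambda>v. \<not> P v)"
  using fo_imp[OF _ fo_const[of False]] by simp

lemma fo_conj [fo]: "fo P \<Longrightarrow> fo Q \<Longrightarrow> fo (\<lambda>v. P v \<and> Q v)"
  using fo_not[OF fo_imp[OF _ fo_not]] by simp

lemma fo_disj [fo]: "fo P \<Longrightarrow> fo Q \<Longrightarrow> fo (\<lambda>v. P v \<or> Q v)"
  using fo_imp[OF fo_not, of P Q] by (simp add: disj_imp)

lemma fo_iff [fo]: "fo P \<Longrightarrow> fo Q \<Longrightarrow> fo (\<lambda>v. P v \<longleftrightarrow> Q v)"
  using fo_conj[OF fo_imp[of P Q] fo_imp[of Q P]] by (simp add: iff_conv_conj_imp)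

lemma fo_ex [fo]: "fo (\<lambda>v. Q (v 0) (\<lambda>i. v (Suc i))) \<Longrightarrow> fo (\<lambda>v. \<exists>x. Q x v)"
  using fo_not[OF fo_all[of "\<lambda>x v. \<not> Q x v", OF fo_not]] by simp

lemma fo_var_eq: "fo (\<lambda>v. v i = v j)"
proof -
  have "v i = v j \<longleftrightarrow> sat E (\<lambda>i. case_sum v (\<lambda>c. c) (Inl i)) (Eq i j)" for v by simp
  then show ?thesis unfolding fo_def by blast
qed

lemma fo_var_mem: "fo (\<lambda>v. v i \<epsilon> v j)"
proof -
  have "v i \<epsilon> v j \<longleftrightarrow> sat E (\<lambda>i. case_sum v (\<lambda>c. c) (Inl i)) (Mem i j)" for v by simp
  then show ?thesis unfolding fo_def by blast
qed

lemma tm_var [fo]: "tm (\<lambda>v. v i)"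
  unfolding tm_def by (rule fo_var_eq)

lemma tm_const [fo]: "tm (\<lambda>v. c)"
  unfolding tm_def using fo_subst[OF fo_var_eq[of 0 1], of "\<lambda>i. if i = 0 then Inl 0 else Inr c"]
  by simp

lemma tm_shift: "tm f \<Longrightarrow> fo (\<lambda>v. v k = f (\<lambda>i. v (r i)))"
  unfolding tm_def using fo_ren[of _ "case_nat k r"] by force

lemma tm_ren: assumes "tm f" shows "tm (\<lambda>v. f (\<lambda>i. v (r i)))"
  unfolding tm_def by (rule tm_shift[OF assms])

text \<open>A term inside a predicate is eliminated by naming its value with an existential
  quantifier; the other composition rules do the same.\<close>

lemma fo_comp1: assumes "fo (\<lambda>v. P (v 0))" "tm f" shows "fo (\<lambda>v. P (f v))"
proof -
  have "fo (\<lambda>v. \<exists>x. x = f v \<and> P x)"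
    by (intro fo_ex fo_conj tm_shift assms)
  then show ?thesis by simp
qed

lemma fo_comp2: assumes "fo (\<lambda>v. P (v 0) (v 1))" "tm f" "tm g" shows "fo (\<lambda>v. P (f v) (g v))"
proof -
  have "fo (\<lambda>v. \<exists>y. y = g v \<and> (\<exists>x. x = f v \<and> P x y))"
    using assms(1) by (intro fo_ex fo_conj tm_shift assms) simp
  then show ?thesis by simp
qed

lemma fo_comp3: assumes "fo (\<lambda>v. P (v 0) (v 1) (v 2))" "tm f" "tm g" "tm h"
  shows "fo (\<lambda>v. P (f v) (g v) (h v))"
proof -
  have "fo (\<lambda>v. \<exists>z. z = h v \<and> (\<exists>y. y = g v \<and> (\<exists>x. x = f v \<and> P x y z)))"
    using assms(1) by (intro fo_ex fo_conj tm_shift assms) (simp add: numeral_eq_Suc)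
  then show ?thesis by simp
qed

lemma tm_comp1: assumes "tm (\<lambda>v. F (v 0))" "tm f" shows "tm (\<lambda>v. F (f v))"
proof -
  have "fo (\<lambda>v. \<exists>x. x = f (\<lambda>i. v (Suc i)) \<and> v 0 = F x)"
    using tm_shift[OF assms(1), of "Suc 0" "\<lambda>i. i"]
    by (intro fo_ex fo_conj tm_shift[OF assms(2)]) simp
  then show ?thesis unfolding tm_def by simp
qed

lemma tm_comp2: assumes "tm (\<lambda>v. F (v 0) (v 1))" "tm f" "tm g" shows "tm (\<lambda>v. F (f v) (g v))"
proof -
  have "fo (\<lambda>v. \<exists>y. y = g (\<lambda>i. v (Suc i)) \<and> (\<exists>x. x = f (\<lambda>i. v (Suc i)) \<and> v 0 = F x y))"
    using tm_shift[OF assms(1), of "2" "\<lambda>i. i"]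
    by (intro fo_ex fo_conj tm_shift[OF assms(2)] tm_shift[OF assms(3)]) (simp add: numeral_eq_Suc)
  then show ?thesis unfolding tm_def by simp
qed

lemma fo_eq [fo]: "tm f \<Longrightarrow> tm g \<Longrightarrow> fo (\<lambda>v. f v = g v)"
  by (rule fo_comp2[where P = "\<lambda>x y. x = y", OF fo_var_eq])

lemma fo_mem [fo]: "tm f \<Longrightarrow> tm g \<Longrightarrow> fo (\<lambda>v. f v \<epsilon> g v)"
  by (rule fo_comp2[where P = "\<lambda>x y. x \<epsilon> y", OF fo_var_mem])

lemma fo_Ex1 [fo]: "fo (\<lambda>v. Q (v 0) (\<lambda>i. v (Suc i))) \<Longrightarrow> fo (\<lambda>v. \<exists>!x. Q x v)"
proof -
  assume a: "fo (\<lambda>v. Q (v 0) (\<lambda>i. v (Suc i)))"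
  have "fo (\<lambda>v. Q (v 0) (\<lambda>i. v (Suc (Suc i))))"
    using fo_ren[OF a, of "case_nat 0 (\<lambda>i. Suc (Suc i))"] by simp
  then have "fo (\<lambda>v. \<exists>x. Q x v \<and> (\<forall>y. Q y v \<longrightarrow> y = x))"
    by (intro fo a)
  then show ?thesis by (simp add: Ex1_def)
qed

subsection \<open>Sets from definable predicates\<close>

definition is_ext :: "('a \<Rightarrow> bool) \<Rightarrow> bool" where
  "is_ext P \<longleftrightarrow> (\<exists>a. \<forall>x. x \<epsilon> a \<longleftrightarrow> P x)"

definition set_of :: "('a \<Rightarrow> bool) \<Rightarrow> 'a" where
  "set_of P = (THE a. \<forall>x. x \<epsilon> a \<longleftrightarrow> P x)"

lemma mem_set_of: "is_ext P \<Longrightarrow> x \<epsilon> set_of P \<longleftrightarrow> P x"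
proof -
  assume "is_ext P"
  then have "\<exists>!a. \<forall>x. x \<epsilon> a \<longleftrightarrow> P x" unfolding is_ext_def using ext by blast
  from theI'[OF this] show ?thesis unfolding set_of_def by blast
qed

text \<open>By Extensionality the graph is first-order: \<open>y\<close> is the value iff it has
  exactly the elements satisfying the predicate.\<close>

lemma tm_set_of:
  assumes "\<And>v. is_ext (\<lambda>x. P x v)" "fo (\<lambda>v. P (v 0) (\<lambda>i. v (Suc i)))"
  shows "tm (\<lambda>v. set_of (\<lambda>x. P x v))"
proof -
  have 1: "y = set_of (\<lambda>x. P x v) \<longleftrightarrow> (\<forall>x. x \<epsilon> y \<longleftrightarrow> P x v)" for y v
    using mem_set_of[OF assms(1)] ext by blast
  have "fo (\<lambda>v. P (v 0) (\<lambda>i. v (Suc (Suc i))))"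
    using fo_ren[OF assms(2), of "case_nat 0 (\<lambda>i. Suc (Suc i))"] by simp
  then show ?thesis unfolding tm_def 1 by (intro fo)
qed

lemma is_ext_sep: assumes "fo (\<lambda>v. P (v 0))" shows "is_ext (\<lambda>x. x \<epsilon> a \<and> P x)"
proof -
  obtain p e where p: "\<And>v :: nat \<Rightarrow> 'a. P (v 0) \<longleftrightarrow> sat E (\<lambda>i. case_sum v (\<lambda>c. c) (e i)) p"
    using assms unfolding fo_def by blast
  \<comment> \<open>\<open>P\<close> depends on \<open>v 0\<close> only and may be evaluated at the
    constant valuation \<open>x\<close>; so every \<open>Inl\<close> goes to the element variable 0,
    and parameters start at 2, after the element and the given set.\<close>
  have "P x \<longleftrightarrow> sat E (case_nat x (case_nat a (\<lambda>i. projr (e i))))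
      (ren (\<lambda>i. if isl (e i) then 0 else i + 2) p)" for x
  proof -
    have "(\<lambda>i. case_sum (\<lambda>_. x) (\<lambda>c. c) (e i)) = (\<lambda>i. case_nat x (case_nat a (\<lambda>i. projr (e i)))
        (if isl (e i) then 0 else i + 2))"
      by (rule HOL.ext) (auto split: sum.split)
    then show ?thesis using p[of "\<lambda>_. x"] by (simp add: sat_ren)
  qed
  then show ?thesis unfolding is_ext_def using separation by simp
qed

lemma is_ext_repl:
  assumes "fo (\<lambda>v. R (v 0) (v 1))" "\<And>x y z. x \<epsilon> a \<Longrightarrow> R x y \<Longrightarrow> R x z \<Longrightarrow> y = z"
  shows "is_ext (\<lambda>y. \<exists>x. x \<epsilon> a \<and> R x y)"
proof -
  obtain p e where p: "\<And>v :: nat \<Rightarrow> 'a. R (v 0) (v 1) \<longleftrightarrow> sat E (\<lambda>i. case_sum v (\<lambda>c. c) (e i)) p"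
    using assms(1) unfolding fo_def by blast
  \<comment> \<open>Argument, value and given set precede the parameters, hence the shift by 3. The
    valuation used below is \<open>x\<close> at 0 and \<open>y\<close> elsewhere, so any positive
    variable stands for the value.\<close>
  define r where "r i = (case e i of Inl j \<Rightarrow> (if j = 0 then 0 else 1) | Inr c \<Rightarrow> i + 3)" for i
  have R: "R x y \<longleftrightarrow> sat E (case_nat x (case_nat y (case_nat a (\<lambda>i. projr (e i))))) (ren r p)" for x y
  proof -
    have "(\<lambda>i. case_sum (\<lambda>i. if i = 0 then x else y) (\<lambda>c. c) (e i))
        = (\<lambda>i. case_nat x (case_nat y (case_nat a (\<lambda>i. projr (e i)))) (r i))"
      by (rule HOL.ext) (auto simp: r_def numeral_eq_Suc split: sum.split)
    then show ?thesis using p[of "\<lambda>i. if i = 0 then x else y"] by (simp add: sat_ren)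
  qed
  show ?thesis using replacement[of a "\<lambda>i. projr (e i)" "ren r p"] assms(2)
    unfolding is_ext_def R[symmetric] by blast
qed

definition sep :: "'a \<Rightarrow> ('a \<Rightarrow> bool) \<Rightarrow> 'a" where
  "sep a P = set_of (\<lambda>x. x \<epsilon> a \<and> P x)"

lemma mem_sep: "fo (\<lambda>v. P (v 0)) \<Longrightarrow> x \<epsilon> sep a P \<longleftrightarrow> x \<epsilon> a \<and> P x"
  unfolding sep_def by (rule mem_set_of) (rule is_ext_sep)

lemma tm_sep [fo]:
  assumes "tm f" "fo (\<lambda>v. P (v 0) (\<lambda>i. v (Suc i)))"
  shows "tm (\<lambda>v. sep (f v) (\<lambda>x. P x v))"
  unfolding sep_def
proof (rule tm_set_of)
  fix v
  show "is_ext (\<lambda>x. x \<epsilon> f v \<and> P x v)"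
    by (rule is_ext_sep) (use fo_param[OF assms(2), of v] in simp)
next
  show "fo (\<lambda>v. v 0 \<epsilon> f (\<lambda>i. v (Suc i)) \<and> P (v 0) (\<lambda>i. v (Suc i)))"
    by (intro fo assms tm_ren[OF assms(1)])
qed

definition img :: "'a \<Rightarrow> ('a \<Rightarrow> 'a) \<Rightarrow> 'a" where
  "img a F = set_of (\<lambda>y. \<exists>x. x \<epsilon> a \<and> y = F x)"

lemma is_ext_img: "tm (\<lambda>v. F (v 0)) \<Longrightarrow> is_ext (\<lambda>y. \<exists>x. x \<epsilon> a \<and> y = F x)"
proof -
  assume a: "tm (\<lambda>v. F (v 0))"
  have "fo (\<lambda>v. v 1 = F (v 0))" using tm_shift[OF a, of 1 "\<lambda>i. i"] by simp
  then show ?thesis by (rule is_ext_repl) simp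
qed

lemma mem_img: "tm (\<lambda>v. F (v 0)) \<Longrightarrow> y \<epsilon> img a F \<longleftrightarrow> (\<exists>x. x \<epsilon> a \<and> y = F x)"
  unfolding img_def by (rule mem_set_of) (rule is_ext_img)

section \<open>Basic set operations, pairs and relations\<close>

definition sub :: "'a \<Rightarrow> 'a \<Rightarrow> bool" where "sub x y \<longleftrightarrow> (\<forall>z. z \<epsilon> x \<longrightarrow> z \<epsilon> y)"
definition upair :: "'a \<Rightarrow> 'a \<Rightarrow> 'a" where "upair x y = set_of (\<lambda>z. z = x \<or> z = y)"
definition union_of :: "'a \<Rightarrow> 'a" where "union_of x = set_of (\<lambda>z. \<exists>y. y \<epsilon> x \<and> z \<epsilon> y)"
definition pow :: "'a \<Rightarrow> 'a" where "pow x = set_of (\<lambda>z. sub z x)"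

lemma fo_sub [fo]: "tm f \<Longrightarrow> tm g \<Longrightarrow> fo (\<lambda>v. sub (f v) (g v))"
  by (rule fo_comp2[where P = sub]) (unfold sub_def, intro fo)

lemma is_ext_upair: "is_ext (\<lambda>z. z = x \<or> z = y)"
  using pairing by (simp add: is_ext_def)
lemma is_ext_union_of: "is_ext (\<lambda>z. \<exists>y. y \<epsilon> x \<and> z \<epsilon> y)"
  using union by (simp add: is_ext_def)
lemma is_ext_pow: "is_ext (\<lambda>z. sub z x)"
  using power by (simp add: is_ext_def sub_def)

lemma mem_upair [simp]: "z \<epsilon> upair x y \<longleftrightarrow> z = x \<or> z = y"
  unfolding upair_def by (rule mem_set_of) (rule is_ext_upair)
lemma mem_union_of [simp]: "z \<epsilon> union_of x \<longleftrightarrow> (\<exists>y. y \<epsilon> x \<and> z \<epsilon> y)"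
  unfolding union_of_def by (rule mem_set_of) (rule is_ext_union_of)
lemma mem_pow [simp]: "z \<epsilon> pow x \<longleftrightarrow> sub z x"
  unfolding pow_def by (rule mem_set_of) (rule is_ext_pow)

lemma tm_upair [fo]: "tm f \<Longrightarrow> tm g \<Longrightarrow> tm (\<lambda>v. upair (f v) (g v))"
  by (rule tm_comp2[where F = upair]) (unfold upair_def, intro tm_set_of is_ext_upair fo)
lemma tm_union_of [fo]: "tm f \<Longrightarrow> tm (\<lambda>v. union_of (f v))"
  by (rule tm_comp1[where F = union_of]) (unfold union_of_def, intro tm_set_of is_ext_union_of fo)
lemma tm_pow [fo]: "tm f \<Longrightarrow> tm (\<lambda>v. pow (f v))"
  by (rule tm_comp1[where F = pow]) (unfold pow_def, intro tm_set_of is_ext_pow fo)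

definition un2 :: "'a \<Rightarrow> 'a \<Rightarrow> 'a" where "un2 x y = union_of (upair x y)"
lemma mem_un2 [simp]: "z \<epsilon> un2 x y \<longleftrightarrow> z \<epsilon> x \<or> z \<epsilon> y" by (auto simp: un2_def)
lemma tm_un2 [fo]: "tm f \<Longrightarrow> tm g \<Longrightarrow> tm (\<lambda>v. un2 (f v) (g v))"
  unfolding un2_def by (intro fo)

definition op :: "'a \<Rightarrow> 'a \<Rightarrow> 'a" where "op x y = upair (upair x x) (upair x y)"
lemma tm_op [fo]: "tm f \<Longrightarrow> tm g \<Longrightarrow> tm (\<lambda>v. op (f v) (g v))"
  unfolding op_def by (intro fo)

lemma upair_eq: "upair x y = upair x' y' \<longleftrightarrow> x = x' \<and> y = y' \<or> x = y' \<and> y = x'"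
proof
  assume "upair x y = upair x' y'"
  then have *: "z = x \<or> z = y \<longleftrightarrow> z = x' \<or> z = y'" for z using mem_upair[of z] by metis
  show "x = x' \<and> y = y' \<or> x = y' \<and> y = x'" using *[of x] *[of y] *[of x'] *[of y'] by auto
next
  assume "x = x' \<and> y = y' \<or> x = y' \<and> y = x'"
  then show "upair x y = upair x' y'" by (auto intro: ext)
qed

lemma op_eq [simp]: "op x y = op x' y' \<longleftrightarrow> x = x' \<and> y = y'"
  unfolding op_def upair_eq by auto

definition cart :: "'a \<Rightarrow> 'a \<Rightarrow> 'a" where
  "cart a b = sep (pow (pow (un2 a b))) (\<lambda>p. \<exists>x y. x \<epsilon> a \<and> y \<epsilon> b \<and> p = op x y)"

lemma mem_cart: "p \<epsilon> cart a b \<longleftrightarrow> (\<exists>x y. x \<epsilon> a \<and> y \<epsilon> b \<and> p = op x y)"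
proof -
  have "fo (\<lambda>v. \<exists>x y. x \<epsilon> a \<and> y \<epsilon> b \<and> v 0 = op x y)" by (intro fo)
  then show ?thesis unfolding cart_def by (subst mem_sep) (auto simp: op_def sub_def)
qed

lemma tm_cart [fo]: "tm f \<Longrightarrow> tm g \<Longrightarrow> tm (\<lambda>v. cart (f v) (g v))"
  by (rule tm_comp2[where F = cart]) (unfold cart_def, intro fo)

definition rel :: "'a \<Rightarrow> 'a \<Rightarrow> ('a \<Rightarrow> 'a \<Rightarrow> bool) \<Rightarrow> 'a" where
  "rel a b R = sep (cart a b) (\<lambda>p. \<exists>x y. p = op x y \<and> R x y)"

lemma mem_rel:
  assumes "fo (\<lambda>v. R (v 0) (v 1))"
  shows "p \<epsilon> rel a b R \<longleftrightarrow> (\<exists>x y. p = op x y \<and> x \<epsilon> a \<and> y \<epsilon> b \<and> R x y)"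
proof -
  have "fo (\<lambda>v. \<exists>x y. v 0 = op x y \<and> R x y)"
    by (intro fo fo_comp2[OF assms])
  then show ?thesis unfolding rel_def by (subst mem_sep) (auto simp: mem_cart)
qed

lemma op_mem_rel:
  assumes "fo (\<lambda>v. R (v 0) (v 1))"
  shows "op x y \<epsilon> rel a b R \<longleftrightarrow> x \<epsilon> a \<and> y \<epsilon> b \<and> R x y"
  by (auto simp: mem_rel[OF assms])

text \<open>Foundation is applied to the set of counterexamples. That set exists only for definable
  \<open>P\<close>, and no stronger induction is available in a model that may be externally
  ill-founded.\<close>

lemma set_induct:
  assumes "fo (\<lambda>v. P (v 0))" "x \<epsilon> a" "\<And>x. x \<epsilon> a \<Longrightarrow> (\<And>y. y \<epsilon> x \<Longrightarrow> y \<epsilon> a \<Longrightarrow> P y) \<Longrightarrow> P x"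
  shows "P x"
proof (rule ccontr)
  assume n: "\<not> P x"
  have m: "y \<epsilon> sep a (\<lambda>x. \<not> P x) \<longleftrightarrow> y \<epsilon> a \<and> \<not> P y" for y
    by (intro mem_sep fo assms(1))
  have "x \<epsilon> sep a (\<lambda>x. \<not> P x)" using assms(2) n m by blast
  from found[OF this] show False using m assms(3) by blast
qed

lemma not_mem_self: "\<not> x \<epsilon> x"
  using found[of x "upair x x"] by auto

lemma not_mem_cycle: "x \<epsilon> y \<Longrightarrow> \<not> y \<epsilon> x"
  using found[of x "upair x y"] by auto

subsection \<open>Choice\<close>

text \<open>The axiom gives a transversal only for disjoint families, so each nonempty
  \<open>s\<close> is replaced by \<open>{s} \<times> s\<close>. Restricting to subsets of one set
  \<open>U\<close> keeps the family a set.\<close>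

lemma choice_function:
  obtains ch where "tm (\<lambda>v. ch (v 0))" "\<And>s t. sub s U \<Longrightarrow> t \<epsilon> s \<Longrightarrow> ch s \<epsilon> s"
proof -
  define D where "D = sep (pow U) (\<lambda>s. \<exists>t. t \<epsilon> s)"
  have D: "s \<epsilon> D \<longleftrightarrow> sub s U \<and> (\<exists>t. t \<epsilon> s)" for s
    unfolding D_def by (subst mem_sep) (intro fo, simp)
  define Z where "Z = img D (\<lambda>s. cart (upair s s) s)"
  have Z: "z \<epsilon> Z \<longleftrightarrow> (\<exists>s. s \<epsilon> D \<and> z = cart (upair s s) s)" for z
    unfolding Z_def by (subst mem_img) (intro fo, simp)
  have "\<exists>c. \<forall>y. y \<epsilon> Z \<longrightarrow> (\<exists>!z. z \<epsilon> y \<and> z \<epsilon> c)"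
  proof (rule choice)
    fix y assume "y \<epsilon> Z"
    then show "\<exists>z. z \<epsilon> y" by (auto simp: Z D mem_cart)
  next
    fix y z u assume "y \<epsilon> Z" "z \<epsilon> Z" "u \<epsilon> y" "u \<epsilon> z"
    then show "y = z" by (auto simp: Z mem_cart)
  qed
  then obtain c where c: "\<And>y. y \<epsilon> Z \<Longrightarrow> \<exists>!z. z \<epsilon> y \<and> z \<epsilon> c" by blast
  define Q where "Q s t \<longleftrightarrow> t \<epsilon> s \<and> op s t \<epsilon> c" for s t
  have uniq: "\<exists>!t. Q s t" if "s \<epsilon> D" for s
  proof -
    have "\<exists>!z. z \<epsilon> cart (upair s s) s \<and> z \<epsilon> c" using that by (intro c) (auto simp: Z)
    then obtain z where z: "z \<epsilon> cart (upair s s) s" "z \<epsilon> c"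
      "\<And>w. w \<epsilon> cart (upair s s) s \<Longrightarrow> w \<epsilon> c \<Longrightarrow> w = z" by blast
    from z(1) obtain t where t: "t \<epsilon> s" "z = op s t" by (auto simp: mem_cart)
    show ?thesis
    proof (rule ex1I[of _ t])
      show "Q s t" using t z(2) by (simp add: Q_def)
      show "t' = t" if "Q s t'" for t'
        using that z(3)[of "op s t'"] t(2) by (auto simp: Q_def mem_cart)
    qed
  qed
  \<comment> \<open>The default \<open>s\<close> where no unique choice exists makes
    \<open>ch\<close> total with a first-order graph.\<close>
  define ch where "ch s = (if \<exists>!t. Q s t then THE t. Q s t else s)" for s
  show ?thesis
  proof
    have "y = ch s \<longleftrightarrow> (\<exists>!t. Q s t) \<and> Q s y \<or> (\<not> (\<exists>!t. Q s t)) \<and> y = s" for y s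
      unfolding ch_def using theI'[of "Q s"] by auto
    then show "tm (\<lambda>v. ch (v 0))" unfolding tm_def Q_def by (simp only:) (intro fo)
  next
    fix s t assume "sub s U" "t \<epsilon> s"
    then have "\<exists>!t. Q s t" by (intro uniq) (auto simp: D)
    then have "Q s (ch s)" using theI'[of "Q s"] by (simp add: ch_def)
    then show "ch s \<epsilon> s" by (simp add: Q_def)
  qed
qed

subsection \<open>Covering\<close>

definition functional :: "'a \<Rightarrow> bool" where
  "functional f \<longleftrightarrow> (\<forall>t y z. op t y \<epsilon> f \<longrightarrow> op t z \<epsilon> f \<longrightarrow> y = z)"

text \<open>Partial functions are allowed, and \<open>f\<close> need not be contained in
  \<open>a \<times> x\<close>. So the empty set is covered by anything, and passing to a smaller
  \<open>x\<close> or a larger \<open>a\<close> keeps the same \<open>f\<close>.\<close>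

definition covby :: "'a \<Rightarrow> 'a \<Rightarrow> 'a \<Rightarrow> bool" where
  "covby f a x \<longleftrightarrow> functional f \<and> (\<forall>y. y \<epsilon> x \<longrightarrow> (\<exists>t. t \<epsilon> a \<and> op t y \<epsilon> f))"

definition cov :: "'a \<Rightarrow> 'a \<Rightarrow> bool" where
  "cov a x \<longleftrightarrow> (\<exists>f. covby f a x)"

lemma fo_functional [fo]: "tm f \<Longrightarrow> fo (\<lambda>v. functional (f v))"
  by (rule fo_comp1[where P = functional]) (unfold functional_def, intro fo)
lemma fo_covby [fo]: "tm f \<Longrightarrow> tm g \<Longrightarrow> tm h \<Longrightarrow> fo (\<lambda>v. covby (f v) (g v) (h v))"
  by (rule fo_comp3[where P = covby]) (unfold covby_def, intro fo)
lemma fo_cov [fo]: "tm f \<Longrightarrow> tm g \<Longrightarrow> fo (\<lambda>v. cov (f v) (g v))"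
  by (rule fo_comp2[where P = cov]) (unfold cov_def, intro fo)

text \<open>Turns a definable functional relation of the metalogic into a covering that is a set of
  the model; all size estimates enter through this lemma.\<close>

lemma covI:
  assumes "fo (\<lambda>v. R (v 0) (v 1))" "\<And>t y z. R t y \<Longrightarrow> R t z \<Longrightarrow> y = z"
    "\<And>y. y \<epsilon> x \<Longrightarrow> \<exists>t. t \<epsilon> a \<and> R t y"
  shows "cov a x"
  unfolding cov_def covby_def functional_def
  by (rule exI[of _ "rel a x R"]) (use assms(2,3) in \<open>auto simp: op_mem_rel[OF assms(1)]\<close>)

lemma cov_fun:
  assumes "tm (\<lambda>v. F (v 0))" "\<And>y. y \<epsilon> x \<Longrightarrow> \<exists>t. t \<epsilon> a \<and> y = F t"
  shows "cov a x"
proof (rule covI[where R = "\<lambda>t y. y = F t"])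
  show "fo (\<lambda>v. v 1 = F (v 0))" by (intro fo tm_comp1[OF assms(1)])
qed (use assms(2) in auto)

lemma cov_sub: "sub x y \<Longrightarrow> sub a b \<Longrightarrow> cov a y \<Longrightarrow> cov b x"
  unfolding cov_def covby_def sub_def by blast

lemma cov_refl: "cov a a"
  by (rule cov_fun[of "\<lambda>x. x"]) (auto intro: fo)

lemma cov_trans: assumes "cov a b" "cov b c" shows "cov a c"
proof -
  obtain f g where "covby f a b" "covby g b c" using assms by (auto simp: cov_def)
  then show ?thesis
    by (intro covI[where R = "\<lambda>t z. \<exists>y. op t y \<epsilon> f \<and> op y z \<epsilon> g"] fo)
      (unfold covby_def functional_def, blast+)
qed

lemma cov_img: assumes "tm (\<lambda>v. F (v 0))" shows "cov a (img a F)"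
  by (rule cov_fun[OF assms]) (auto simp: mem_img[OF assms])

text \<open>Direct image under the covering is itself a covering of power sets: every
  \<open>y\<close> is the image of its preimage.\<close>

lemma cov_pow: assumes "cov a x" shows "cov (pow a) (pow x)"
proof -
  obtain f where f: "covby f a x" using assms by (auto simp: cov_def)
  define G where "G s = sep x (\<lambda>y. \<exists>t. t \<epsilon> s \<and> op t y \<epsilon> f)" for s
  have G: "y \<epsilon> G s \<longleftrightarrow> y \<epsilon> x \<and> (\<exists>t. t \<epsilon> s \<and> op t y \<epsilon> f)" for y s
    unfolding G_def by (intro mem_sep fo)
  have "tm (\<lambda>v. G (v 0))" unfolding G_def by (intro fo)
  then show ?thesis
  proof (rule cov_fun)
    fix y assume y: "y \<epsilon> pow x"
    define s where "s = sep a (\<lambda>t. \<exists>z. z \<epsilon> y \<and> op t z \<epsilon> f)"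
    have s: "t \<epsilon> s \<longleftrightarrow> t \<epsilon> a \<and> (\<exists>z. z \<epsilon> y \<and> op t z \<epsilon> f)" for t
      unfolding s_def by (intro mem_sep fo)
    have "y = G s"
      by (rule ext) (use f y in \<open>unfold G s covby_def functional_def mem_pow sub_def, blast\<close>)
    moreover have "sub s a" by (simp add: sub_def s)
    ultimately show "\<exists>t. t \<epsilon> pow a \<and> y = G t" by auto
  qed
qed

text \<open>A pair \<open>(t, s)\<close> names the element that the covering chosen for the
  \<open>t\<close>-th member of \<open>z\<close> assigns to \<open>s\<close>. Choice selects one
  covering per member.\<close>

lemma cov_union_of:
  assumes "cov a z" "\<And>y. y \<epsilon> z \<Longrightarrow> cov b y"
  shows "cov (cart a b) (union_of z)"
proof -
  obtain f where f: "covby f a z" using assms(1) by (auto simp: cov_def)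
  \<comment> \<open>Coverings may contain arbitrary further pairs; \<open>W\<close> bounds the
    candidates by a set, as the choice function requires.\<close>
  define W where "W = pow (cart b (union_of z))"
  obtain ch where ch: "tm (\<lambda>v. ch (v 0))" "\<And>s t. sub s W \<Longrightarrow> t \<epsilon> s \<Longrightarrow> ch s \<epsilon> s"
    using choice_function by blast
  define C where "C y = sep W (\<lambda>g. covby g b y)" for y
  have C: "g \<epsilon> C y \<longleftrightarrow> g \<epsilon> W \<and> covby g b y" for g y
    unfolding C_def by (intro mem_sep fo)
  have tmC [fo]: "tm f \<Longrightarrow> tm (\<lambda>v. C (f v))" for f
    by (rule tm_comp1[where F = C]) (unfold C_def, intro fo)
  have tmch [fo]: "tm f \<Longrightarrow> tm (\<lambda>v. ch (f v))" for f
    by (rule tm_comp1[where F = ch, OF ch(1)])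
  have g: "covby (ch (C y)) b y" if "y \<epsilon> z" for y
  proof -
    obtain g where g: "covby g b y" using assms(2)[OF \<open>y \<epsilon> z\<close>] by (auto simp: cov_def)
    \<comment> \<open>Trimming \<open>g\<close> to \<open>b\<close> and \<open>y\<close> shows that
      a candidate inside \<open>W\<close> exists.\<close>
    define g' where "g' = rel b y (\<lambda>t w. op t w \<epsilon> g)"
    have g': "p \<epsilon> g' \<longleftrightarrow> (\<exists>t w. p = op t w \<and> t \<epsilon> b \<and> w \<epsilon> y \<and> op t w \<epsilon> g)" for p
      unfolding g'_def by (intro mem_rel fo)
    have "g' \<epsilon> W" using that by (auto simp: W_def sub_def g' mem_cart)
    moreover have "covby g' b y" using g unfolding covby_def functional_def by (auto simp: g')
    ultimately have "ch (C y) \<epsilon> C y" by (intro ch(2)[of _ g']) (auto simp: C sub_def)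
    then show ?thesis by (simp add: C)
  qed
  show ?thesis
  proof (rule covI[where R = "\<lambda>p w. \<exists>t s y. p = op t s \<and> y \<epsilon> z \<and> op t y \<epsilon> f \<and> op s w \<epsilon> ch (C y)"])
    show "fo (\<lambda>v. \<exists>t s y. v 0 = op t s \<and> y \<epsilon> z \<and> op t y \<epsilon> f \<and> op s (v 1) \<epsilon> ch (C y))"
      by (intro fo)
  next
    fix p w w'
    assume "\<exists>t s y. p = op t s \<and> y \<epsilon> z \<and> op t y \<epsilon> f \<and> op s w \<epsilon> ch (C y)"
      "\<exists>t s y. p = op t s \<and> y \<epsilon> z \<and> op t y \<epsilon> f \<and> op s w' \<epsilon> ch (C y)"
    then obtain t s y t' s' y' where *: "p = op t s" "y \<epsilon> z" "op t y \<epsilon> f" "op s w \<epsilon> ch (C y)"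
      "p = op t' s'" "y' \<epsilon> z" "op t' y' \<epsilon> f" "op s' w' \<epsilon> ch (C y')" by blast
    then have "t = t'" "s = s'" by auto
    moreover from this * have "y = y'" using f unfolding covby_def functional_def by blast
    ultimately show "w = w'" using * g unfolding covby_def functional_def by blast
  next
    fix w assume "w \<epsilon> union_of z"
    then obtain y where y: "y \<epsilon> z" "w \<epsilon> y" by auto
    obtain t where "t \<epsilon> a" "op t y \<epsilon> f" using f y unfolding covby_def by blast
    moreover obtain s where "s \<epsilon> b" "op s w \<epsilon> ch (C y)"
      using g[OF y(1)] y(2) unfolding covby_def by blast
    ultimately show "\<exists>t. t \<epsilon> cart a b \<and> (\<exists>ta s y. t = op ta s \<and> y \<epsilon> z \<and> op ta y \<epsilon> f \<and> op s w \<epsilon> ch (C y))"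
      using y(1) by (auto simp: mem_cart)
  qed
qed

lemma tm_if [fo]: "fo P \<Longrightarrow> tm f \<Longrightarrow> tm g \<Longrightarrow> tm (\<lambda>v. if P v then f v else g v)"
proof -
  assume a: "fo P" "tm f" "tm g"
  have "fo (\<lambda>v. (P (\<lambda>i. v (Suc i)) \<and> v 0 = f (\<lambda>i. v (Suc i))) \<or>
    (\<not> P (\<lambda>i. v (Suc i)) \<and> v 0 = g (\<lambda>i. v (Suc i))))"
    using fo_ren[OF a(1)] by (intro fo_conj fo_disj fo_not tm_shift[OF a(2)] tm_shift[OF a(3)])
  moreover have "(y = (if P u then f u else g u)) \<longleftrightarrow> (P u \<and> y = f u) \<or> (\<not> P u \<and> y = g u)" for y u
    by auto
  ultimately show ?thesis unfolding tm_def by simp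
qed

subsection \<open>Levels of the cumulative hierarchy\<close>

text \<open>
  Level Theory (Potter, Button) describes the sets \<open>V\<^sub>\<alpha>\<close> without ordinals: \<open>pot h\<close> for a
  history \<open>h\<close> is a level, and levels are well-ordered by membership.
\<close>

definition inter2 :: "'a \<Rightarrow> 'a \<Rightarrow> 'a" where "inter2 x h = sep x (\<lambda>z. z \<epsilon> h)"
definition pot :: "'a \<Rightarrow> 'a" where "pot a = sep (pow (union_of a)) (\<lambda>x. \<exists>c. c \<epsilon> a \<and> sub x c)"
definition history :: "'a \<Rightarrow> bool" where "history h \<longleftrightarrow> (\<forall>x. x \<epsilon> h \<longrightarrow> x = pot (inter2 x h))"
definition level :: "'a \<Rightarrow> bool" where "level s \<longleftrightarrow> (\<exists>h. history h \<and> s = pot h)"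
definition levels_in :: "'a \<Rightarrow> 'a" where "levels_in s = sep s level"

lemma mem_inter2 [simp]: "z \<epsilon> inter2 x h \<longleftrightarrow> z \<epsilon> x \<and> z \<epsilon> h"
  unfolding inter2_def by (intro mem_sep fo)
lemma tm_inter2 [fo]: "tm f \<Longrightarrow> tm g \<Longrightarrow> tm (\<lambda>v. inter2 (f v) (g v))"
  by (rule tm_comp2[where F = inter2]) (unfold inter2_def, intro fo)
lemma mem_pot: "x \<epsilon> pot a \<longleftrightarrow> (\<exists>c. c \<epsilon> a \<and> sub x c)"
proof -
  have "x \<epsilon> pot a \<longleftrightarrow> x \<epsilon> pow (union_of a) \<and> (\<exists>c. c \<epsilon> a \<and> sub x c)"
    unfolding pot_def by (intro mem_sep fo)
  then show ?thesis by (auto simp: sub_def)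
qed
lemma tm_pot [fo]: "tm f \<Longrightarrow> tm (\<lambda>v. pot (f v))"
  by (rule tm_comp1[where F = pot]) (unfold pot_def, intro fo)
lemma fo_history [fo]: "tm f \<Longrightarrow> fo (\<lambda>v. history (f v))"
  by (rule fo_comp1[where P = history]) (unfold history_def, intro fo)
lemma fo_level [fo]: "tm f \<Longrightarrow> fo (\<lambda>v. level (f v))"
  by (rule fo_comp1[where P = level]) (unfold level_def, intro fo)
lemma mem_levels_in [simp]: "r \<epsilon> levels_in s \<longleftrightarrow> r \<epsilon> s \<and> level r"
  unfolding levels_in_def by (intro mem_sep fo)
lemma tm_levels_in [fo]: "tm f \<Longrightarrow> tm (\<lambda>v. levels_in (f v))"
  by (rule tm_comp1[where F = levels_in]) (unfold levels_in_def, intro fo)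

lemma sub_refl [simp]: "sub x x" by (simp add: sub_def)
lemma sub_trans: "sub x y \<Longrightarrow> sub y z \<Longrightarrow> sub x z" by (simp add: sub_def)
lemma subD: "sub x y \<Longrightarrow> z \<epsilon> x \<Longrightarrow> z \<epsilon> y" by (simp add: sub_def)
lemma sub_antisym: "sub x y \<Longrightarrow> sub y x \<Longrightarrow> x = y" by (rule ext) (auto simp: sub_def)

lemma history_mem: "history h \<Longrightarrow> x \<epsilon> h \<Longrightarrow> y \<epsilon> x \<longleftrightarrow> (\<exists>c. c \<epsilon> x \<and> c \<epsilon> h \<and> sub y c)"
proof -
  assume "history h" "x \<epsilon> h"
  then have "x = pot (inter2 x h)" by (simp add: history_def)
  then have "y \<epsilon> x \<longleftrightarrow> y \<epsilon> pot (inter2 x h)" by simp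
  then show ?thesis by (simp add: mem_pot conj_assoc)
qed

text \<open>An element \<open>y\<close> of \<open>x\<close> lies below some \<open>c\<close> in both
  \<open>x\<close> and \<open>h\<close>; \<open>c\<close> is transitive by induction, so elements of
  \<open>y\<close> are elements of \<open>c\<close>, hence subsets of \<open>c\<close>, hence in
  \<open>x\<close>.\<close>

lemma history_trans:
  assumes "history h" "x \<epsilon> h" shows "\<forall>y. y \<epsilon> x \<longrightarrow> sub y x"
proof (rule set_induct[where a = h and P = "\<lambda>x. \<forall>y. y \<epsilon> x \<longrightarrow> sub y x"])
  show "fo (\<lambda>v. \<forall>y. y \<epsilon> v 0 \<longrightarrow> sub y (v 0))" by (intro fo)
  show "x \<epsilon> h" by (rule assms(2))
next
  fix x assume x: "x \<epsilon> h" and IH: "\<And>c. c \<epsilon> x \<Longrightarrow> c \<epsilon> h \<Longrightarrow> \<forall>y. y \<epsilon> c \<longrightarrow> sub y c"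
  show "\<forall>y. y \<epsilon> x \<longrightarrow> sub y x"
  \<comment> \<open>\<open>allI\<close> and \<open>impI\<close> are hidden by the rules of \<open>proves\<close>.\<close>
  proof (intro HOL.allI HOL.impI)
    fix y assume "y \<epsilon> x"
    then obtain c where c: "c \<epsilon> x" "c \<epsilon> h" "sub y c" using history_mem[OF assms(1) x] by blast
    show "sub y x" unfolding sub_def
    proof (intro HOL.allI HOL.impI)
      fix z assume "z \<epsilon> y"
      then have "sub z c" using IH[OF c(1,2)] c(3) by (auto simp: sub_def)
      then show "z \<epsilon> x" using history_mem[OF assms(1) x] c by blast
    qed
  qed
qed

text \<open>By transitivity of \<open>x\<close>, the part of the history below \<open>x\<close> is
  again a history, and it generates \<open>x\<close>.\<close>

lemma history_lev: assumes "history h" "x \<epsilon> h" shows "level x"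
proof -
  have "inter2 y (inter2 x h) = inter2 y h" if "y \<epsilon> x" for y
    using history_trans[OF assms] that by (intro ext) (auto simp: sub_def)
  then have "history (inter2 x h)" using assms(1) by (auto simp: history_def)
  moreover have "x = pot (inter2 x h)" using assms by (simp add: history_def)
  ultimately show ?thesis by (auto simp: level_def)
qed

lemma level_potent: "level s \<Longrightarrow> c \<epsilon> s \<Longrightarrow> sub x c \<Longrightarrow> x \<epsilon> s"
  unfolding level_def mem_pot using sub_trans by (force simp: mem_pot)

lemma level_trans: assumes "level s" "c \<epsilon> s" shows "sub c s"
proof -
  obtain h where h: "history h" "s = pot h" using assms(1) by (auto simp: level_def)
  obtain x where x: "x \<epsilon> h" "sub c x" using assms(2) h by (auto simp: mem_pot)
  have "z \<epsilon> s" if "z \<epsilon> c" for z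
    using history_mem[OF h(1) x(1), of z] subD[OF x(2) that] by (auto simp: h(2) mem_pot)
  then show ?thesis by (simp add: sub_def)
qed

text \<open>Every history generating \<open>s\<close> consists of levels in \<open>s\<close>, so the
  levels below can replace it. A level is thus determined by the levels in it.\<close>

lemma level_mem: assumes "level s" shows "x \<epsilon> s \<longleftrightarrow> (\<exists>r. r \<epsilon> levels_in s \<and> sub x r)"
proof
  assume "x \<epsilon> s"
  obtain h where h: "history h" "s = pot h" using assms(1) by (auto simp: level_def)
  obtain c where c: "c \<epsilon> h" "sub x c" using \<open>x \<epsilon> s\<close> h by (auto simp: mem_pot)
  then have "c \<epsilon> s" by (auto simp: h mem_pot)
  then show "\<exists>r. r \<epsilon> levels_in s \<and> sub x r" using c history_lev[OF h(1)] by auto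
qed (use level_potent[OF assms] in auto)

lemma level_eqI: "level s \<Longrightarrow> level t \<Longrightarrow> levels_in s = levels_in t \<Longrightarrow> s = t"
  by (rule ext) (simp only: level_mem[of s] level_mem[of t])

lemma levels_in_down: "level s \<Longrightarrow> r \<epsilon> levels_in s \<Longrightarrow> q \<epsilon> levels_in r \<Longrightarrow> q \<epsilon> levels_in s"
  using level_trans[of s r] by (auto simp: sub_def)

lemma level_induct:
  assumes "fo (\<lambda>v. P (v 0))" "level s" "\<And>s. level s \<Longrightarrow> (\<And>r. r \<epsilon> levels_in s \<Longrightarrow> P r) \<Longrightarrow> P s"
  shows "P s"
proof (rule assms(3)[OF assms(2)])
  fix r assume "r \<epsilon> levels_in s"
  show "P r"
  proof (rule set_induct[where P = P and a = "levels_in s", OF assms(1) \<open>r \<epsilon> levels_in s\<close>])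
    fix x assume x: "x \<epsilon> levels_in s" and IH: "\<And>y. y \<epsilon> x \<Longrightarrow> y \<epsilon> levels_in s \<Longrightarrow> P y"
    show "P x"
    proof (rule assms(3))
      show "level x" using x by simp
      show "P y" if y: "y \<epsilon> levels_in x" for y
      proof (rule IH)
        show "y \<epsilon> x" using y by simp
        show "y \<epsilon> levels_in s" by (rule levels_in_down[OF assms(2) x y])
      qed
    qed
  qed
qed

text \<open>Double induction: for incomparable \<open>s\<close> and \<open>t\<close>, the two
  hypotheses put each level of one into the other, so both have the same levels below and are
  equal.\<close>

lemma level_linear:
  assumes "level s" "level t" shows "s \<epsilon> t \<or> s = t \<or> t \<epsilon> s"
proof -
  have "\<forall>t. level t \<longrightarrow> s \<epsilon> t \<or> s = t \<or> t \<epsilon> s"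
  proof (rule level_induct[where P = "\<lambda>s. \<forall>t. level t \<longrightarrow> s \<epsilon> t \<or> s = t \<or> t \<epsilon> s"])
    show "fo (\<lambda>v. \<forall>t. level t \<longrightarrow> v 0 \<epsilon> t \<or> v 0 = t \<or> t \<epsilon> v 0)" by (intro fo)
    show "level s" by (rule assms(1))
  next
    fix s assume s: "level s" and
      IH: "\<And>r. r \<epsilon> levels_in s \<Longrightarrow> \<forall>t. level t \<longrightarrow> r \<epsilon> t \<or> r = t \<or> t \<epsilon> r"
    show "\<forall>t. level t \<longrightarrow> s \<epsilon> t \<or> s = t \<or> t \<epsilon> s"
    proof (intro HOL.allI HOL.impI)
      fix t assume "level t"
      show "s \<epsilon> t \<or> s = t \<or> t \<epsilon> s"
      proof (rule level_induct[where P = "\<lambda>t. s \<epsilon> t \<or> s = t \<or> t \<epsilon> s"])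
        show "fo (\<lambda>v. s \<epsilon> v 0 \<or> s = v 0 \<or> v 0 \<epsilon> s)" by (intro fo)
        show "level t" by fact
      next
        fix t assume t: "level t" and IH2: "\<And>r. r \<epsilon> levels_in t \<Longrightarrow> s \<epsilon> r \<or> s = r \<or> r \<epsilon> s"
        show "s \<epsilon> t \<or> s = t \<or> t \<epsilon> s"
        proof (rule ccontr)
          assume n: "\<not> ?thesis"
          have "levels_in s = levels_in t"
          proof (rule ext)
            fix r
            have "r \<epsilon> t" if "r \<epsilon> levels_in s"
              using IH[OF that] t n that subD[OF level_trans[OF s]] by auto
            moreover have "r \<epsilon> s" if "r \<epsilon> levels_in t"
              using IH2[OF that] n that subD[OF level_trans[OF t]] by auto
            ultimately show "r \<epsilon> levels_in s \<longleftrightarrow> r \<epsilon> levels_in t" by auto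
          qed
          then show False using level_eqI[OF s t] n by blast
        qed
      qed
    qed
  qed
  then show ?thesis using assms(2) by blast
qed

text \<open>Burali-Forti: a set \<open>Y\<close> of all levels would be a history, and the level
  \<open>pot Y\<close> would be an element of itself.\<close>

lemma no_set_of_levels: "\<exists>l. level l \<and> \<not> l \<epsilon> Z"
proof (rule ccontr)
  assume all: "\<not> ?thesis"
  define Y where "Y = sep Z level"
  have Y: "x \<epsilon> Y \<longleftrightarrow> level x" for x using all mem_sep[of level x Z, OF fo_level[OF tm_var]] by (auto simp: Y_def)
  have "history Y" unfolding history_def
  proof (intro HOL.allI HOL.impI)
    fix x assume "x \<epsilon> Y"
    then have x: "level x" by (simp add: Y)
    show "x = pot (inter2 x Y)"
      by (rule ext, subst level_mem[OF x]) (simp add: mem_pot Y)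
  qed
  then have "level (pot Y)" by (auto simp: level_def)
  then have "pot Y \<epsilon> pot Y" by (auto simp: mem_pot Y)
  then show False using not_mem_self by blast
qed

text \<open>
  The Hartogs argument: a covering \<open>f\<close> of \<open>levels_in l\<close> pulls membership back to a relation on \<open>X\<close>,
  which determines \<open>l\<close>; if all levels were covered by \<open>X\<close>, they would form a set.
\<close>

definition hartogs :: "'a \<Rightarrow> 'a \<Rightarrow> 'a \<Rightarrow> 'a \<Rightarrow> bool" where
  "hartogs X f l r \<longleftrightarrow> level l \<and> covby f X (levels_in l) \<and>
     (\<forall>t y. op t y \<epsilon> f \<longrightarrow> t \<epsilon> X \<and> y \<epsilon> levels_in l) \<and> sub r (cart X X) \<and>
     (\<forall>t u. op t u \<epsilon> r \<longleftrightarrow> (\<exists>y z. op t y \<epsilon> f \<and> op u z \<epsilon> f \<and> (y = z \<or> y \<epsilon> z)))"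

text \<open>The relation \<open>r\<close> determines the covering: its diagonal gives the domain and
  its strict part gives membership between values. Induction on \<open>y\<close> then shows that
  both coverings have the same value at \<open>t\<close>.\<close>

lemma hartogs_sub:
  assumes "hartogs X f l r" "hartogs X f' l' r" "op t y \<epsilon> f"
  shows "op t y \<epsilon> f'"
proof -
  have l: "level l" "level l'" using assms by (auto simp: hartogs_def)
  have functional: "y = z" if "op t y \<epsilon> f" "op t z \<epsilon> f" for t y z
    using that assms(1) unfolding hartogs_def covby_def functional_def by blast
  have fn': "y = z" if "op t y \<epsilon> f'" "op t z \<epsilon> f'" for t y z
    using that assms(2) unfolding hartogs_def covby_def functional_def by blast
  have ran: "y \<epsilon> levels_in l" if "op t y \<epsilon> f" for t y using that assms(1) unfolding hartogs_def by blast
  have ran': "y \<epsilon> levels_in l'" if "op t y \<epsilon> f'" for t y using that assms(2) unfolding hartogs_def by blast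
  have cov: "\<exists>t. op t y \<epsilon> f" if "y \<epsilon> levels_in l" for y
    using that assms(1) unfolding hartogs_def covby_def by blast
  have cov': "\<exists>t. op t y \<epsilon> f'" if "y \<epsilon> levels_in l'" for y
    using that assms(2) unfolding hartogs_def covby_def by blast
  have r: "op t u \<epsilon> r \<longleftrightarrow> (\<exists>y z. op t y \<epsilon> f \<and> op u z \<epsilon> f \<and> (y = z \<or> y \<epsilon> z))" for t u
    using assms(1) unfolding hartogs_def by blast
  have r': "op t u \<epsilon> r \<longleftrightarrow> (\<exists>y z. op t y \<epsilon> f' \<and> op u z \<epsilon> f' \<and> (y = z \<or> y \<epsilon> z))" for t u
    using assms(2) unfolding hartogs_def by blast
  \<comment> \<open>A covering may repeat values, so \<open>r\<close> is only a preorder; since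
    membership has no cycles of length one or two, the strict part of \<open>r\<close> is exactly
    membership.\<close>
  have lt: "op u t \<epsilon> r \<and> \<not> op t u \<epsilon> r \<longleftrightarrow> z \<epsilon> y" if "op t y \<epsilon> f" "op u z \<epsilon> f" for t u y z
    unfolding r using that functional[OF that(1)] functional[OF that(2)] not_mem_cycle not_mem_self by blast
  have lt': "op u t \<epsilon> r \<and> \<not> op t u \<epsilon> r \<longleftrightarrow> z \<epsilon> y" if "op t y \<epsilon> f'" "op u z \<epsilon> f'" for t u y z
    unfolding r' using that fn'[OF that(1)] fn'[OF that(2)] not_mem_cycle not_mem_self by blast
  have dom: "(\<exists>y. op t y \<epsilon> f) \<longleftrightarrow> op t t \<epsilon> r" for t unfolding r by blast
  have dom': "(\<exists>y. op t y \<epsilon> f') \<longleftrightarrow> op t t \<epsilon> r" for t unfolding r' by blast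
  have "\<forall>t. op t y \<epsilon> f \<longrightarrow> op t y \<epsilon> f'"
  proof (rule set_induct[where a = "levels_in l" and P = "\<lambda>y. \<forall>t. op t y \<epsilon> f \<longrightarrow> op t y \<epsilon> f'"])
    show "fo (\<lambda>v. \<forall>t. op t (v 0) \<epsilon> f \<longrightarrow> op t (v 0) \<epsilon> f')" by (intro fo)
    show "y \<epsilon> levels_in l" by (rule ran[OF assms(3)])
  next
    fix y assume y: "y \<epsilon> levels_in l" and
      IH: "\<And>z. z \<epsilon> y \<Longrightarrow> z \<epsilon> levels_in l \<Longrightarrow> \<forall>t. op t z \<epsilon> f \<longrightarrow> op t z \<epsilon> f'"
    show "\<forall>t. op t y \<epsilon> f \<longrightarrow> op t y \<epsilon> f'"
    proof (intro HOL.allI HOL.impI)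
      fix t assume t: "op t y \<epsilon> f"
      then obtain y' where y': "op t y' \<epsilon> f'" using dom dom' by blast
      have "levels_in y = levels_in y'"
      proof (rule ext)
        fix z
        have "z \<epsilon> levels_in y'" if z: "z \<epsilon> levels_in y"
        proof -
          have zl: "z \<epsilon> levels_in l" by (rule levels_in_down[OF l(1) y z])
          then obtain u where u: "op u z \<epsilon> f" using cov by blast
          then have "op u z \<epsilon> f'" using IH z zl by auto
          then show ?thesis using lt[OF t u] lt'[OF y'] z by auto
        qed
        moreover have "z \<epsilon> levels_in y" if z: "z \<epsilon> levels_in y'"
        proof -
          have "z \<epsilon> levels_in l'" by (rule levels_in_down[OF l(2) ran'[OF y'] z])
          then obtain u where u: "op u z \<epsilon> f'" using cov' by blast
          then obtain z2 where z2: "op u z2 \<epsilon> f" using dom dom' by blast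
          then have "z2 \<epsilon> y" using lt[OF t z2] lt'[OF y' u] z by auto
          then have "op u z2 \<epsilon> f'" using IH z2 ran by blast
          then have "z2 = z" using fn' u by blast
          then show ?thesis using \<open>z2 \<epsilon> y\<close> z by auto
        qed
        ultimately show "z \<epsilon> levels_in y \<longleftrightarrow> z \<epsilon> levels_in y'" by blast
      qed
      moreover have "level y" "level y'" using y ran'[OF y'] by simp_all
      ultimately have "y = y'" using level_eqI by blast
      then show "op t y \<epsilon> f'" using y' by simp
    qed
  qed
  then show ?thesis using assms(3) by blast
qed

lemma level_not_covered: "\<exists>l. level l \<and> \<not> cov X (levels_in l)"
proof (rule ccontr)
  assume n: "\<not> ?thesis"
  \<comment> \<open>The possible \<open>r\<close> form a set and each determines at most one level,
    so Replacement collects all levels covered by \<open>X\<close>.\<close>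
  have 1: "is_ext (\<lambda>l. \<exists>r. r \<epsilon> pow (cart X X) \<and> (\<exists>f. hartogs X f l r))"
  proof (rule is_ext_repl)
    show "fo (\<lambda>v. \<exists>f. hartogs X f (v 1) (v 0))" unfolding hartogs_def by (intro fo)
  next
    fix r l l' assume "\<exists>f. hartogs X f l r" "\<exists>f. hartogs X f l' r"
    then obtain f f' where f: "hartogs X f l r" "hartogs X f' l' r" by blast
    have "op t y \<epsilon> f \<longleftrightarrow> op t y \<epsilon> f'" for t y
      using hartogs_sub[OF f] hartogs_sub[OF f(2,1)] by blast
    moreover have "y \<epsilon> levels_in l \<longleftrightarrow> (\<exists>t. op t y \<epsilon> f)" for y
      using f(1) unfolding hartogs_def covby_def by blast
    moreover have "y \<epsilon> levels_in l' \<longleftrightarrow> (\<exists>t. op t y \<epsilon> f')" for y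
      using f(2) unfolding hartogs_def covby_def by blast
    ultimately have "levels_in l = levels_in l'" by (intro ext) presburger
    moreover have "level l" "level l'" using f by (simp_all add: hartogs_def)
    ultimately show "l = l'" using level_eqI by blast
  qed
  obtain Z where Z: "\<And>l. l \<epsilon> Z \<longleftrightarrow> (\<exists>r. r \<epsilon> pow (cart X X) \<and> (\<exists>f. hartogs X f l r))"
    using 1 unfolding is_ext_def by blast
  have "l \<epsilon> Z" if l: "level l" for l
  proof -
    obtain g where g: "covby g X (levels_in l)" using n l by (auto simp: cov_def)
    \<comment> \<open>\<open>hartogs\<close> also restricts domain and range, so the given covering
      is trimmed first.\<close>
    define f where "f = rel X (levels_in l) (\<lambda>t y. op t y \<epsilon> g)"
    have f: "op t y \<epsilon> f \<longleftrightarrow> t \<epsilon> X \<and> y \<epsilon> levels_in l \<and> op t y \<epsilon> g" for t y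
      unfolding f_def by (intro op_mem_rel fo)
    define r where "r = rel X X (\<lambda>t u. \<exists>y z. op t y \<epsilon> f \<and> op u z \<epsilon> f \<and> (y = z \<or> y \<epsilon> z))"
    have r: "p \<epsilon> r \<longleftrightarrow> (\<exists>t u. p = op t u \<and> t \<epsilon> X \<and> u \<epsilon> X \<and>
       (\<exists>y z. op t y \<epsilon> f \<and> op u z \<epsilon> f \<and> (y = z \<or> y \<epsilon> z)))" for p
      unfolding r_def by (intro mem_rel fo)
    have "sub r (cart X X)" by (auto simp: sub_def r mem_cart)
    moreover have "covby f X (levels_in l)"
      using g unfolding covby_def functional_def f by blast
    ultimately have "hartogs X f l r"
      unfolding hartogs_def r op_eq using l f by blast
    then show ?thesis using Z \<open>sub r (cart X X)\<close> by auto
  qed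
  then show False using no_set_of_levels[of Z] by blast
qed

text \<open>
  If the predicate \<open>sm\<close> is closed under unions over small index sets, then the least level with
  not \<open>sm\<close>-many levels below has large cofinality.
\<close>

lemma closed_level:
  assumes fo_sm: "fo (\<lambda>v. sm (v 0))"
    and sm_sub: "\<And>x y. sub x y \<Longrightarrow> sm y \<Longrightarrow> sm x"
    and sm_single: "\<And>c. sm (upair c c)"
    and sm_Uni: "\<And>z. small z \<Longrightarrow> (\<And>y. y \<epsilon> z \<Longrightarrow> sm y) \<Longrightarrow> sm (union_of z)"
    and small_img: "\<And>F z. tm (\<lambda>v. F (v 0)) \<Longrightarrow> small z \<Longrightarrow> small (img z F)"
    and small_upair: "\<And>x y. small (upair x y)"
    and ex: "\<exists>l. level l \<and> \<not> sm (levels_in l)"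
  obtains l where "level l" "\<not> sm (levels_in l)" "\<And>x. sub x l \<Longrightarrow> small x \<Longrightarrow> x \<epsilon> l"
    "\<And>y. y \<epsilon> l \<Longrightarrow> \<exists>r. r \<epsilon> levels_in l \<and> y \<epsilon> r"
proof -
  have "\<exists>l. level l \<and> \<not> sm (levels_in l) \<and> (\<forall>r. r \<epsilon> levels_in l \<longrightarrow> sm (levels_in r))"
  proof (rule ccontr)
    assume n: "\<not> ?thesis"
    have "sm (levels_in l)" if "level l" for l
    proof (rule level_induct[where P = "\<lambda>l. sm (levels_in l)"])
      show "fo (\<lambda>v. sm (levels_in (v 0)))" by (rule fo_comp1[where P = sm, OF fo_sm]) (intro fo)
      show "level l" by (rule that)
      show "sm (levels_in s)" if "level s" "\<And>r. r \<epsilon> levels_in s \<Longrightarrow> sm (levels_in r)" for s using n that by blast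
    qed
    then show False using ex by blast
  qed
  then obtain l where l: "level l" "\<not> sm (levels_in l)" "\<And>r. r \<epsilon> levels_in l \<Longrightarrow> sm (levels_in r)" by blast
  have limit: "\<exists>r. r \<epsilon> levels_in l \<and> y \<epsilon> r" if y: "y \<epsilon> l" for y
  proof (rule ccontr)
    assume n: "\<not> ?thesis"
    obtain c where c: "c \<epsilon> levels_in l" "sub y c" using level_mem[OF l(1)] y by blast
    \<comment> \<open>A level above \<open>c\<close> would contain \<open>y\<close>. So
      \<open>c\<close> would be the last level below \<open>l\<close>, and adding this single level
      to \<open>levels_in c\<close> preserves \<open>sm\<close>.\<close>
    have "r \<epsilon> levels_in c \<or> r = c" if "r \<epsilon> levels_in l" for r
      using level_linear[of r c] level_potent[of r c y] that c n by auto
    then have "sub (levels_in l) (union_of (upair (levels_in c) (upair c c)))" unfolding sub_def mem_union_of mem_upair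
      by (metis mem_upair)
    moreover have "sm (union_of (upair (levels_in c) (upair c c)))"
      using l(3)[OF c(1)] sm_single by (intro sm_Uni small_upair) auto
    ultimately show False using sm_sub l(2) by blast
  qed
  have closed: "x \<epsilon> l" if x: "sub x l" "small x" for x
  proof (rule ccontr)
    assume n: "\<not> x \<epsilon> l"
    \<comment> \<open>\<open>F y\<close> collects the levels that \<open>y\<close> has not yet
      entered; it is bounded by a level containing \<open>y\<close>, hence \<open>sm\<close>. If
      \<open>x\<close> is not in \<open>l\<close>, no level below includes \<open>x\<close>, so
      these sets together exhaust the levels below \<open>l\<close>.\<close>
    define F where "F y = sep (levels_in l) (\<lambda>r. \<not> y \<epsilon> r)" for y
    have F: "r \<epsilon> F y \<longleftrightarrow> r \<epsilon> levels_in l \<and> \<not> y \<epsilon> r" for r y unfolding F_def by (intro mem_sep fo)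
    have tmF: "tm (\<lambda>v. F (v 0))" unfolding F_def by (intro fo)
    have "sm (F y)" if "y \<epsilon> x" for y
    proof -
      obtain r where r: "r \<epsilon> levels_in l" "y \<epsilon> r" using limit[OF subD[OF x(1) \<open>y \<epsilon> x\<close>]] by blast
      have "m \<epsilon> levels_in r" if m: "m \<epsilon> F y" for m
      proof -
        have "level m" "\<not> y \<epsilon> m" "level r" using m r by (simp_all add: F)
        then show ?thesis using level_linear[of m r] subD[OF level_trans[of m r] r(2)] r(2) by auto
      qed
      then have "sub (F y) (levels_in r)" by (simp add: sub_def)
      then show ?thesis using sm_sub l(3)[OF r(1)] by blast
    qed
    then have "sm (union_of (img x F))"
      using small_img[OF tmF x(2)] by (intro sm_Uni) (auto simp: mem_img[OF tmF])
    moreover have "sub (levels_in l) (union_of (img x F))" unfolding sub_def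
    proof (intro HOL.allI HOL.impI)
      fix r assume r: "r \<epsilon> levels_in l"
      then have "\<not> sub x r" using level_mem[OF l(1)] n by blast
      then obtain y where "y \<epsilon> x" "\<not> y \<epsilon> r" by (auto simp: sub_def)
      then show "r \<epsilon> union_of (img x F)" using r by (auto simp: mem_img[OF tmF] F)
    qed
    ultimately show False using sm_sub l(2) by blast
  qed
  show ?thesis using that l limit closed by blast
qed

end

subsection \<open>An inaccessible cardinal\<close>

text \<open>In the following locale \<open>w\<close> is \<open>\<omega>\<close> and \<open>e\<close> is the empty set.\<close>

locale zf_inacc = zf_model +
  fixes k w e :: 'a
  assumes k_trans: "a \<epsilon> k \<Longrightarrow> sub a k"
    and k_trans2: "a \<epsilon> k \<Longrightarrow> b \<epsilon> a \<Longrightarrow> sub b a"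
    and k_regular: "a \<epsilon> k \<Longrightarrow> tm (\<lambda>v. F (v 0)) \<Longrightarrow> (\<And>t. t \<epsilon> a \<Longrightarrow> F t \<epsilon> k) \<Longrightarrow>
        \<exists>b. b \<epsilon> k \<and> (\<forall>t. t \<epsilon> a \<longrightarrow> F t \<epsilon> b)"
    and k_strong_limit: "a \<epsilon> k \<Longrightarrow> \<exists>b. b \<epsilon> k \<and> cov b (pow a)"
    and w_k: "w \<epsilon> k"
    and e_w: "e \<epsilon> w"
    and e_empty: "\<not> x \<epsilon> e"
    and w_succ: "y \<epsilon> w \<Longrightarrow> un2 y (upair y y) \<epsilon> w"
begin

definition small :: "'a \<Rightarrow> bool" where "small x \<longleftrightarrow> (\<exists>a. a \<epsilon> k \<and> cov a x)"

lemma fo_small [fo]: "tm f \<Longrightarrow> fo (\<lambda>v. small (f v))"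
  by (rule fo_comp1[where P = small]) (unfold small_def, intro fo)

lemma small_k: "a \<epsilon> k \<Longrightarrow> small a"
  unfolding small_def using cov_refl by blast
lemma small_cov: "small x \<Longrightarrow> cov x y \<Longrightarrow> small y"
  unfolding small_def using cov_trans by blast
lemma small_sub: "sub x y \<Longrightarrow> small y \<Longrightarrow> small x"
  unfolding small_def using cov_sub sub_refl by blast
lemma small_img: "tm (\<lambda>v. F (v 0)) \<Longrightarrow> small x \<Longrightarrow> small (img x F)"
  using small_cov cov_img by blast
lemma small_pow: "small x \<Longrightarrow> small (pow x)"
  unfolding small_def using cov_trans cov_pow k_strong_limit by blast

lemma two_elements: "\<exists>s. s \<epsilon> w \<and> s \<noteq> e"
  using w_succ[OF e_w] e_empty by (metis mem_un2 mem_upair)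

text \<open>Any element of \<open>k\<close> with at least two elements can index a pair;
  \<open>w\<close> serves, with \<open>e\<close> naming \<open>x\<close> and all other elements
  naming \<open>y\<close>.\<close>

lemma small_upair: "small (upair x y)"
proof -
  have "cov w (upair x y)"
  proof (rule cov_fun[where F = "\<lambda>t. if t = e then x else y"])
    show "tm (\<lambda>v. if v 0 = e then x else y)" by (intro fo)
  next
    fix z assume "z \<epsilon> upair x y"
    then show "\<exists>t. t \<epsilon> w \<and> z = (if t = e then x else y)" using e_w two_elements by auto
  qed
  then show ?thesis using w_k by (auto simp: small_def)
qed

text \<open>Regularity, applied to a map on \<open>w\<close> with values \<open>a\<close> and
  \<open>b\<close>, gives one \<open>c\<close> in \<open>k\<close> above both. The product then lies
  in the double power set of \<open>c\<close>, which is small as \<open>k\<close> is a strong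
  limit.\<close>

lemma small_cart: assumes "a \<epsilon> k" "b \<epsilon> k" shows "small (cart a b)"
proof -
  have "\<exists>c. c \<epsilon> k \<and> (\<forall>t. t \<epsilon> w \<longrightarrow> (if t = e then a else b) \<epsilon> c)"
  proof (rule k_regular[OF w_k])
    show "tm (\<lambda>v. if v 0 = e then a else b)" by (intro fo)
  qed (use assms in simp)
  then obtain c where c: "c \<epsilon> k" "a \<epsilon> c" "b \<epsilon> c" using e_w two_elements by force
  then have "sub (cart a b) (pow (pow c))"
    using k_trans2[OF c(1)] by (auto simp: sub_def mem_cart op_def)
  moreover have "small (pow (pow c))" using c by (intro small_pow small_k)
  ultimately show ?thesis by (rule small_sub)
qed

text \<open>Choice picks an index from \<open>k\<close> for each member of \<open>z\<close>,
  regularity bounds all of them by one \<open>c\<close> in \<open>k\<close>, and a product of two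
  elements of \<open>k\<close> is small.\<close>

lemma small_union_of:
  assumes "small z" "\<And>y. y \<epsilon> z \<Longrightarrow> small y" shows "small (union_of z)"
proof -
  obtain a where a: "a \<epsilon> k" "cov a z" using assms(1) by (auto simp: small_def)
  obtain f where f: "covby f a z" using a by (auto simp: cov_def)
  obtain ch where ch: "tm (\<lambda>v. ch (v 0))" "\<And>s t. sub s k \<Longrightarrow> t \<epsilon> s \<Longrightarrow> ch s \<epsilon> s"
    using choice_function by blast
  define B where "B y = sep k (\<lambda>b. cov b y)" for y
  have B: "b \<epsilon> B y \<longleftrightarrow> b \<epsilon> k \<and> cov b y" for b y unfolding B_def by (intro mem_sep fo)
  have tmch [fo]: "tm f \<Longrightarrow> tm (\<lambda>v. ch (f v))" for f
    by (rule tm_comp1[where F = ch, OF ch(1)])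
  have tmB [fo]: "tm f \<Longrightarrow> tm (\<lambda>v. B (f v))" for f
    by (rule tm_comp1[where F = B]) (unfold B_def, intro fo)
  have chB: "ch (B y) \<epsilon> k \<and> cov (ch (B y)) y" if "y \<epsilon> z" for y
  proof -
    obtain b where "b \<epsilon> B y" using assms(2)[OF \<open>y \<epsilon> z\<close>] by (auto simp: small_def B)
    then have "ch (B y) \<epsilon> B y" by (intro ch(2)) (auto simp: sub_def B)
    then show ?thesis by (simp add: B)
  qed
  \<comment> \<open>\<open>G t\<close> is the singleton of the index chosen for the member named by
    \<open>t\<close>, or empty. Its union is that index or the default \<open>e\<close>, so the map
    is total into \<open>k\<close>, as regularity demands.\<close>
  define G where "G t = sep k (\<lambda>b. \<exists>y. y \<epsilon> z \<and> op t y \<epsilon> f \<and> b = ch (B y))" for t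
  have G: "b \<epsilon> G t \<longleftrightarrow> b \<epsilon> k \<and> (\<exists>y. y \<epsilon> z \<and> op t y \<epsilon> f \<and> b = ch (B y))" for b t
    unfolding G_def by (intro mem_sep fo)
  have Gy: "union_of (G t) = ch (B y)" if "y \<epsilon> z" "op t y \<epsilon> f" for t y
  proof -
    have "b \<epsilon> G t \<longleftrightarrow> b = ch (B y)" for b
      using f that chB unfolding G covby_def functional_def by blast
    then show ?thesis by (intro ext) auto
  qed
  have "\<exists>c. c \<epsilon> k \<and> (\<forall>t. t \<epsilon> a \<longrightarrow> union_of (G t) \<epsilon> c)"
  proof (rule k_regular[OF a(1)])
    show "tm (\<lambda>v. union_of (G (v 0)))" unfolding G_def by (intro fo)
    fix t
    show "union_of (G t) \<epsilon> k"
    proof (cases "\<exists>y. y \<epsilon> z \<and> op t y \<epsilon> f")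
      case True then show ?thesis using Gy chB by auto
    next
      case False
      then have "union_of (G t) = e" by (intro ext) (auto simp: G e_empty)
      then show ?thesis using e_w w_k k_trans by (auto simp: sub_def)
    qed
  qed
  then obtain c where c: "c \<epsilon> k" "\<And>t. t \<epsilon> a \<Longrightarrow> union_of (G t) \<epsilon> c" by blast
  have "cov c y" if "y \<epsilon> z" for y
  proof -
    obtain t where "t \<epsilon> a" "op t y \<epsilon> f" using f \<open>y \<epsilon> z\<close> unfolding covby_def by blast
    then have "ch (B y) \<epsilon> c" using c(2) Gy that by force
    then show ?thesis using k_trans2[OF c(1)] chB[OF that] cov_sub[OF sub_refl] by blast
  qed
  then have "cov (cart a c) (union_of z)" by (intro cov_union_of a)
  then show ?thesis using small_cov small_cart a c by blast
qed

section \<open>The levels \<open>K\<close> and \<open>U\<close>\<close>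

definition K :: 'a where
  "K = (SOME l. level l \<and> \<not> small (levels_in l) \<and> (\<forall>x. sub x l \<longrightarrow> small x \<longrightarrow> x \<epsilon> l))"

text \<open>This is \<open>closed_level\<close> with \<open>sm\<close> taken to be
  \<open>small\<close>. Elements of \<open>k\<close> are subsets of \<open>k\<close>, so a level
  whose levels are not covered by \<open>k\<close> shows that the search succeeds.\<close>

lemma K: "level K" "\<not> small (levels_in K)" "sub x K \<Longrightarrow> small x \<Longrightarrow> x \<epsilon> K"
proof -
  have "\<exists>l. level l \<and> \<not> small (levels_in l) \<and> (\<forall>x. sub x l \<longrightarrow> small x \<longrightarrow> x \<epsilon> l)"
  proof (rule closed_level[of small small])
    show "fo (\<lambda>v. small (v 0))" by (intro fo)
    show "\<exists>l. level l \<and> \<not> small (levels_in l)"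
      using level_not_covered[of k] cov_sub[OF sub_refl k_trans] unfolding small_def by metis
    show "sub x y \<Longrightarrow> small y \<Longrightarrow> small x" for x y by (rule small_sub)
  qed (use small_upair small_img small_union_of in blast)+
  from someI_ex[OF this]
  show "level K" "\<not> small (levels_in K)" "sub x K \<Longrightarrow> small x \<Longrightarrow> x \<epsilon> K" unfolding K_def by blast+
qed

text \<open>Induction along membership: an element of \<open>k\<close> is small, and a subset of
  \<open>l\<close> once its elements are in \<open>l\<close>.\<close>

lemma closed_k_sub:
  assumes "\<And>x. sub x l \<Longrightarrow> small x \<Longrightarrow> x \<epsilon> l" shows "sub k l"
proof -
  have "a \<epsilon> l" if "a \<epsilon> k" for a
  proof (rule set_induct[where a = k and P = "\<lambda>a. a \<epsilon> l"])
    show "fo (\<lambda>v. v 0 \<epsilon> l)" by (intro fo)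
    fix x assume x: "x \<epsilon> k" "\<And>y. y \<epsilon> x \<Longrightarrow> y \<epsilon> k \<Longrightarrow> y \<epsilon> l"
    then have "sub x l" using k_trans by (auto simp: sub_def)
    then show "x \<epsilon> l" using assms small_k x by blast
  qed (rule that)
  then show ?thesis by (simp add: sub_def)
qed

lemma k_K: "sub k K" by (rule closed_k_sub) (rule K(3))

lemma small_cov_K: "small x \<Longrightarrow> cov K x"
  unfolding small_def using k_K k_trans cov_sub[OF sub_refl] sub_trans by blast

lemma op_K: "x \<epsilon> K \<Longrightarrow> y \<epsilon> K \<Longrightarrow> op x y \<epsilon> K"
  unfolding op_def using small_upair K(3) by (auto simp: sub_def)

text \<open>\<open>K\<close> contains \<open>k\<close> and is closed under pairs, so
  \<open>cart a K\<close> is a subset of \<open>K\<close>. This replaces cardinal arithmetic for the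
  size of \<open>K\<close>.\<close>

lemma cov_K_union_of: "small z \<Longrightarrow> (\<And>y. y \<epsilon> z \<Longrightarrow> cov K y) \<Longrightarrow> cov K (union_of z)"
proof -
  assume z: "small z" "\<And>y. y \<epsilon> z \<Longrightarrow> cov K y"
  then obtain a where a: "a \<epsilon> k" "cov a z" by (auto simp: small_def)
  have "sub (cart a K) K" using k_trans[OF a(1)] k_K by (auto simp: sub_def mem_cart intro: op_K)
  then show ?thesis using cov_union_of[OF a(2) z(2)] cov_sub[OF sub_refl] by blast
qed

definition U :: 'a where
  "U = (SOME l. level l \<and> \<not> cov K (levels_in l) \<and> (\<forall>x. sub x l \<longrightarrow> small x \<longrightarrow> x \<epsilon> l) \<and>
     (\<forall>y. y \<epsilon> l \<longrightarrow> (\<exists>r. r \<epsilon> levels_in l \<and> y \<epsilon> r)))"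

text \<open>This is \<open>closed_level\<close> with \<open>sm\<close> taken to be
  \<open>cov K\<close>: unions over small index sets preserve being covered by \<open>K\<close>, so
  \<open>U\<close> too is closed under small subsets.\<close>

lemma U: "level U" "\<not> cov K (levels_in U)" "sub x U \<Longrightarrow> small x \<Longrightarrow> x \<epsilon> U"
    "y \<epsilon> U \<Longrightarrow> \<exists>r. r \<epsilon> levels_in U \<and> y \<epsilon> r"
proof -
  have "\<exists>l. level l \<and> \<not> cov K (levels_in l) \<and> (\<forall>x. sub x l \<longrightarrow> small x \<longrightarrow> x \<epsilon> l) \<and>
     (\<forall>y. y \<epsilon> l \<longrightarrow> (\<exists>r. r \<epsilon> levels_in l \<and> y \<epsilon> r))"
  proof (rule closed_level[of "cov K" small])
    show "fo (\<lambda>v. cov K (v 0))" by (intro fo)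
    show "sub x y \<Longrightarrow> cov K y \<Longrightarrow> cov K x" for x y using cov_sub[OF _ sub_refl] by blast
    show "cov K (upair c c)" for c using small_upair small_cov_K by blast
    show "\<exists>l. level l \<and> \<not> cov K (levels_in l)" by (rule level_not_covered)
  qed (use small_upair small_img cov_K_union_of in blast)+
  from someI_ex[OF this]
  show "level U" "\<not> cov K (levels_in U)" "sub x U \<Longrightarrow> small x \<Longrightarrow> x \<epsilon> U"
    "y \<epsilon> U \<Longrightarrow> \<exists>r. r \<epsilon> levels_in U \<and> y \<epsilon> r" unfolding U_def by blast+
qed

lemma k_U: "sub k U" by (rule closed_k_sub) (rule U(3))

lemma U_trans: "x \<epsilon> U \<Longrightarrow> y \<epsilon> x \<Longrightarrow> y \<epsilon> U"
  using level_trans[OF U(1)] by (auto simp: sub_def)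

text \<open>Otherwise every level in \<open>U\<close> would be in \<open>K\<close>, and
  \<open>K\<close> would cover the levels of \<open>U\<close>.\<close>

lemma K_U: "K \<epsilon> U"
proof -
  have "\<not> sub (levels_in U) (levels_in K)"
    using U(2) cov_sub[of "levels_in U" K K K] cov_refl by (auto simp: sub_def)
  then obtain r where "r \<epsilon> levels_in U" "\<not> r \<epsilon> K" by (auto simp: sub_def)
  then show ?thesis using level_linear[of r K] K(1) U_trans by auto
qed

lemma K_not_small: "\<not> small K"
  using K(2) small_sub[of "levels_in K" K] by (auto simp: sub_def)

end

subsection \<open>Zermelo's well-ordering theorem\<close>

context zf_model
begin

text \<open>
  Zermelo's 1908 proof: the least family of subsets of \<open>A\<close> that contains \<open>A\<close> and is closed under
  intersections and under removing the chosen element is a chain, and \<open>x\<close> precedes \<open>y\<close> if \<open>y\<close> is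
  in the least member of the family containing \<open>x\<close>.
\<close>

lemma zermelo:
  obtains W where "sub W (cart A A)" "\<And>x. x \<epsilon> A \<Longrightarrow> op x x \<epsilon> W"
    "\<And>x y. op x y \<epsilon> W \<Longrightarrow> op y x \<epsilon> W \<Longrightarrow> x = y"
    "\<And>x y z. op x y \<epsilon> W \<Longrightarrow> op y z \<epsilon> W \<Longrightarrow> op x z \<epsilon> W"
    "\<And>x y. x \<epsilon> A \<Longrightarrow> y \<epsilon> A \<Longrightarrow> op x y \<epsilon> W \<or> op y x \<epsilon> W"
    "\<And>X x. sub X A \<Longrightarrow> x \<epsilon> X \<Longrightarrow> \<exists>m. m \<epsilon> X \<and> (\<forall>x. x \<epsilon> X \<longrightarrow> op m x \<epsilon> W)"
proof -
  obtain ch where ch: "tm (\<lambda>v. ch (v 0))" "\<And>s t. sub s A \<Longrightarrow> t \<epsilon> s \<Longrightarrow> ch s \<epsilon> s"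
    using choice_function by blast
  have tmch [fo]: "tm f \<Longrightarrow> tm (\<lambda>v. ch (f v))" for f
    by (rule tm_comp1[where F = ch, OF ch(1)])
  define nx where "nx B = sep B (\<lambda>x. x \<noteq> ch B)" for B
  have nx: "x \<epsilon> nx B \<longleftrightarrow> x \<epsilon> B \<and> x \<noteq> ch B" for x B unfolding nx_def by (intro mem_sep fo)
  have tmnx [fo]: "tm f \<Longrightarrow> tm (\<lambda>v. nx (f v))" for f
    by (rule tm_comp1[where F = nx]) (unfold nx_def, intro fo)
  define inter where "inter D = sep A (\<lambda>x. \<forall>B. B \<epsilon> D \<longrightarrow> x \<epsilon> B)" for D
  have inter: "x \<epsilon> inter D \<longleftrightarrow> x \<epsilon> A \<and> (\<forall>B. B \<epsilon> D \<longrightarrow> x \<epsilon> B)" for x D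
    unfolding inter_def by (intro mem_sep fo)
  have tminter [fo]: "tm f \<Longrightarrow> tm (\<lambda>v. inter (f v))" for f
    by (rule tm_comp1[where F = inter]) (unfold inter_def, intro fo)
  define chain where "chain C \<longleftrightarrow> A \<epsilon> C \<and> (\<forall>B. B \<epsilon> C \<longrightarrow> nx B \<epsilon> C) \<and>
     (\<forall>D. sub D C \<longrightarrow> (\<exists>B. B \<epsilon> D) \<longrightarrow> inter D \<epsilon> C)" for C
  define Th where "Th = sep (pow A) (\<lambda>B. \<forall>C. chain C \<longrightarrow> B \<epsilon> C)"
  have Th: "B \<epsilon> Th \<longleftrightarrow> sub B A \<and> (\<forall>C. chain C \<longrightarrow> B \<epsilon> C)" for B
  proof -
    have "B \<epsilon> Th \<longleftrightarrow> B \<epsilon> pow A \<and> (\<forall>C. chain C \<longrightarrow> B \<epsilon> C)"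
      unfolding Th_def chain_def by (intro mem_sep fo)
    then show ?thesis by simp
  qed
  have ThA: "A \<epsilon> Th" by (auto simp: Th chain_def)
  have Thnx: "nx B \<epsilon> Th" if "B \<epsilon> Th" for B
    using that by (auto simp: Th chain_def nx sub_def)
  have Thinter: "inter D \<epsilon> Th" if "sub D Th" "B \<epsilon> D" for D B
    unfolding Th
  proof (intro conjI HOL.allI HOL.impI)
    show "sub (inter D) A" by (simp add: sub_def inter)
    fix C assume C: "chain C"
    have "sub D C" using that(1) C by (auto simp: sub_def Th)
    then show "inter D \<epsilon> C" using C that(2) by (auto simp: chain_def)
  qed
  have Th_sub: "sub B A" if "B \<epsilon> Th" for B using that by (simp add: Th)
  have induct: "P B" if P: "fo (\<lambda>v. P (v 0))" "P A" "\<And>B. B \<epsilon> Th \<Longrightarrow> P B \<Longrightarrow> P (nx B)"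
    "\<And>D B. sub D Th \<Longrightarrow> B \<epsilon> D \<Longrightarrow> (\<And>B. B \<epsilon> D \<Longrightarrow> P B) \<Longrightarrow> P (inter D)"
    and B: "B \<epsilon> Th" for P B
  proof -
    have m: "B \<epsilon> sep Th P \<longleftrightarrow> B \<epsilon> Th \<and> P B" for B by (rule mem_sep[OF P(1)])
    have "chain (sep Th P)" unfolding chain_def m
    proof (intro conjI HOL.allI HOL.impI)
      fix D assume D: "sub D (sep Th P)" "\<exists>B. B \<epsilon> D"
      then have D': "sub D Th" "\<And>B. B \<epsilon> D \<Longrightarrow> P B" by (auto simp: sub_def m)
      obtain B where "B \<epsilon> D" using D by blast
      then show "inter D \<epsilon> Th" "P (inter D)" using D' Thinter P(4) by blast+
    qed (use ThA P Thnx in auto)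
    then have "B \<epsilon> sep Th P" using B by (simp add: Th)
    then show ?thesis by (simp add: m)
  qed
  \<comment> \<open>If \<open>A1\<close> is comparable with all members, nothing in the family lies
    strictly between \<open>nx A1\<close> and \<open>A1\<close>, because passing from
    \<open>B\<close> to \<open>nx B\<close> loses at most one element.\<close>
  have step: "sub A1 B \<or> sub B (nx A1)"
    if A1: "A1 \<epsilon> Th" "\<And>B. B \<epsilon> Th \<Longrightarrow> sub A1 B \<or> sub B A1" and B: "B \<epsilon> Th" for A1 B
  proof (rule induct[where P = "\<lambda>B. sub A1 B \<or> sub B (nx A1)", OF _ _ _ _ B])
    show "fo (\<lambda>v. sub A1 (v 0) \<or> sub (v 0) (nx A1))" by (intro fo)
    show "sub A1 A \<or> sub A (nx A1)" using Th_sub A1(1) by blast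
  next
    fix B assume B: "B \<epsilon> Th" "sub A1 B \<or> sub B (nx A1)"
    show "sub A1 (nx B) \<or> sub (nx B) (nx A1)"
    proof (cases "sub B (nx A1)")
      case True then show ?thesis by (auto simp: sub_def nx)
    next
      case False
      then have s: "sub A1 B" using B by blast
      consider "sub A1 (nx B)" | "sub (nx B) A1" using A1(2)[OF Thnx[OF B(1)]] by blast
      then show ?thesis
      proof cases
        case 2
        show ?thesis
        proof (cases "sub B A1")
          case True
          then have "B = A1" using s sub_antisym by blast
          then show ?thesis by simp
        next
          case False
          then obtain x where "x \<epsilon> B" "\<not> x \<epsilon> A1" by (auto simp: sub_def)
          then have "x = ch B" using 2 by (auto simp: sub_def nx)
          then have "sub A1 (nx B)" using s \<open>\<not> x \<epsilon> A1\<close> by (auto simp: sub_def nx)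
          then show ?thesis by blast
        qed
      qed blast
    qed
  next
    fix D B assume D: "sub D Th" "B \<epsilon> D" "\<And>B. B \<epsilon> D \<Longrightarrow> sub A1 B \<or> sub B (nx A1)"
    show "sub A1 (inter D) \<or> sub (inter D) (nx A1)"
    proof (cases "\<forall>B. B \<epsilon> D \<longrightarrow> sub A1 B")
      case True
      then have "sub A1 (inter D)" using Th_sub[OF A1(1)] by (auto simp: sub_def inter)
      then show ?thesis by blast
    next
      case False
      then obtain B where "B \<epsilon> D" "sub B (nx A1)" using D(3) by blast
      then have "sub (inter D) (nx A1)" unfolding sub_def inter by blast
      then show ?thesis by blast
    qed
  qed
  have comp: "\<forall>B. B \<epsilon> Th \<longrightarrow> sub A1 B \<or> sub B A1" if A1: "A1 \<epsilon> Th" for A1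
  proof (rule induct[where P = "\<lambda>A1. \<forall>B. B \<epsilon> Th \<longrightarrow> sub A1 B \<or> sub B A1", OF _ _ _ _ A1])
    show "fo (\<lambda>v. \<forall>B. B \<epsilon> Th \<longrightarrow> sub (v 0) B \<or> sub B (v 0))" by (intro fo)
    show "\<forall>B. B \<epsilon> Th \<longrightarrow> sub A B \<or> sub B A" using Th_sub by blast
  next
    fix A1 assume A1: "A1 \<epsilon> Th" "\<forall>B. B \<epsilon> Th \<longrightarrow> sub A1 B \<or> sub B A1"
    have "sub (nx A1) A1" by (simp add: sub_def nx)
    then show "\<forall>B. B \<epsilon> Th \<longrightarrow> sub (nx A1) B \<or> sub B (nx A1)"
      using step[OF A1(1)] A1(2) sub_trans by blast
  next
    fix D B assume D: "sub D Th" "B \<epsilon> D" "\<And>B. B \<epsilon> D \<Longrightarrow> \<forall>B'. B' \<epsilon> Th \<longrightarrow> sub B B' \<or> sub B' B"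
    show "\<forall>B. B \<epsilon> Th \<longrightarrow> sub (inter D) B \<or> sub B (inter D)"
    proof (intro HOL.allI HOL.impI)
      fix B assume B: "B \<epsilon> Th"
      show "sub (inter D) B \<or> sub B (inter D)"
      proof (cases "\<exists>A1. A1 \<epsilon> D \<and> sub A1 B")
        case True
        then show ?thesis unfolding sub_def inter by blast
      next
        case False
        then have *: "\<And>A1. A1 \<epsilon> D \<Longrightarrow> sub B A1" using D(3) B by blast
        have "sub B (inter D)" unfolding sub_def inter
          using subD[OF *] subD[OF Th_sub[OF B]] by blast
        then show ?thesis by blast
      qed
    qed
  qed
  have lin: "sub B B' \<or> sub B' (nx B)" if "B \<epsilon> Th" "B' \<epsilon> Th" for B B'
    using step comp that by blast
  define least where "least S = inter (sep Th (\<lambda>B. sub S B))" for S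
  have tml [fo]: "tm f \<Longrightarrow> tm (\<lambda>v. least (f v))" for f
    by (rule tm_comp1[where F = least]) (unfold least_def, intro fo)
  have m: "B \<epsilon> sep Th (\<lambda>B. sub S B) \<longleftrightarrow> B \<epsilon> Th \<and> sub S B" for B S by (intro mem_sep fo)
  have ml: "x \<epsilon> least S \<longleftrightarrow> x \<epsilon> A \<and> (\<forall>B. B \<epsilon> Th \<and> sub S B \<longrightarrow> x \<epsilon> B)" for x S
    unfolding least_def inter m ..
  have least: "least S \<epsilon> Th" "sub S (least S)" "B \<epsilon> Th \<Longrightarrow> sub S B \<Longrightarrow> sub (least S) B"
    if "sub S A" for S B
  proof -
    have "sub (sep Th (\<lambda>B. sub S B)) Th" by (subst sub_def) (simp only: m, simp)
    moreover have "A \<epsilon> sep Th (\<lambda>B. sub S B)" unfolding m using ThA that by blast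
    ultimately show "least S \<epsilon> Th" unfolding least_def by (rule Thinter)
    show "sub S (least S)" unfolding sub_def[of S "least S"] ml using that subD by blast
    show "sub (least S) B" if "B \<epsilon> Th" "sub S B"
      unfolding sub_def[of "least S" B] ml using that by blast
  qed
  \<comment> \<open>If the chosen element of \<open>least S\<close> missed \<open>S\<close>,
    removing it would leave a smaller member of the family that still includes
    \<open>S\<close>.\<close>
  have ch_least: "ch (least S) \<epsilon> S" if S: "sub S A" "x \<epsilon> S" for S x
  proof (rule ccontr)
    assume n: "\<not> ?thesis"
    have "sub S (nx (least S))" using least(2)[OF S(1)] n by (auto simp: sub_def nx)
    then have "sub (least S) (nx (least S))" using least(1,3)[OF S(1)] Thnx by blast
    moreover have "ch (least S) \<epsilon> least S"
      using least(1,2)[OF S(1)] S(2) Th_sub ch(2) subD by blast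
    ultimately show False by (auto simp: sub_def nx)
  qed
  define R where "R x = least (upair x x)" for x
  have up: "sub (upair x x) B \<longleftrightarrow> x \<epsilon> B" for x B by (auto simp: sub_def)
  have R: "R x \<epsilon> Th" "x \<epsilon> R x" "B \<epsilon> Th \<Longrightarrow> x \<epsilon> B \<Longrightarrow> sub (R x) B" "ch (R x) = x"
    if "x \<epsilon> A" for x B
    using least(1,2)[of "upair x x"] least(3)[of "upair x x" B] ch_least[of "upair x x" x] that by (auto simp: up R_def)
  define W where "W = rel A A (\<lambda>x y. y \<epsilon> R x)"
  have W0: "p \<epsilon> W \<longleftrightarrow> (\<exists>x y. p = op x y \<and> x \<epsilon> A \<and> y \<epsilon> A \<and> y \<epsilon> R x)" for p
    unfolding W_def R_def by (intro mem_rel fo)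
  then have W: "op x y \<epsilon> W \<longleftrightarrow> x \<epsilon> A \<and> y \<epsilon> A \<and> y \<epsilon> R x" for x y by simp
  show ?thesis
  proof
    show "sub W (cart A A)" by (auto simp: sub_def W0 mem_cart)
    show "op x x \<epsilon> W" if "x \<epsilon> A" for x using that R by (simp add: W)
    show "x = y" if "op x y \<epsilon> W" "op y x \<epsilon> W" for x y
    proof -
      have "x \<epsilon> A" "y \<epsilon> A" "sub (R x) (R y)" "sub (R y) (R x)" using that R W by auto
      then have "R x = R y" using sub_antisym by blast
      then show ?thesis using R(4) \<open>x \<epsilon> A\<close> \<open>y \<epsilon> A\<close> by metis
    qed
    show "op x z \<epsilon> W" if "op x y \<epsilon> W" "op y z \<epsilon> W" for x y z
      using that R(1,3) unfolding W by (meson subD)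
    show "op x y \<epsilon> W \<or> op y x \<epsilon> W" if xy: "x \<epsilon> A" "y \<epsilon> A" for x y
      using comp[OF R(1)[OF xy(1)]] R(1,2) xy unfolding W by (meson subD)
    show "\<exists>m. m \<epsilon> X \<and> (\<forall>x. x \<epsilon> X \<longrightarrow> op m x \<epsilon> W)" if X: "sub X A" "x \<epsilon> X" for X x
    proof (intro exI conjI HOL.allI HOL.impI)
      let ?m = "ch (least X)"
      show mX: "?m \<epsilon> X" by (rule ch_least[OF X])
      then have mA: "?m \<epsilon> A" using X subD by blast
      fix y assume y: "y \<epsilon> X"
      \<comment> \<open>\<open>R ?m\<close> contains \<open>?m\<close>, which \<open>nx\<close>
        removes. By \<open>lin\<close>, \<open>R ?m\<close> then includes \<open>least X\<close> and
        with it \<open>X\<close>, so \<open>?m\<close> precedes all of \<open>X\<close>.\<close>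
      have "\<not> sub (R ?m) (nx (least X))" using R(2)[OF mA] by (auto simp: sub_def nx)
      then have "sub (least X) (R ?m)" using lin[OF least(1)[OF X(1)] R(1)[OF mA]] by blast
      then have "y \<epsilon> R ?m" using least(2)[OF X(1)] y subD by blast
      then show "op ?m y \<epsilon> W" using mA y X subD by (simp add: W)
    qed
  qed
qed

end

subsection \<open>A model of KMCU\<close>

context zf_inacc
begin

text \<open>
  The objects are the elements of the level \<open>U\<close>. Those of size less than \<open>k\<close> are the sets; all
  others are declared urelements, their elements being ignored.
\<close>

definition M :: "('a, 'a) class_structure" where
  "M = \<lparr>Obj = {x. x \<epsilon> U}, Cls = {X. sub X U}, Ur = (\<lambda>x. \<not> small x),
    mem = (\<lambda>z x. z \<epsilon> x \<and> small x), cmem = E\<rparr>"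

lemma M_simps [simp]:
  "x \<in> Obj M \<longleftrightarrow> x \<epsilon> U" "X \<in> Cls M \<longleftrightarrow> sub X U" "Ur M x \<longleftrightarrow> \<not> small x"
  "mem M z x \<longleftrightarrow> z \<epsilon> x \<and> small x" "cmem M x X \<longleftrightarrow> x \<epsilon> X"
  by (simp_all add: M_def)

lemma is_set_M [simp]: "is_set M x \<longleftrightarrow> x \<epsilon> U \<and> small x"
  by (simp add: is_set_def)

lemma upair_U: "x \<epsilon> U \<Longrightarrow> y \<epsilon> U \<Longrightarrow> upair x y \<epsilon> U"
  using U(3) small_upair by (auto simp: sub_def)

lemma op_U [simp]: "op x y \<epsilon> U \<longleftrightarrow> x \<epsilon> U \<and> y \<epsilon> U"
proof
  assume a: "op x y \<epsilon> U"
  have "upair x y \<epsilon> op x y" by (simp add: op_def)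
  with a have "upair x y \<epsilon> U" by (rule U_trans)
  then show "x \<epsilon> U \<and> y \<epsilon> U" using U_trans by auto
qed (auto simp: op_def intro: upair_U)

lemma is_upair_M: "x \<epsilon> U \<Longrightarrow> y \<epsilon> U \<Longrightarrow> is_upair M p x y \<longleftrightarrow> p = upair x y"
proof
  assume a: "x \<epsilon> U" "y \<epsilon> U" "is_upair M p x y"
  then have p: "p \<epsilon> U" "small p" "\<And>z. z \<epsilon> U \<Longrightarrow> z \<epsilon> p \<longleftrightarrow> z = x \<or> z = y"
    by (auto simp: is_upair_def)
  show "p = upair x y"
    by (rule ext) (use p(3) a U_trans[OF p(1)] in auto)
qed (auto simp: is_upair_def small_upair intro: upair_U)

lemma is_opair_M: "x \<epsilon> U \<Longrightarrow> y \<epsilon> U \<Longrightarrow> is_opair M p x y \<longleftrightarrow> p = op x y"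
  by (auto simp: is_opair_def is_upair_M upair_U op_def)

lemma related_M: "x \<epsilon> U \<Longrightarrow> y \<epsilon> U \<Longrightarrow> related M R x y \<longleftrightarrow> op x y \<epsilon> R"
  by (auto simp: related_def is_opair_M)

text \<open>Class quantifiers of \<open>M\<close> range over subsets of \<open>U\<close>, which are
  elements of \<open>E\<close>. Every second-order formula thus translates to a first-order one, and
  impredicative comprehension becomes an instance of Separation.\<close>

lemma fo_csat:
  assumes "\<And>i. tm (s i)" "\<And>i. tm (S i)"
  shows "fo (\<lambda>v. csat M (\<lambda>i. s i v) (\<lambda>i. S i v) p)"
  using assms
proof (induction p arbitrary: s S)
  case CFls show ?case unfolding csat.simps by (intro fo)
next
  case (CUr i) then show ?case unfolding csat.simps M_simps by (intro fo)
next
  case (COMem i j) then show ?case unfolding csat.simps M_simps by (intro fo)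
next
  case (COEq i j) then show ?case unfolding csat.simps M_simps by (intro fo)
next
  case (CMem i j) then show ?case unfolding csat.simps M_simps by (intro fo)
next
  case (CEq i j) then show ?case unfolding csat.simps M_simps by (intro fo)
next
  case (CImp p q)
  show ?case unfolding csat.simps
    by (rule fo_imp[OF CImp.IH(1)[OF CImp.prems] CImp.IH(2)[OF CImp.prems]])
next
  case (COAll p)
  define s' where "s' i v = (case i of 0 \<Rightarrow> v 0 | Suc j \<Rightarrow> s j (\<lambda>i. v (Suc i)))"
    for i and v :: "nat \<Rightarrow> 'a"
  have s': "case_nat (v 0) (\<lambda>i. s i (\<lambda>i. v (Suc i))) = (\<lambda>i. s' i v)" for v
    by (auto simp: s'_def split: nat.split)
  have "tm (s' i)" for i
    unfolding s'_def using tm_var[of 0] tm_ren[OF COAll.prems(1), of _ Suc] by (cases i) simp_all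
  then have "fo (\<lambda>v. csat M (\<lambda>i. s' i v) (\<lambda>i. S i (\<lambda>i. v (Suc i))) p)"
    by (intro COAll.IH tm_ren[OF COAll.prems(2)])
  then have "fo (\<lambda>v. \<forall>x. x \<epsilon> U \<longrightarrow> csat M (case_nat x (\<lambda>i. s i v)) (\<lambda>i. S i v) p)"
    by (intro fo_all fo_imp fo_mem tm_var tm_const) (simp only: s')
  then show ?case by (simp add: Ball_def)
next
  case (CCAll p)
  define S' where "S' i v = (case i of 0 \<Rightarrow> v 0 | Suc j \<Rightarrow> S j (\<lambda>i. v (Suc i)))"
    for i and v :: "nat \<Rightarrow> 'a"
  have S': "case_nat (v 0) (\<lambda>i. S i (\<lambda>i. v (Suc i))) = (\<lambda>i. S' i v)" for v
    by (auto simp: S'_def split: nat.split)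
  have "tm (S' i)" for i
    unfolding S'_def using tm_var[of 0] tm_ren[OF CCAll.prems(2), of _ Suc] by (cases i) simp_all
  then have "fo (\<lambda>v. csat M (\<lambda>i. s i (\<lambda>i. v (Suc i))) (\<lambda>i. S' i v) p)"
    by (intro CCAll.IH tm_ren[OF CCAll.prems(1)])
  then have "fo (\<lambda>v. \<forall>x. sub x U \<longrightarrow> csat M (\<lambda>i. s i v) (case_nat x (\<lambda>i. S i v)) p)"
    by (intro fo_all fo_imp fo_sub tm_var tm_const) (simp only: S')
  then show ?case by (simp add: Ball_def)
qed

section \<open>The axioms of KMU in \<open>M\<close>\<close>

lemma comprehension_M: "ax_comprehension M"
  unfolding ax_comprehension_def
proof (intro HOL.allI HOL.impI)
  fix p and v V :: "nat \<Rightarrow> 'a"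
  have "fo (\<lambda>u. csat M (\<lambda>i. (case i of 0 \<Rightarrow> u 0 | Suc j \<Rightarrow> v j)) (\<lambda>i. V i) p)"
  proof (rule fo_csat)
    show "tm (\<lambda>u. case i of 0 \<Rightarrow> u 0 | Suc j \<Rightarrow> v j)" for i
      by (cases i) (simp_all add: tm_var tm_const)
  qed (rule tm_const)
  then have "x \<epsilon> sep U (\<lambda>x. csat M (case_nat x v) V p) \<longleftrightarrow> x \<epsilon> U \<and> csat M (case_nat x v) V p" for x
    by (intro mem_sep) (simp add: nat.case_distrib)
  then show "\<exists>X\<in>Cls M. \<forall>x\<in>Obj M. cmem M x X \<longleftrightarrow> csat M (case_nat x v) V p"
    by (intro bexI[of _ "sep U (\<lambda>x. csat M (case_nat x v) V p)"]) (auto simp: sub_def)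
qed

lemma e_k: "e \<epsilon> k" using k_trans[OF w_k] e_w by (simp add: sub_def)

text \<open>The image of a small set is covered by it, hence small, and small subsets of
  \<open>U\<close> are elements of \<open>U\<close>.\<close>

lemma replacement_M: "ax_replacement M"
  unfolding ax_replacement_def
proof (intro ballI HOL.allI HOL.impI)
  fix F x assume F: "F \<in> Cls M" "is_function M F" and x: "is_set M x"
  define r where "r = sep U (\<lambda>z. \<exists>y. y \<epsilon> x \<and> op y z \<epsilon> F)"
  have r: "z \<epsilon> r \<longleftrightarrow> z \<epsilon> U \<and> (\<exists>y. y \<epsilon> x \<and> op y z \<epsilon> F)" for z
    unfolding r_def by (intro mem_sep fo)
  have xU: "y \<epsilon> U" if "y \<epsilon> x" for y using x U_trans that by simp blast
  have "cov x r"
  proof (rule covI[where R = "\<lambda>y z. y \<epsilon> U \<and> z \<epsilon> U \<and> op y z \<epsilon> F"])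
    show "fo (\<lambda>v. v 0 \<epsilon> U \<and> v 1 \<epsilon> U \<and> op (v 0) (v 1) \<epsilon> F)" by (intro fo)
    show "y = z" if "t \<epsilon> U \<and> y \<epsilon> U \<and> op t y \<epsilon> F" "t \<epsilon> U \<and> z \<epsilon> U \<and> op t z \<epsilon> F" for t y z
      using F(2) that by (auto simp: is_function_def related_M)
    show "\<exists>t. t \<epsilon> x \<and> t \<epsilon> U \<and> y \<epsilon> U \<and> op t y \<epsilon> F" if "y \<epsilon> r" for y
      using that xU unfolding r by blast
  qed
  moreover have "small x" using x by simp
  ultimately have sr: "small r" by (rule small_cov[rotated])
  then have "r \<epsilon> U" by (intro U(3)[OF _ sr]) (simp add: sub_def r)
  then show "\<exists>r. is_set M r \<and> (\<forall>z\<in>Obj M. mem M z r \<longleftrightarrow>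
        (\<exists>y\<in>Obj M. mem M y x \<and> related M F y z))"
    using x xU sr by (intro exI[of _ r]) (auto simp: related_M r)
qed

lemma union_M: "ax_union M"
  unfolding ax_union_def
proof (intro HOL.allI HOL.impI)
  fix x assume x: "is_set M x"
  \<comment> \<open>Large members of \<open>x\<close> are urelements whose elements in
    \<open>E\<close> must not enter the union.\<close>
  define x' where "x' = sep x small"
  have x': "y \<epsilon> x' \<longleftrightarrow> y \<epsilon> x \<and> small y" for y unfolding x'_def by (intro mem_sep fo)
  have "small x'" using x small_sub[of x' x] by (simp add: sub_def x')
  then have s: "small (union_of x')" by (rule small_union_of) (simp add: x')
  moreover have xU: "y \<epsilon> U" if "y \<epsilon> x" for y using x U_trans that by simp blast
  moreover have "union_of x' \<epsilon> U" by (rule U(3)[OF _ s]) (auto simp: sub_def x' intro: U_trans xU)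
  ultimately show "\<exists>u. is_set M u \<and> (\<forall>z\<in>Obj M. mem M z u \<longleftrightarrow> (\<exists>y\<in>Obj M. mem M y x \<and> mem M z y))"
    using x by (intro exI[of _ "union_of x'"]) (auto simp: x')
qed

lemma powerset_M: "ax_powerset M"
  unfolding ax_powerset_def
proof (intro HOL.allI HOL.impI)
  fix x assume x: "is_set M x"
  have xU: "y \<epsilon> U" if "y \<epsilon> x" for y using x U_trans that by simp blast
  have y: "y \<epsilon> U \<and> small y" if "sub y x" for y
    using that x small_sub U(3)[of y] xU by (auto simp: sub_def)
  have s: "small (pow x)" using x small_pow by simp
  have "pow x \<epsilon> U" by (rule U(3)[OF _ s]) (use y in \<open>simp add: sub_def\<close>)
  moreover have "y \<epsilon> pow x \<longleftrightarrow> y \<epsilon> U \<and> small y \<and> (\<forall>z. z \<epsilon> U \<longrightarrow> z \<epsilon> y \<longrightarrow> z \<epsilon> x)" if "y \<epsilon> U" for y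
  proof -
    have "z \<epsilon> U" if "z \<epsilon> y" for z using that U_trans[OF \<open>y \<epsilon> U\<close>] by blast
    then show ?thesis using y[of y] by (auto simp: sub_def)
  qed
  ultimately show "\<exists>p. is_set M p \<and> (\<forall>y\<in>Obj M. mem M y p \<longleftrightarrow>
        is_set M y \<and> (\<forall>z\<in>Obj M. mem M z y \<longrightarrow> mem M z x))"
    using x s by (intro exI[of _ "pow x"]) auto
qed

lemma infinity_M: "ax_infinity M"
proof -
  have wk: "y \<epsilon> k" if "y \<epsilon> w" for y using k_trans[OF w_k] that by (simp add: sub_def)
  have kU: "y \<epsilon> U" "small y" if "y \<epsilon> k" for y
    using k_U small_k that by (auto simp: sub_def)
  show ?thesis unfolding ax_infinity_def
  proof (intro exI conjI ballI HOL.impI)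
    show "is_set M w" using w_k kU by simp
    show "is_set M e" using e_k kU by simp
    show "mem M e w" using w_k kU e_w by simp
    show "\<not> (\<exists>z\<in>Obj M. mem M z e)" by (simp add: e_empty)
    fix y assume "y \<in> Obj M" "mem M y w"
    then have y: "y \<epsilon> w" by simp
    have s: "un2 y (upair y y) \<epsilon> k" using w_succ[OF y] wk by blast
    show "is_set M (un2 y (upair y y))" using s kU by simp
    show "mem M (un2 y (upair y y)) w" using w_succ[OF y] w_k kU by simp
    fix z show "mem M z (un2 y (upair y y)) \<longleftrightarrow> mem M z y \<or> z = y"
      using kU(2)[OF s] kU(2)[OF wk[OF y]] by simp
  qed
qed

lemma separation_M: "ax_separation M"
  unfolding ax_separation_def
proof (intro HOL.allI ballI HOL.impI)
  fix x X assume x: "is_set M x"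
  have s: "small (inter2 x X)" using x small_sub[of "inter2 x X" x] by (simp add: sub_def)
  have "inter2 x X \<epsilon> U" by (rule U(3)[OF _ s]) (use x U_trans in \<open>auto simp: sub_def\<close>)
  then show "\<exists>s. is_set M s \<and> (\<forall>z\<in>Obj M. mem M z s \<longleftrightarrow> mem M z x \<and> cmem M z X)"
    using s x by (intro exI[of _ "inter2 x X"]) auto
qed

lemma set_ext_M: "ax_set_ext M"
  unfolding ax_set_ext_def
proof (intro HOL.allI HOL.impI)
  fix x y assume a: "is_set M x" "is_set M y" "\<forall>z\<in>Obj M. mem M z x \<longleftrightarrow> mem M z y"
  show "x = y"
  proof (rule ext)
    fix z show "z \<epsilon> x \<longleftrightarrow> z \<epsilon> y" using a U_trans[of x z] U_trans[of y z] by auto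
  qed
qed

lemma class_ext_M: "ax_class_ext M"
  unfolding ax_class_ext_def
proof (intro ballI HOL.impI)
  fix x y assume a: "x \<in> Cls M" "y \<in> Cls M" "\<forall>z\<in>Obj M. cmem M z x \<longleftrightarrow> cmem M z y"
  show "x = y"
  proof (rule ext)
    fix z show "z \<epsilon> x \<longleftrightarrow> z \<epsilon> y" using a by (auto simp: sub_def)
  qed
qed

lemma foundation_M: "ax_foundation M"
  unfolding ax_foundation_def
proof (intro HOL.allI HOL.impI)
  fix x assume x: "is_set M x" "\<exists>y\<in>Obj M. mem M y x"
  then obtain y where "y \<epsilon> x" by auto
  from found[OF this] obtain y where y: "y \<epsilon> x" "\<And>z. z \<epsilon> x \<Longrightarrow> \<not> z \<epsilon> y" by blast
  then have "y \<epsilon> U" using x U_trans by auto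
  then show "\<exists>y\<in>Obj M. mem M y x \<and> \<not> (\<exists>z\<in>Obj M. mem M z x \<and> mem M z y)"
    using x y by (intro bexI[of _ y]) auto
qed

lemma KMU_M: "KMU_model M"
  unfolding KMU_model_def
proof (intro conjI)
  show "Obj M \<noteq> {}" using K_U M_simps(1) by blast
  show "Cls M \<noteq> {}" using M_simps(2) sub_refl by blast
  show "ax_urelements M" by (simp add: ax_urelements_def)
  show "ax_pairing M" unfolding ax_pairing_def using is_upair_M by auto
qed (fact set_ext_M class_ext_M foundation_M union_M powerset_M infinity_M replacement_M
    separation_M comprehension_M)+

lemma KMCU_M: "KMCU_model M"
proof -
  obtain W where W: "sub W (cart U U)" "\<And>x. x \<epsilon> U \<Longrightarrow> op x x \<epsilon> W"
    "\<And>x y. op x y \<epsilon> W \<Longrightarrow> op y x \<epsilon> W \<Longrightarrow> x = y"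
    "\<And>x y z. op x y \<epsilon> W \<Longrightarrow> op y z \<epsilon> W \<Longrightarrow> op x z \<epsilon> W"
    "\<And>x y. x \<epsilon> U \<Longrightarrow> y \<epsilon> U \<Longrightarrow> op x y \<epsilon> W \<or> op y x \<epsilon> W"
    "\<And>X x. sub X U \<Longrightarrow> x \<epsilon> X \<Longrightarrow> \<exists>m. m \<epsilon> X \<and> (\<forall>x. x \<epsilon> X \<longrightarrow> op m x \<epsilon> W)"
    using zermelo by blast
  have pW: "\<exists>x y. p = op x y \<and> x \<epsilon> U \<and> y \<epsilon> U" if "p \<epsilon> W" for p
    using subD[OF W(1) that] by (auto simp: mem_cart)
  have "is_wellorder_of_universe M W" unfolding is_wellorder_of_universe_def
  proof (intro conjI ballI HOL.impI)
    show "is_relation M W" unfolding is_relation_def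
      using pW is_opair_M by fastforce
    show "related M W x y \<or> related M W y x" if "x \<in> Obj M" "y \<in> Obj M" for x y
      using that W(5) by (simp add: related_M)
    show "related M W x z" if "x \<in> Obj M" "y \<in> Obj M" "z \<in> Obj M" "related M W x y" "related M W y z"
      for x y z using that W(4)[of x y z] by (simp add: related_M)
    fix X assume X: "X \<in> Cls M" "\<exists>x\<in>Obj M. cmem M x X"
    then obtain x where "x \<epsilon> X" by auto
    then obtain m where m: "m \<epsilon> X" "\<And>x. x \<epsilon> X \<Longrightarrow> op m x \<epsilon> W" using W(6)[of X x] X(1) by auto
    have "m \<epsilon> U" using m(1) X by (auto simp: sub_def)
    then show "\<exists>m\<in>Obj M. cmem M m X \<and> (\<forall>x\<in>Obj M. cmem M x X \<longrightarrow> related M W m x)"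
      using m by (intro bexI[of _ m]) (auto simp: related_M)
  qed (use W(2,3) in \<open>auto simp: related_M\<close>)
  \<comment> \<open>\<open>U\<close> is closed under pairs, so an internal relation on
    \<open>U\<close> is a subset of \<open>U\<close> and thereby a class.\<close>
  moreover have "W \<in> Cls M" unfolding M_simps sub_def using pW op_U by metis
  ultimately show ?thesis unfolding KMCU_model_def using KMU_M by blast
qed

end

subsection \<open>Automorphisms from involutions of the urelements\<close>

text \<open>Definability of \<open>s\<close> will make the induced automorphism a class of
  \<open>M\<close>; an involution makes it its own inverse.\<close>

locale urelement_involution = zf_inacc +
  fixes s :: "'a \<Rightarrow> 'a"
  assumes tm_s: "tm (\<lambda>v. s (v 0))"
    and s_U: "x \<epsilon> U \<Longrightarrow> \<not> small x \<Longrightarrow> s x \<epsilon> U"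
    and s_ur: "x \<epsilon> U \<Longrightarrow> \<not> small x \<Longrightarrow> \<not> small (s x)"
    and s_inv: "x \<epsilon> U \<Longrightarrow> \<not> small x \<Longrightarrow> s (s x) = x"
begin

definition bisim_step :: "('a \<Rightarrow> 'a \<Rightarrow> bool) \<Rightarrow> 'a \<Rightarrow> 'a \<Rightarrow> bool" where
  "bisim_step R x y \<longleftrightarrow> (\<not> small x \<and> \<not> small y \<and> y = s x) \<or>
     (small x \<and> small y \<and> (\<forall>x'. x' \<epsilon> x \<longrightarrow> (\<exists>y'. y' \<epsilon> y \<and> R x' y')) \<and>
       (\<forall>y'. y' \<epsilon> y \<longrightarrow> (\<exists>x'. x' \<epsilon> x \<and> R x' y')))"

definition bisim :: "'a \<Rightarrow> bool" where
  "bisim B \<longleftrightarrow> sub B (cart U U) \<and>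
     (\<forall>x y. op x y \<epsilon> B \<longrightarrow> bisim_step (\<lambda>x y. op x y \<epsilon> B) x y)"

text \<open>
  The automorphism induced by \<open>s\<close> is defined as the greatest bisimulation, which avoids a recursion
  theorem.
\<close>

definition aut :: "'a \<Rightarrow> 'a \<Rightarrow> bool" where
  "aut x y \<longleftrightarrow> (\<exists>B. bisim B \<and> op x y \<epsilon> B)"

text \<open>A bisimulation is a set of pairs, so one existential quantifier over sets defines the
  greatest one.\<close>

lemma fo_aut [fo]: "tm f \<Longrightarrow> tm g \<Longrightarrow> fo (\<lambda>v. aut (f v) (g v))"
  by (rule fo_comp2[where P = aut])
    (unfold aut_def bisim_def bisim_step_def, intro fo tm_comp1[where F = s, OF tm_s])

lemma bisim_step_mono: "bisim_step R x y \<Longrightarrow> (\<And>x y. R x y \<Longrightarrow> R' x y) \<Longrightarrow> bisim_step R' x y"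
  unfolding bisim_step_def by blast

lemma aut_U: "aut x y \<Longrightarrow> x \<epsilon> U \<and> y \<epsilon> U"
  unfolding aut_def bisim_def using subD[of _ "cart U U" "op x y"] by (auto simp: mem_cart)

lemma aut_step: assumes "aut x y" shows "bisim_step aut x y"
proof -
  obtain B where B: "bisim B" "op x y \<epsilon> B" using assms by (auto simp: aut_def)
  then have "bisim_step (\<lambda>x y. op x y \<epsilon> B) x y" by (simp add: bisim_def)
  then show ?thesis by (rule bisim_step_mono) (use B(1) in \<open>auto simp: aut_def\<close>)
qed

lemma bisim_aut: "bisim (rel U U aut)"
proof -
  have m: "op x y \<epsilon> rel U U aut \<longleftrightarrow> aut x y" for x y
    using op_mem_rel[of aut x y U U, OF fo_aut[OF tm_var tm_var]] aut_U by blast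
  have "sub (rel U U aut) (cart U U)"
    using mem_rel[of aut _ U U, OF fo_aut[OF tm_var tm_var]] by (auto simp: sub_def mem_cart)
  then show ?thesis unfolding bisim_def m using aut_step by blast
qed

text \<open>Coinduction: adding one locally justified pair to the greatest bisimulation gives a
  bisimulation again.\<close>

lemma autI: assumes "x \<epsilon> U" "y \<epsilon> U" "bisim_step aut x y" shows "aut x y"
proof -
  have m: "op x y \<epsilon> rel U U aut \<longleftrightarrow> aut x y" for x y
    using op_mem_rel[of aut x y U U, OF fo_aut[OF tm_var tm_var]] aut_U by blast
  define B where "B = un2 (rel U U aut) (upair (op x y) (op x y))"
  have B: "op x' y' \<epsilon> B \<longleftrightarrow> aut x' y' \<or> x' = x \<and> y' = y" for x' y' by (auto simp: B_def m)
  have "bisim B" unfolding bisim_def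
  proof (intro conjI HOL.allI HOL.impI)
    show "sub B (cart U U)" using bisim_aut assms(1,2) unfolding B_def bisim_def
      by (auto simp: sub_def mem_cart)
    fix x' y' assume "op x' y' \<epsilon> B"
    then have "bisim_step aut x' y'" using aut_step assms(3) by (auto simp: B)
    then show "bisim_step (\<lambda>x y. op x y \<epsilon> B) x' y'" by (rule bisim_step_mono) (simp add: B)
  qed
  then show ?thesis unfolding aut_def using B by blast
qed

lemma aut_unique: assumes "aut x y" "aut x z" shows "y = z"
proof -
  have "\<forall>y z. aut x y \<longrightarrow> aut x z \<longrightarrow> y = z"
  proof (rule set_induct[where a = U and P = "\<lambda>x. \<forall>y z. aut x y \<longrightarrow> aut x z \<longrightarrow> y = z"])
    show "fo (\<lambda>v. \<forall>y z. aut (v 0) y \<longrightarrow> aut (v 0) z \<longrightarrow> y = z)" by (intro fo)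
    show "x \<epsilon> U" using aut_U assms by blast
  next
    fix x assume x: "x \<epsilon> U" and
      IH: "\<And>x'. x' \<epsilon> x \<Longrightarrow> x' \<epsilon> U \<Longrightarrow> \<forall>y z. aut x' y \<longrightarrow> aut x' z \<longrightarrow> y = z"
    have IH': "y = z" if "x' \<epsilon> x" "aut x' y" "aut x' z" for x' y z
      using IH[OF that(1) U_trans[OF x that(1)]] that by blast
    have half: "u \<epsilon> z" if a: "aut x y" "aut x z" and u: "u \<epsilon> y" and sm: "small x" for y z u
    proof -
      obtain x' where x': "x' \<epsilon> x" "aut x' u"
        using aut_step[OF a(1)] u sm unfolding bisim_step_def by blast
      then obtain u' where "u' \<epsilon> z" "aut x' u'"
        using aut_step[OF a(2)] sm unfolding bisim_step_def by blast
      then show ?thesis using IH' x' by blast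
    qed
    show "\<forall>y z. aut x y \<longrightarrow> aut x z \<longrightarrow> y = z"
    proof (intro HOL.allI HOL.impI)
      fix y z assume a: "aut x y" "aut x z"
      show "y = z"
      proof (cases "small x")
        case True
        show ?thesis by (rule ext) (use half[OF a _ True] half[OF a(2,1) _ True] in blast)
      next
        case False
        then show ?thesis using aut_step[OF a(1)] aut_step[OF a(2)] unfolding bisim_step_def by simp
      qed
    qed
  qed
  then show ?thesis using assms by blast
qed

text \<open>The converse relation is a bisimulation as well, and it is here that \<open>s\<close>
  being an involution is used.\<close>

lemma aut_sym: assumes "aut x y" shows "aut y x"
proof -
  define B where "B = rel U U (\<lambda>x y. aut y x)"
  have m: "p \<epsilon> B \<longleftrightarrow> (\<exists>x y. p = op x y \<and> x \<epsilon> U \<and> y \<epsilon> U \<and> aut y x)" for p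
    unfolding B_def by (intro mem_rel fo)
  then have B: "op x y \<epsilon> B \<longleftrightarrow> aut y x" for x y using aut_U by auto
  have "bisim B" unfolding bisim_def B
  proof (intro conjI HOL.allI HOL.impI)
    show "sub B (cart U U)" by (auto simp: sub_def m mem_cart)
    fix x y assume "aut y x"
    then show "bisim_step (\<lambda>x y. aut y x) x y"
      using aut_step[of y x] aut_U[of y x] s_inv[of y] unfolding bisim_step_def by metis
  qed
  then show ?thesis unfolding aut_def using B assms by blast
qed

text \<open>For a set \<open>x\<close>, the images of its elements form a set covered by
  \<open>x\<close>, hence a small subset of \<open>U\<close>, which \<open>U\<close>
  contains.\<close>

lemma aut_total: assumes "x \<epsilon> U" shows "\<exists>y. aut x y"
proof (rule set_induct[where a = U and P = "\<lambda>x. \<exists>y. aut x y", OF _ assms])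
  show "fo (\<lambda>v. \<exists>y. aut (v 0) y)" by (intro fo)
next
  fix x assume x: "x \<epsilon> U" and IH: "\<And>x'. x' \<epsilon> x \<Longrightarrow> x' \<epsilon> U \<Longrightarrow> \<exists>y. aut x' y"
  show "\<exists>y. aut x y"
  proof (cases "small x")
    case False
    then have "aut x (s x)" using x s_U s_ur by (intro autI) (auto simp: bisim_step_def)
    then show ?thesis by blast
  next
    case True
    define z where "z = sep U (\<lambda>y. \<exists>x'. x' \<epsilon> x \<and> aut x' y)"
    have z0: "y \<epsilon> z \<longleftrightarrow> y \<epsilon> U \<and> (\<exists>x'. x' \<epsilon> x \<and> aut x' y)" for y
      unfolding z_def by (intro mem_sep fo)
    then have z: "y \<epsilon> z \<longleftrightarrow> (\<exists>x'. x' \<epsilon> x \<and> aut x' y)" for y using aut_U by blast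
    have "cov x z"
    proof (rule covI[where R = aut])
      show "fo (\<lambda>v. aut (v 0) (v 1))" by (intro fo)
    qed (use aut_unique z in blast)+
    then have "small z" using small_cov True by blast
    moreover from this have "z \<epsilon> U" by (intro U(3)) (auto simp: sub_def z0)
    moreover have "\<exists>y'. y' \<epsilon> z \<and> aut x' y'" if "x' \<epsilon> x" for x'
      using IH[OF that U_trans[OF x that]] z that by blast
    moreover have "\<exists>x'. x' \<epsilon> x \<and> aut x' y'" if "y' \<epsilon> z" for y'
      using z that by blast
    ultimately have "aut x z" using True x by (intro autI) (auto simp: bisim_step_def)
    then show ?thesis by blast
  qed
qed

text \<open>The identity outside \<open>U\<close> keeps \<open>pi\<close> an involution on the whole
  ambient model, so that \<open>pi_pi\<close> and \<open>pi_U\<close> hold without side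
  conditions.\<close>

definition pi :: "'a \<Rightarrow> 'a" where "pi x = (if x \<epsilon> U then THE y. aut x y else x)"

lemma pi_aut: "x \<epsilon> U \<Longrightarrow> aut x (pi x)"
  unfolding pi_def using aut_total aut_unique by (simp add: theI2[of "aut x"]) (metis theI)

lemma aut_pi: "aut x y \<Longrightarrow> pi x = y"
  using pi_aut aut_unique aut_U by blast

lemma tm_pi [fo]: "tm f \<Longrightarrow> tm (\<lambda>v. pi (f v))"
proof (rule tm_comp1[where F = pi])
  have 1: "y = pi x \<longleftrightarrow> aut x y \<or> (\<not> x \<epsilon> U \<and> y = x)" for x y
    using aut_pi[of x y] pi_aut[of x] aut_U[of x y] by (auto simp: pi_def)
  show "tm (\<lambda>v. pi (v 0))" unfolding tm_def 1 by (intro fo)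
qed

lemma pi_pi [simp]: "pi (pi x) = x"
proof (cases "x \<epsilon> U")
  case True
  then show ?thesis using aut_pi aut_sym pi_aut by blast
next
  case False
  then show ?thesis by (simp add: pi_def)
qed

lemma pi_U [simp]: "pi x \<epsilon> U \<longleftrightarrow> x \<epsilon> U"
  using aut_U[OF pi_aut[of x]] aut_U[OF pi_aut[of "pi x"]] by auto

lemma small_pi: "x \<epsilon> U \<Longrightarrow> small (pi x) \<longleftrightarrow> small x"
  using aut_step[OF pi_aut[of x]] unfolding bisim_step_def by blast

lemma pi_ur: "x \<epsilon> U \<Longrightarrow> \<not> small x \<Longrightarrow> pi x = s x"
  using aut_step[OF pi_aut[of x]] unfolding bisim_step_def by blast

lemma mem_pi: assumes "x \<epsilon> U" "small x" shows "z \<epsilon> pi x \<longleftrightarrow> pi z \<epsilon> x"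
proof -
  have b: "(\<forall>x'. x' \<epsilon> x \<longrightarrow> (\<exists>y'. y' \<epsilon> pi x \<and> aut x' y'))"
    "(\<forall>y'. y' \<epsilon> pi x \<longrightarrow> (\<exists>x'. x' \<epsilon> x \<and> aut x' y'))"
    using aut_step[OF pi_aut[OF assms(1)]] assms(2) unfolding bisim_step_def by blast+
  show ?thesis
  proof
    assume "z \<epsilon> pi x"
    then obtain x' where "x' \<epsilon> x" "aut x' z" using b(2) by blast
    then show "pi z \<epsilon> x" using aut_pi[of x' z] pi_pi[of x'] by simp
  next
    assume "pi z \<epsilon> x"
    then obtain y where "y \<epsilon> pi x" "aut (pi z) y" using b(1) by blast
    then show "z \<epsilon> pi x" using aut_pi[of "pi z" y] by simp
  qed
qed

section \<open>Action on classes and invariance of satisfaction\<close>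

definition ipi :: "'a \<Rightarrow> 'a" where "ipi X = img X pi"

lemma mem_ipi [simp]: "z \<epsilon> ipi X \<longleftrightarrow> pi z \<epsilon> X"
proof -
  have "z \<epsilon> ipi X \<longleftrightarrow> (\<exists>x. x \<epsilon> X \<and> z = pi x)"
    unfolding ipi_def by (intro mem_img fo)
  then show ?thesis using pi_pi by metis
qed

lemma ipi_ipi [simp]: "ipi (ipi X) = X" by (rule ext) simp

lemma sub_ipi [simp]: "sub (ipi X) U \<longleftrightarrow> sub X U"
  using pi_U pi_pi mem_ipi unfolding sub_def by metis

lemma all_pi: "(\<forall>x. x \<epsilon> U \<longrightarrow> Q x) \<longleftrightarrow> (\<forall>x. x \<epsilon> U \<longrightarrow> Q (pi x))"
proof
  assume a: "\<forall>x. x \<epsilon> U \<longrightarrow> Q (pi x)"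
  have "Q x" if "x \<epsilon> U" for x using a[rule_format, of "pi x"] that by simp
  then show "\<forall>x. x \<epsilon> U \<longrightarrow> Q x" by blast
qed simp

lemma all_ipi: "(\<forall>X. sub X U \<longrightarrow> Q X) \<longleftrightarrow> (\<forall>X. sub X U \<longrightarrow> Q (ipi X))"
proof
  assume a: "\<forall>X. sub X U \<longrightarrow> Q (ipi X)"
  have "Q X" if "sub X U" for X using a[rule_format, of "ipi X"] that by simp
  then show "\<forall>X. sub X U \<longrightarrow> Q X" by blast
qed simp

text \<open>Since \<open>pi\<close> and \<open>ipi\<close> permute the objects and the classes, a
  quantifier may be reindexed along them.\<close>

lemma csat_pi:
  assumes "\<And>i. v i \<epsilon> U" "\<And>i. sub (V i) U"
  shows "csat M (\<lambda>i. pi (v i)) (\<lambda>i. ipi (V i)) p \<longleftrightarrow> csat M v V p"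
  using assms
proof (induction p arbitrary: v V)
  case (CUr i) then show ?case by (simp add: small_pi)
next
  case (COMem i j)
  have "small (pi (v j)) \<longleftrightarrow> small (v j)" by (rule small_pi[OF COMem(1)])
  moreover have "pi (v i) \<epsilon> pi (v j) \<longleftrightarrow> v i \<epsilon> v j" if "small (v j)"
    using mem_pi[OF COMem(1) that, of "pi (v i)"] by simp
  ultimately show ?case by auto
next
  case (COEq i j) show ?case by simp (metis pi_pi)
next
  case (CEq i j) show ?case by simp (metis ipi_ipi)
next
  case (CImp p q)
  show ?case using CImp.IH(1)[OF CImp.prems] CImp.IH(2)[OF CImp.prems] by simp
next
  case (COAll p)
  have 1: "case_nat (pi x) (\<lambda>i. pi (v i)) = (\<lambda>i. pi (case_nat x v i))" for x
    by (auto split: nat.split)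
  have 2: "csat M (case_nat (pi x) (\<lambda>i. pi (v i))) (\<lambda>i. ipi (V i)) p \<longleftrightarrow> csat M (case_nat x v) V p"
    if "x \<epsilon> U" for x unfolding 1
    by (rule COAll.IH) (use COAll.prems that in \<open>auto split: nat.split\<close>)
  show ?case unfolding csat.simps M_simps Ball_def by (subst all_pi) (simp only: 2 cong: imp_cong)
next
  case (CCAll p)
  have 1: "case_nat (ipi X) (\<lambda>i. ipi (V i)) = (\<lambda>i. ipi (case_nat X V i))" for X
    by (auto split: nat.split)
  have 2: "csat M (\<lambda>i. pi (v i)) (case_nat (ipi X) (\<lambda>i. ipi (V i))) p \<longleftrightarrow> csat M v (case_nat X V) p"
    if "sub X U" for X unfolding 1
    by (rule CCAll.IH) (use CCAll.prems that in \<open>auto split: nat.split\<close>)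
  show ?case unfolding csat.simps M_simps Ball_def by (subst all_ipi) (simp only: 2 cong: imp_cong)
qed auto

text \<open>The automorphism is definable in \<open>E\<close>, so its restriction to
  \<open>X\<close> is a class of \<open>M\<close> and not merely an external bijection.\<close>

lemma equinumerous_ipi: assumes "sub X U" shows "equinumerous M X (ipi X)"
proof -
  define F where "F = rel U U (\<lambda>x y. x \<epsilon> X \<and> y = pi x)"
  have m: "p \<epsilon> F \<longleftrightarrow> (\<exists>x y. p = op x y \<and> x \<epsilon> U \<and> y \<epsilon> U \<and> x \<epsilon> X \<and> y = pi x)" for p
    unfolding F_def by (intro mem_rel fo)
  have rl: "related M F x y \<longleftrightarrow> x \<epsilon> X \<and> y = pi x" if "x \<epsilon> U" "y \<epsilon> U" for x y
    using that by (auto simp: related_M m)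
  have "is_relation M F" unfolding is_relation_def using m is_opair_M by fastforce
  then have "is_bijection M F X (ipi X)"
    unfolding is_bijection_def is_function_def
  proof (intro conjI ballI HOL.impI)
    show "y = z" if "x \<in> Obj M" "y \<in> Obj M" "z \<in> Obj M" "related M F x y" "related M F x z"
      for x y z using that by (simp add: rl)
    show "cmem M x X" "cmem M y (ipi X)"
      if "x \<in> Obj M" "y \<in> Obj M" "related M F x y" for x y using that by (simp_all add: rl)
    show "\<exists>y\<in>Obj M. related M F x y" if "x \<in> Obj M" "cmem M x X" for x
      using that by (intro bexI[of _ "pi x"]) (simp_all add: rl)
    show "\<exists>x\<in>Obj M. related M F x y" if "y \<in> Obj M" "cmem M y (ipi X)" for y
      using that by (intro bexI[of _ "pi y"]) (simp_all add: rl)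
    show "x = x'"
      if x: "x \<in> Obj M" "x' \<in> Obj M" "y \<in> Obj M" "related M F x y" "related M F x' y" for x x' y
    proof -
      have "pi x = pi x'" using x by (simp add: rl)
      then show ?thesis by (metis pi_pi)
    qed
  qed
  moreover have "F \<in> Cls M" by (auto simp: sub_def m)
  ultimately show ?thesis unfolding equinumerous_def by blast
qed

text \<open>Definability gives \<open>h (ipi X) = pi (h X)\<close>, while Hume's Principle gives
  \<open>h (ipi X) = h X\<close> because \<open>X\<close> and its image are equinumerous.\<close>

lemma definable_Hume_fixed:
  assumes h: "Hume_classes M h"
    and p: "\<And>X y. sub X U \<Longrightarrow> y \<epsilon> U \<Longrightarrow> csat M (\<lambda>_. y) (\<lambda>_. X) p \<longleftrightarrow> h X = y"
    and X: "sub X U"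
  shows "pi (h X) = h X"
proof -
  have hU: "h X \<epsilon> U" using h X by (simp add: Hume_classes_def)
  then have "csat M (\<lambda>_. h X) (\<lambda>_. X) p" using p X by blast
  then have "csat M (\<lambda>_. pi (h X)) (\<lambda>_. ipi X) p"
    using csat_pi[of "\<lambda>_. h X" "\<lambda>_. X" p] hU X by simp
  then have "h (ipi X) = pi (h X)" using p[of "ipi X" "pi (h X)"] hU X by simp
  moreover have "h (ipi X) = h X"
  proof -
    have "X \<in> Cls M" "ipi X \<in> Cls M" using X by simp_all
    then show ?thesis using h equinumerous_ipi[OF X] unfolding Hume_classes_def by metis
  qed
  ultimately show ?thesis by simp
qed

end

subsection \<open>Supports\<close>

context zf_inacc
begin

definition ur_trans :: "'a \<Rightarrow> bool" where
  "ur_trans T \<longleftrightarrow> sub T U \<and> (\<forall>x. x \<epsilon> T \<longrightarrow> small x \<longrightarrow> sub x T)"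

lemma fo_ur_trans [fo]: "tm f \<Longrightarrow> fo (\<lambda>v. ur_trans (f v))"
  by (rule fo_comp1[where P = ur_trans]) (unfold ur_trans_def, intro fo)

text \<open>\<open>tc x\<close> is the transitive closure of \<open>{x}\<close> in the sense of \<open>M\<close>.\<close>

definition tc :: "'a \<Rightarrow> 'a" where
  "tc x = sep U (\<lambda>z. \<forall>T. ur_trans T \<and> x \<epsilon> T \<longrightarrow> z \<epsilon> T)"

lemma mem_tc: "z \<epsilon> tc x \<longleftrightarrow> z \<epsilon> U \<and> (\<forall>T. ur_trans T \<and> x \<epsilon> T \<longrightarrow> z \<epsilon> T)"
  unfolding tc_def by (intro mem_sep fo)

lemma tm_tc [fo]: "tm f \<Longrightarrow> tm (\<lambda>v. tc (f v))"
  by (rule tm_comp1[where F = tc]) (unfold tc_def, intro fo)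

lemma ur_trans_tc: "ur_trans (tc x)"
  unfolding ur_trans_def
proof (intro conjI HOL.allI HOL.impI)
  show "sub (tc x) U" by (simp add: sub_def mem_tc)
  fix y assume y: "y \<epsilon> tc x" "small y"
  show "sub y (tc x)" unfolding sub_def
  proof (intro HOL.allI HOL.impI)
    fix z assume z: "z \<epsilon> y"
    have "z \<epsilon> T" if "ur_trans T" "x \<epsilon> T" for T
      using that y z subD[of y T z] unfolding ur_trans_def mem_tc by blast
    moreover have "z \<epsilon> U" using y(1) z U_trans by (auto simp: mem_tc)
    ultimately show "z \<epsilon> tc x" by (simp add: mem_tc)
  qed
qed

lemma self_tc: "x \<epsilon> U \<Longrightarrow> x \<epsilon> tc x"
  by (simp add: mem_tc)

lemma tc_least: "ur_trans T \<Longrightarrow> x \<epsilon> T \<Longrightarrow> sub (tc x) T"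
  by (simp add: sub_def mem_tc)

text \<open>Induction along membership: \<open>{x}\<close> together with the closures of the
  elements of a set \<open>x\<close> is closed, and it is a small union of small sets.\<close>

lemma small_tc: assumes "x \<epsilon> U" shows "small (tc x)"
proof (rule set_induct[where a = U and P = "\<lambda>x. small (tc x)", OF _ assms])
  show "fo (\<lambda>v. small (tc (v 0)))" by (intro fo)
next
  fix x assume x: "x \<epsilon> U" and IH: "\<And>y. y \<epsilon> x \<Longrightarrow> y \<epsilon> U \<Longrightarrow> small (tc y)"
  show "small (tc x)"
  proof (cases "small x")
    case False
    then have "ur_trans (upair x x)" using x by (auto simp: ur_trans_def sub_def)
    then have "sub (tc x) (upair x x)" by (rule tc_least) simp
    then show ?thesis using small_sub small_upair by blast
  next
    case True
    have m: "z \<epsilon> img x tc \<longleftrightarrow> (\<exists>y. y \<epsilon> x \<and> z = tc y)" for z by (intro mem_img fo)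
    have yU: "y \<epsilon> U" if "y \<epsilon> x" for y using U_trans[OF x that] .
    define T where "T = un2 (upair x x) (union_of (img x tc))"
    have T: "z \<epsilon> T \<longleftrightarrow> z = x \<or> (\<exists>y. y \<epsilon> x \<and> z \<epsilon> tc y)" for z by (auto simp: T_def m)
    have "ur_trans T" unfolding ur_trans_def
    proof (intro conjI HOL.allI HOL.impI)
      show "sub T U" using x by (auto simp: sub_def T mem_tc)
      fix z assume z: "z \<epsilon> T" "small z"
      show "sub z T"
      proof (cases "z = x")
        case True
        then show ?thesis using self_tc[OF yU] unfolding sub_def T by blast
      next
        case False
        then obtain y where "y \<epsilon> x" "z \<epsilon> tc y" using z by (auto simp: T)
        then show ?thesis using ur_trans_tc[of y] z(2) subD[of z "tc y"] unfolding ur_trans_def sub_def[of z T] T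
          by blast
      qed
    qed
    then have "sub (tc x) T" by (rule tc_least) (simp add: T)
    moreover have "small (img x tc)" by (rule small_img[OF _ True]) (intro fo)
    then have "small (union_of (img x tc))"
    proof (rule small_union_of)
      fix z assume "z \<epsilon> img x tc"
      then obtain y where "y \<epsilon> x" "z = tc y" using m by blast
      then show "small z" using IH yU by blast
    qed
    then have "small T" unfolding T_def un2_def
      by (intro small_union_of[OF small_upair]) (auto simp: small_upair)
    ultimately show ?thesis using small_sub by blast
  qed
qed

text \<open>Induction inside \<open>tc x\<close>: each \<open>y\<close> there is small and a subset
  of \<open>K\<close>, so \<open>K\<close> contains it.\<close>

lemma pure_K:
  assumes "\<And>z. z \<epsilon> tc x \<Longrightarrow> small z" "x \<epsilon> U" shows "x \<epsilon> K"
proof (rule set_induct[where a = "tc x" and P = "\<lambda>x. x \<epsilon> K"])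
  show "fo (\<lambda>v. v 0 \<epsilon> K)" by (intro fo)
  show "x \<epsilon> tc x" by (rule self_tc[OF assms(2)])
  fix y assume y: "y \<epsilon> tc x" "\<And>z. z \<epsilon> y \<Longrightarrow> z \<epsilon> tc x \<Longrightarrow> z \<epsilon> K"
  have "sub y (tc x)" using ur_trans_tc y(1) assms(1) by (auto simp: ur_trans_def)
  then show "y \<epsilon> K" using y assms(1) by (intro K(3)) (auto simp: sub_def)
qed

text \<open>The urelement outside \<open>T\<close> is \<open>K \<union> {T}\<close>.\<close>

lemma fresh_urelement:
  assumes "small T" "sub T U" shows "\<exists>b. b \<epsilon> U \<and> \<not> small b \<and> \<not> b \<epsilon> T"
proof -
  define b where "b = un2 K (upair T T)"
  have b: "z \<epsilon> b \<longleftrightarrow> z \<epsilon> K \<or> z = T" for z by (auto simp: b_def)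
  have "T \<epsilon> U" using assms U(3) by blast
  then obtain r where r: "r \<epsilon> levels_in U" "T \<epsilon> r" using U(4) by blast
  obtain r' where r': "r' \<epsilon> levels_in U" "K \<epsilon> r'" using U(4)[OF K_U] by blast
  \<comment> \<open>By linearity, the larger of two levels containing \<open>T\<close> and
    \<open>K\<close> contains both; then \<open>b\<close> is a subset of this level and lies in
    \<open>U\<close>.\<close>
  have "\<exists>q. q \<epsilon> levels_in U \<and> T \<epsilon> q \<and> K \<epsilon> q"
    using level_linear[of r r'] r r' level_trans[of r r'] level_trans[of r' r] subD[of r r' T] subD[of r' r K]
    by auto
  then obtain q where q: "q \<epsilon> U" "level q" "T \<epsilon> q" "K \<epsilon> q" by auto
  have "sub b q" using level_trans[OF q(2,4)] q(3) by (auto simp: sub_def b)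
  then have "b \<epsilon> U" using level_potent[OF U(1) q(1)] by blast
  moreover have "\<not> small b" using K_not_small small_sub[of K b] by (auto simp: sub_def b)
  moreover have "\<not> b \<epsilon> T" using not_mem_cycle[of b T] b by blast
  ultimately show ?thesis by blast
qed

text \<open>Otherwise the value \<open>u\<close> has a urelement \<open>a\<close> in its closure.
  Its closure is small, so some urelement \<open>b\<close> lies outside, and swapping
  \<open>a\<close> with \<open>b\<close> cannot fix \<open>u\<close>.\<close>

lemma definable_Hume_K:
  assumes h: "Hume_classes M h"
    and p: "\<And>X y. sub X U \<Longrightarrow> y \<epsilon> U \<Longrightarrow> csat M (\<lambda>_. y) (\<lambda>_. X) p \<longleftrightarrow> h X = y"
    and X: "sub X U"
  shows "h X \<epsilon> K"
proof (rule ccontr)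
  define u where "u = h X"
  assume "\<not> h X \<epsilon> K"
  have u: "u \<epsilon> U" using h X by (simp add: Hume_classes_def u_def)
  obtain a where a: "a \<epsilon> tc u" "\<not> small a"
    using pure_K[OF _ u] \<open>\<not> h X \<epsilon> K\<close> by (auto simp: u_def)
  have aU: "a \<epsilon> U" using a(1) by (simp add: mem_tc)
  obtain b where b: "b \<epsilon> U" "\<not> small b" "\<not> b \<epsilon> tc u"
    using fresh_urelement[OF small_tc[OF u]] ur_trans_tc[of u] by (auto simp: ur_trans_def)
  define s where "s x = (if x = a then b else if x = b then a else x)" for x
  have tm_s: "tm (\<lambda>v. s (v 0))" unfolding s_def by (intro fo)
  interpret I: urelement_involution E k w e s
    by unfold_locales (use tm_s a(2) aU b(1,2) in \<open>auto simp: s_def\<close>)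
  have pu: "I.pi u = u" using I.definable_Hume_fixed[OF h p X] by (simp add: u_def)
  \<comment> \<open>\<open>T\<close> is closed and contains the fixed object \<open>u\<close>, so it
    includes \<open>tc u\<close>. Hence \<open>pi\<close> maps \<open>tc u\<close> into itself and
    would send \<open>a\<close> to \<open>b\<close> inside it.\<close>
  define T where "T = sep U (\<lambda>z. z \<epsilon> tc u \<and> I.pi z \<epsilon> tc u)"
  have T: "z \<epsilon> T \<longleftrightarrow> z \<epsilon> U \<and> z \<epsilon> tc u \<and> I.pi z \<epsilon> tc u" for z
    unfolding T_def by (intro mem_sep fo I.tm_pi)
  have tcD: "y \<epsilon> tc u" if "x \<epsilon> tc u" "small x" "y \<epsilon> x" for x y
    using ur_trans_tc[of u] that subD unfolding ur_trans_def by blast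
  have "ur_trans T" unfolding ur_trans_def
  proof (intro conjI HOL.allI HOL.impI)
    show "sub T U" by (simp add: sub_def T)
    fix x assume x: "x \<epsilon> T" "small x"
    show "sub x T" unfolding sub_def
    proof (intro HOL.allI HOL.impI)
      fix y assume y: "y \<epsilon> x"
      have "I.pi y \<epsilon> I.pi x" using I.mem_pi[of x "I.pi y"] x y by (simp add: T)
      then have "I.pi y \<epsilon> tc u" using tcD[of "I.pi x"] x I.small_pi[of x] by (simp add: T)
      moreover have "y \<epsilon> tc u" using tcD x y by (auto simp: T)
      moreover have "y \<epsilon> U" using x y U_trans by (auto simp: T)
      ultimately show "y \<epsilon> T" by (simp add: T)
    qed
  qed
  moreover have "u \<epsilon> T" using u self_tc pu by (simp add: T)
  ultimately have "a \<epsilon> T" using tc_least a(1) subD by blast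
  then show False using b(3) I.pi_ur[OF aU a(2)] by (simp add: T s_def)
qed

subsection \<open>Counting levels\<close>

text \<open>Cantor's diagonal: \<open>r'\<close> contains \<open>r\<close> and therefore every
  subset of \<open>r\<close>, in particular the diagonal set \<open>d\<close>.\<close>

lemma levels_not_equinumerous:
  assumes "r \<epsilon> levels_in U" "r' \<epsilon> levels_in U" "r \<epsilon> r'" shows "\<not> equinumerous M r r'"
proof
  assume "equinumerous M r r'"
  then obtain F where F: "sub F U" "is_bijection M F r r'" by (auto simp: equinumerous_def)
  have rU: "sub r U" using level_trans[OF U(1)] assms(1) by simp
  define d where "d = sep r (\<lambda>x. \<not> (\<exists>y. op x y \<epsilon> F \<and> x \<epsilon> y))"
  have d: "x \<epsilon> d \<longleftrightarrow> x \<epsilon> r \<and> \<not> (\<exists>y. op x y \<epsilon> F \<and> x \<epsilon> y)" for x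
    unfolding d_def by (intro mem_sep fo)
  have "d \<epsilon> r'" using level_potent[of r' r d] assms by (simp add: sub_def d)
  then have dU: "d \<epsilon> U" using U_trans assms(2) by auto
  obtain x where x: "x \<epsilon> U" "x \<epsilon> r" "op x d \<epsilon> F"
    using F(2) \<open>d \<epsilon> r'\<close> dU by (auto simp: is_bijection_def related_M)
  have "y = d" if "op x y \<epsilon> F" for y
  proof -
    have "y \<epsilon> U" using subD[OF F(1) that] by simp
    then show ?thesis using F(2) that x dU by (auto simp: is_bijection_def is_function_def related_M)
  qed
  then show False using d[of x] x by blast
qed

lemma no_definable_Hume: "\<not> (\<exists>h. Hume_classes M h \<and> definable_map M h)"
proof
  assume "\<exists>h. Hume_classes M h \<and> definable_map M h"
  then obtain h p where h: "Hume_classes M h"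
    and p': "\<forall>X\<in>Cls M. \<forall>y\<in>Obj M. csat M (\<lambda>_. y) (\<lambda>_. X) p \<longleftrightarrow> h X = y"
    unfolding definable_map_def by blast
  then have p: "csat M (\<lambda>_. y) (\<lambda>_. X) p \<longleftrightarrow> h X = y" if "sub X U" "y \<epsilon> U" for X y
    using that by simp
  have rU: "sub r U" if "r \<epsilon> levels_in U" for r using level_trans[OF U(1)] that by simp
  have hU: "h r \<epsilon> U" if "r \<epsilon> levels_in U" for r using h rU[OF that] by (simp add: Hume_classes_def)
  have "cov K (levels_in U)"
  \<comment> \<open>\<open>h\<close> lives outside the model, but \<open>p\<close> supplies an
    internal relation from values in \<open>K\<close> to levels. It is functional because levels
    with the same value are equinumerous, so neither is an element of the other.\<close>
  proof (rule covI[where R = "\<lambda>t r. r \<epsilon> levels_in U \<and> t \<epsilon> U \<and> csat M (\<lambda>_. t) (\<lambda>_. r) p"])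
    show "fo (\<lambda>v. v 1 \<epsilon> levels_in U \<and> v 0 \<epsilon> U \<and> csat M (\<lambda>_. v 0) (\<lambda>_. v 1) p)"
      by (intro fo_conj fo_mem tm_var tm_const fo_csat)
  next
    fix t r r'
    assume a: "r \<epsilon> levels_in U \<and> t \<epsilon> U \<and> csat M (\<lambda>_. t) (\<lambda>_. r) p"
      "r' \<epsilon> levels_in U \<and> t \<epsilon> U \<and> csat M (\<lambda>_. t) (\<lambda>_. r') p"
    then have "h r = t" "h r' = t" using p rU by blast+
    moreover have "r \<in> Cls M" "r' \<in> Cls M" using rU a by simp_all
    ultimately have "equinumerous M r r'" "equinumerous M r' r"
      using h unfolding Hume_classes_def by metis+
    then have "\<not> r \<epsilon> r'" "\<not> r' \<epsilon> r" using levels_not_equinumerous a by blast+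
    then show "r = r'" using level_linear[of r r'] a by auto
  next
    fix r assume r: "r \<epsilon> levels_in U"
    then show "\<exists>t. t \<epsilon> K \<and> r \<epsilon> levels_in U \<and> t \<epsilon> U \<and> csat M (\<lambda>_. t) (\<lambda>_. r) p"
      using definable_Hume_K[OF h p] p rU hU by blast
  qed
  then show False using U(2) by blast
qed

end

subsection \<open>From the axioms to the locales\<close>

lemma zf_model_sat:
  assumes "\<And>p. p \<in> ZFC \<Longrightarrow> sat E v p" shows "zf_model E"
proof
  have "ext_axiom \<in> ZFC" "found_axiom \<in> ZFC" "pairing_axiom \<in> ZFC" "union_axiom \<in> ZFC"
    "power_axiom \<in> ZFC" "choice_axiom \<in> ZFC" and sepr: "\<And>p. separation_axiom p \<in> ZFC"
    "\<And>p. replacement_axiom p \<in> ZFC" by (auto simp: ZFC_def)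
  note ax = this(1-6)[THEN assms]
  fix x y
  show "(\<And>z. E z x \<longleftrightarrow> E z y) \<Longrightarrow> x = y" using ax(1) unfolding sat_ext_axiom by blast
  show "E y x \<Longrightarrow> \<exists>y. E y x \<and> (\<forall>z. E z x \<longrightarrow> \<not> E z y)" using ax(2) unfolding sat_found_axiom by blast
  show "\<exists>p. \<forall>z. E z p \<longleftrightarrow> z = x \<or> z = y" using ax(3) unfolding sat_pairing_axiom s_upair_def by blast
  show "\<exists>u. \<forall>z. E z u \<longleftrightarrow> (\<exists>y. E y x \<and> E z y)" using ax(4) unfolding sat_union_axiom by blast
  show "\<exists>p. \<forall>z. E z p \<longleftrightarrow> (\<forall>t. E t z \<longrightarrow> E t x)"
    using ax(5) unfolding sat_power_axiom s_power_def s_subset_def by blast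
  show "\<exists>c. \<forall>y. E y x \<longrightarrow> (\<exists>!z. E z y \<and> E z c)"
    if "\<And>y. E y x \<Longrightarrow> \<exists>z. E z y" "\<And>y z u. E y x \<Longrightarrow> E z x \<Longrightarrow> E u y \<Longrightarrow> E u z \<Longrightarrow> y = z"
  proof -
    have "(\<forall>y. E y x \<longrightarrow> (\<exists>z. E z y)) \<and>
      (\<forall>y. E y x \<longrightarrow> (\<forall>z. E z x \<longrightarrow> (\<exists>u. E u y \<and> E u z) \<longrightarrow> y = z))"
      using that by blast
    then show ?thesis using ax(6) unfolding sat_choice_axiom by blast
  qed
  fix a w p
  show "\<exists>b. \<forall>x. E x b \<longleftrightarrow> E x a \<and> sat E (case_nat x (case_nat a w)) p"
    using assms[OF sepr(1)] unfolding sat_separation_axiom by blast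
  show "\<exists>b. \<forall>y. E y b \<longleftrightarrow> (\<exists>x. E x a \<and> sat E (case_nat x (case_nat y (case_nat a w))) p)"
    if "\<And>x y z. E x a \<Longrightarrow> sat E (case_nat x (case_nat y (case_nat a w))) p \<Longrightarrow>
          sat E (case_nat x (case_nat z (case_nat a w))) p \<Longrightarrow> y = z"
  proof -
    have "\<forall>x. E x a \<longrightarrow> (\<forall>y z. sat E (case_nat x (case_nat y (case_nat a w))) p \<longrightarrow>
        sat E (case_nat x (case_nat z (case_nat a w))) p \<longrightarrow> y = z)"
      using that by blast
    then show ?thesis using assms[OF sepr(2)[of p]] unfolding sat_replacement_axiom by blast
  qed
qed

context zf_model
begin

lemma s_opair_iff: "s_opair E p x y \<longleftrightarrow> p = op x y"
proof -
  have 1: "s_upair E p x y \<longleftrightarrow> p = upair x y" for p x y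
    unfolding s_upair_def using ext[of p "upair x y"] by auto
  show ?thesis unfolding s_opair_def 1 op_def by auto
qed

lemma s_app_iff: "s_app E f x y \<longleftrightarrow> op x y \<epsilon> f"
  unfolding s_app_def s_opair_iff by auto

lemma zf_inacc_inaccessible:
  assumes k: "s_card E k" "s_regular E k" "s_strong_limit E k" and w: "w \<epsilon> k" "s_omega E w"
  obtains e where "zf_inacc E k w e"
proof -
  have ordk: "s_ord E k" and limw: "s_limit E w" using k w by (auto simp: s_card_def s_omega_def)
  obtain y where y: "y \<epsilon> w" using limw unfolding s_limit_def by blast
  \<comment> \<open>A membership-minimal element of \<open>w\<close> is empty, because
    \<open>w\<close> is transitive.\<close>
  from found[OF y] obtain e where e: "e \<epsilon> w" "\<And>z. z \<epsilon> w \<Longrightarrow> \<not> z \<epsilon> e" by blast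
  have trw: "z \<epsilon> w" if "x \<epsilon> w" "z \<epsilon> x" for x z
    using limw that unfolding s_limit_def s_ord_def s_trans_def s_subset_def by blast
  have trk: "sub a k" if "a \<epsilon> k" for a
    using ordk that unfolding s_ord_def s_trans_def s_subset_def sub_def by blast
  have "zf_inacc E k w e"
  proof
    show "sub a k" if "a \<epsilon> k" for a by (rule trk[OF that])
    show "sub b a" if "a \<epsilon> k" "b \<epsilon> a" for a b
      using ordk that unfolding s_ord_def s_trans_def s_subset_def sub_def by blast
    show "w \<epsilon> k" "e \<epsilon> w" by fact+
    show "\<not> x \<epsilon> e" for x using e(2)[OF trw[OF e(1)]] by blast
    show "un2 y (upair y y) \<epsilon> w" if y: "y \<epsilon> w" for y
    proof -
      obtain s where s: "s \<epsilon> w" "\<And>z. z \<epsilon> s \<longleftrightarrow> z \<epsilon> y \<or> z = y"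
        using limw y unfolding s_limit_def s_succ_def by blast
      have "s = un2 y (upair y y)" by (rule ext) (simp add: s(2))
      then show ?thesis using s by simp
    qed
    show "\<exists>b. b \<epsilon> k \<and> (\<forall>t. t \<epsilon> a \<longrightarrow> F t \<epsilon> b)"
      if a: "a \<epsilon> k" and F: "tm (\<lambda>v. F (v 0))" "\<And>t. t \<epsilon> a \<Longrightarrow> F t \<epsilon> k" for a F
    proof -
      \<comment> \<open>Regularity in the model speaks of functions that are sets, so the definable
        map \<open>F\<close> is coded as one.\<close>
      define f where "f = rel a k (\<lambda>t y. y = F t)"
      have f: "p \<epsilon> f \<longleftrightarrow> (\<exists>x y. p = op x y \<and> x \<epsilon> a \<and> y \<epsilon> k \<and> y = F x)" for p
        unfolding f_def by (intro mem_rel fo tm_comp1[where F = F, OF F(1)])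
      have "s_func E f a k" unfolding s_func_def s_opair_iff s_app_iff
        using F(2) by (auto simp: f)
      then obtain b where "b \<epsilon> k" "\<And>x y. x \<epsilon> a \<Longrightarrow> y \<epsilon> k \<Longrightarrow> op x y \<epsilon> f \<Longrightarrow> y \<epsilon> b"
        using k(2) a unfolding s_regular_def s_app_iff by blast
      then show ?thesis using F(2) by (auto simp: f)
    qed
    show "\<exists>b. b \<epsilon> k \<and> cov b (pow a)" if a: "a \<epsilon> k" for a
    proof -
      obtain b P f where b: "b \<epsilon> k" "s_power E P a" "s_bij E f P b"
        using k(3) a unfolding s_strong_limit_def by blast
      have P: "x \<epsilon> P \<longleftrightarrow> sub x a" for x
        using b(2) unfolding s_power_def s_subset_def sub_def by blast
      have "cov b (pow a)"
      \<comment> \<open>The bijection leads from the power set to \<open>b\<close>, so the covering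
        uses it backwards.\<close>
      proof (rule covI[where R = "\<lambda>t y. t \<epsilon> b \<and> y \<epsilon> P \<and> op y t \<epsilon> f"])
        show "fo (\<lambda>v. v 0 \<epsilon> b \<and> v 1 \<epsilon> P \<and> op (v 1) (v 0) \<epsilon> f)" by (intro fo)
        show "y = z" if "t \<epsilon> b \<and> y \<epsilon> P \<and> op y t \<epsilon> f" "t \<epsilon> b \<and> z \<epsilon> P \<and> op z t \<epsilon> f" for t y z
          using b(3) that unfolding s_bij_def s_app_iff by blast
        show "\<exists>t. t \<epsilon> b \<and> t \<epsilon> b \<and> y \<epsilon> P \<and> op y t \<epsilon> f" if "y \<epsilon> pow a" for y
          using b(3) that P unfolding s_bij_def s_func_def s_app_iff by auto
      qed
      then show ?thesis using b by blast
    qed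
  qed
  then show ?thesis by (rule that)
qed

end

theorem theorem14:
  assumes "consistent (insert inaccessible_axiom ZFC)"
  shows "\<exists>M :: (nat, nat) class_structure. KMCU_model M \<and>
    \<not> (\<exists>h. Hume_classes M h \<and> definable_map M h)"
proof -
  \<comment> \<open>Elements of \<open>E\<close> serve both as objects and as classes, so both sorts
    of the final structure live on \<open>nat\<close>.\<close>
  obtain E :: "nat \<Rightarrow> nat \<Rightarrow> bool" and v
    where sat: "\<And>p. p \<in> insert inaccessible_axiom ZFC \<Longrightarrow> sat E v p"
    using ZFC_nat_model[OF assms subset_insertI] by blast
  interpret zf_model E by (rule zf_model_sat) (use sat in blast)
  obtain k w where "s_card E k" "s_regular E k" "s_strong_limit E k" "E w k" "s_omega E w"
    using sat[OF insertI1] unfolding sat_inaccessible_axiom by blast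
  then obtain e where "zf_inacc E k w e" by (rule zf_inacc_inaccessible)
  then interpret zf_inacc E k w e .
  show ?thesis using KMCU_M no_definable_Hume by blast
qed

end
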